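(* Let $0<\delta<1$ and suppose $d$ is sufficiently large. Under the five assumptions stated in the context ($\mathbf g$-relevant Hessian boundedness, Lipschitz Hessian, Krylov subspace regularity I and II, and the spectral assumption (5)), after at most $\max\{\tilde{\mathcal O}(\varepsilon_g^{-3/2}),\mathcal O(\varepsilon_H^{-7/2})\}$ gradient and Hessian-vector product evaluations, the second-order Newton-MR method (Algorithm B in the context) satisfies the approximate second-order optimality condition $\|\nabla f(\mathbf x_k)\|\le\varepsilon_g$ and $\lambda_{\min}(\nabla^2f(\mathbf x_k))\ge-\varepsilon_H$ with probability $1-\delta$.
   Context: Setting: $f:\mathbb R^d\to\mathbb R$ is twice continuously differentiable and attains its minimum; $\mathbf g(\mathbf x)=\nabla f(\mathbf x)$, $\mathbf H(\mathbf x)=\nabla^2 f(\mathbf x)$, $\mathbf g_k=\mathbf g(\mathbf x_k)$, $\mathbf H_k=\mathbf H(\mathbf x_k)$; $\|\cdot\|$ is the Euclidean/spectral norm. Exact arithmetic is assumed. Each outer iteration evaluates one gradient and each MINRES iteration costs one Hessian-vector product; function evaluations in the line-search are not counted. $\mathcal O(\cdot)$ refers to $\varepsilon_g,\varepsilon_H\to0$ with hidden constants not depending on $\varepsilon_g,\varepsilon_H$; $\tilde{\mathcal O}$ additionally hides logarithmic factors. "$d$ sufficiently large" means that the trivial bound of MINRES iterations by $d$ is not the active bound. MINRES. For a symmetric $\mathbf H$ and $\mathbf g\ne\mathbf 0$ let $\mathcal K_t(\mathbf H,\mathbf g)=\mathrm{Span}\{\mathbf g,\mathbf H\mathbf g,\dots,\mathbf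 H^{t-1}\mathbf g\}$; the grade $g$ of $\mathbf g$ with respect to $\mathbf H$ is the integer with $\dim\mathcal K_t=\min\{t,g\}$ for all $t\ge1$. The MINRES iterates are $\mathbf s_0=\mathbf 0$, $\mathbf s_t=\arg\min_{\mathbf s\in\mathcal K_t(\mathbf H,\mathbf g)}\|\mathbf H\mathbf s+\mathbf g\|^2$ (if the minimizer is not unique, which can only occur at $t=g$ with $\mathbf g\notin\mathrm{Range}(\mathbf H)$, then $\mathbf s_g=\mathbf s_{g-1}$), with residuals $\mathbf r_t=-\mathbf g-\mathbf H\mathbf s_t$. The NPC (nonpositive curvature) condition is detected at iteration $t$ if $\mathbf r_{t-1}\neq\mathbf 0$ and $\langle\mathbf r_{t-1},\mathbf H\mathbf r_{t-1}\rangle\le0$. The procedure MINRES$(\mathbf H,\mathbf g,\eta)$ does, for $t=1,2,\dots$: if the NPC condition is detected at iteration $t$, return $\mathbf d=\mathbf r_{t-1}$ with flag `NPC'; otherwise, if $\|\mathbf H\mathbf r_{t-1}\|\le\eta\|\mathbf H\mathbf s_{t-1}\|$, return $\mathbf d=\mathbf s_{t-1}$ with flag `SOL'; otherwise continue. Algorithm B (second-order Newton-MR). Inputs: $\mathbf x_0\in\mathbb R^d$, $0<\varepsilon_g\le1$, $0<\varepsilon_H\le1$, $\theta>0$, line-search parameters $0<\rho_S<1/2$, $0<\rho_N<1$, $0<\rho_C<1$. For $k=0,1,\dots$: (a) If $\|\mathbf g_k\|>\varepsilon_g$: call MINRES$(\mathbf H_k,\mathbf g_k,\theta\sqrt{\varepsilon_g})$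 to get $\mathbf d_k$ and a flag. If `SOL', $\alpha_k$ is the largest $0<\alpha\le1$ with $f(\mathbf x_k+\alpha\mathbf d_k)\le f(\mathbf x_k)+\rho_S\,\alpha\langle\mathbf g_k,\mathbf d_k\rangle$; if `NPC', $\alpha_k$ is the largest $\alpha>0$ with $f(\mathbf x_k+\alpha\mathbf d_k)\le f(\mathbf x_k)+\rho_N\,\alpha\langle\mathbf g_k,\mathbf d_k\rangle$. (b) If $\|\mathbf g_k\|\le\varepsilon_g$: draw $\tilde{\mathbf g}$ from the uniform distribution on the unit sphere (a fresh draw each time) and call MINRES$(\mathbf H_k+\tfrac{\varepsilon_H}{2}\mathbf I,\tilde{\mathbf g},0)$. If the flag is `SOL', terminate. If it is `NPC' with returned vector $\mathbf r$, set $\mathbf d_k=-\mathrm{Sign}(\langle\mathbf g_k,\mathbf r\rangle)\,\mathbf r/\|\mathbf r\|$ (with $\mathrm{Sign}(0)$ chosen arbitrarily as $\pm1$), and let $\alpha_k$ be the largest $\alpha>0$ with $f(\mathbf x_k+\alpha\mathbf d_k)\le f(\mathbf x_k)+\tfrac12\rho_C\,\alpha^2\langle\mathbf d_k,\mathbf H_k\mathbf d_k\rangle$. Set $\mathbf x_{k+1}=\mathbf x_k+\alpha_k\mathbf d_k$. Spectral notation. An eigenvalue $\lambda$ of $\mathbf H$ is $\mathbf g$-relevant if $\mathbf g$ is not orthogonal to $\mathrm{Null}(\mathbf H-\lambda\mathbf I)$. Let $\psi_+,\psi_-,\psi_0$ be the numbers of distinct positive, negative, zero $\mathbf g$-relevant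 eigenvalues, $\psi=\psi_++\psi_-+\psi_0$, labelled $\lambda_1>\dots>\lambda_{\psi_+}>0>\lambda_{\psi_++\psi_0+1}>\dots>\lambda_\psi$. $\mathbf U$, $\mathbf U_{i+}$ ($1\le i\le\psi_+$), $\mathbf U_{j-}$ ($\psi_++\psi_0+1\le j\le\psi$) are matrices whose columns form orthonormal eigenvector bases of, respectively, the sum of the eigenspaces of all nonzero $\mathbf g$-relevant eigenvalues, of $\lambda_1,\dots,\lambda_i$, and of $\lambda_j,\dots,\lambda_\psi$. Assumptions. (1) There is $0\le L_g<\infty$ with $\|\mathbf U^\top\mathbf H(\mathbf x)\mathbf U\|\le L_g$ for all $\mathbf x\in\mathbb R^d$. (2) $\|\nabla^2f(\mathbf x)-\nabla^2f(\mathbf y)\|\le L_H\|\mathbf x-\mathbf y\|$ for all $\mathbf x,\mathbf y$, with $0\le L_H<\infty$. (3) Krylov subspace regularity I: there is $\sigma>0$ such that for every $\mathbf x$ and every $t\le g$, if the NPC condition has not been detected at iterations $1,\dots,t$ of MINRES applied to $\mathbf H(\mathbf x),\mathbf g(\mathbf x)$, then $\langle\mathbf s,\mathbf H(\mathbf x)\mathbf s\rangle\ge\sigma\|\mathbf s\|^2$ for all $\mathbf s\in\mathcal K_t(\mathbf H(\mathbf x),\mathbf g(\mathbf x))$. (4) Krylov subspace regularity II: there is $\omega>0$ such that for every iterate $\mathbf x_k$ of the algorithm at which the MINRES call in (a) returns `NPC', $\|\mathbf d_k\|\ge\omega\|\mathbf g_k\|$. (5) There exist $\mu>0$ and $L_g^2/(L_g^2+\theta^2\varepsilon_g)\le\nu\le1$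 such that for any $\mathbf x\in\mathbb R^d$ with $\mathbf g\notin\mathrm{Null}(\mathbf H)$ at least one of the following holds: (i) $\psi_+\ge1$, $\psi_-\ge1$ and there are $1\le i\le\psi_+$, $\psi_++\psi_0+1\le j\le\psi$ with $\min\{\lambda_i,|\lambda_j|\}\ge\mu$ and $\|(\mathbf U_{i+}\mathbf U_{i+}^\top+\mathbf U_{j-}\mathbf U_{j-}^\top)\mathbf g\|^2\ge\nu\|\mathbf U\mathbf U^\top\mathbf g\|^2$; (ii) $\psi_+\ge1$ and there is $1\le i\le\psi_+$ with $\lambda_i\ge\mu$ and $\|\mathbf U_{i+}\mathbf U_{i+}^\top\mathbf g\|^2\ge\nu\|\mathbf U\mathbf U^\top\mathbf g\|^2$; (iii) $\psi_-\ge1$ and there is $\psi_++\psi_0+1\le j\le\psi$ with $|\lambda_j|\ge\mu$ and $\|\mathbf U_{j-}\mathbf U_{j-}^\top\mathbf g\|^2\ge\nu\|\mathbf U\mathbf U^\top\mathbf g\|^2$. *)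

theory Defs
  imports "HOL-Probability.Probability"
begin

section \<open>The spaces \<open>\<real>\<^sup>d\<close> inside one type\<close>

text \<open>
  The complexity constants have to be chosen before the dimension \<open>d\<close> (otherwise they could absorb
  the trivial bound of MINRES iterations by \<open>d\<close>), so \<open>d\<close> is a natural number and not a type.
  The type of finitely supported real sequences with the Euclidean inner product contains every
  \<open>\<real>\<^sup>d\<close>, namely as the subspace of the sequences that vanish from index \<open>d\<close> on.
\<close>

typedef rseq = "{x :: nat \<Rightarrow> real. finite {i. x i \<noteq> 0}}"
  morphisms coord mk_rseq
  by (rule exI[of _ "\<lambda>_. 0"]) simp

lemma finite_coord: "finite {i. coord x i \<noteq> 0}"
  using coord[of x] by simp

lemma rseq_eqI: "(\<And>i. coord x i = coord y i) \<Longrightarrow> x = y"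
  by (simp add: coord_inject[symmetric] fun_eq_iff)

lemma coord_mk: "finite {i. h i \<noteq> 0} \<Longrightarrow> coord (mk_rseq h) = h"
  by (simp add: mk_rseq_inverse)

instantiation rseq :: real_vector
begin

definition "0 = mk_rseq (\<lambda>_. 0)"
definition "x + y = mk_rseq (\<lambda>i. coord x i + coord y i)"
definition "x - y = mk_rseq (\<lambda>i. coord x i - coord y i)"
definition "- x = mk_rseq (\<lambda>i. - coord x i)"
definition "a *\<^sub>R x = mk_rseq (\<lambda>i. a * coord x i)"

lemma coord_zero [simp]: "coord 0 i = 0"
  by (simp add: zero_rseq_def coord_mk)

lemma coord_add [simp]: "coord (x + y) i = coord x i + coord y i"
proof -
  have "finite {i. coord x i + coord y i \<noteq> 0}"
    by (rule finite_subset[OF _ finite_UnI[OF finite_coord[of x] finite_coord[of y]]]) auto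
  then show ?thesis by (simp add: plus_rseq_def coord_mk)
qed

lemma coord_diff [simp]: "coord (x - y) i = coord x i - coord y i"
proof -
  have "finite {i. coord x i - coord y i \<noteq> 0}"
    by (rule finite_subset[OF _ finite_UnI[OF finite_coord[of x] finite_coord[of y]]]) auto
  then show ?thesis by (simp add: minus_rseq_def coord_mk)
qed

lemma coord_uminus [simp]: "coord (- x) i = - coord x i"
  using finite_coord[of x] by (simp add: uminus_rseq_def coord_mk)

lemma coord_scaleR [simp]: "coord (a *\<^sub>R x) i = a * coord x i"
proof -
  have "finite {i. a * coord x i \<noteq> 0}"
    by (rule finite_subset[OF _ finite_coord[of x]]) auto
  then show ?thesis by (simp add: scaleR_rseq_def coord_mk)
qed

instance
  by standard (auto intro!: rseq_eqI simp: algebra_simps)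

end

instantiation rseq :: real_inner
begin

definition "inner x y = (\<Sum>i | coord x i \<noteq> 0. coord x i * coord y i)"
definition "norm x = sqrt (inner x x)" for x :: rseq
definition "dist x y = norm (x - y)" for x y :: rseq
definition "sgn x = x /\<^sub>R norm x" for x :: rseq
definition "(uniformity :: (rseq \<times> rseq) filter) = (INF e\<in>{0<..}. principal {(x, y). dist x y < e})"
definition "open (U :: rseq set) \<longleftrightarrow> (\<forall>x\<in>U. \<forall>\<^sub>F (x', y) in uniformity. x' = x \<longrightarrow> y \<in> U)"

lemma inner_rseq_sum:
  assumes "finite S" "{i. coord x i \<noteq> 0} \<subseteq> S"
  shows "inner x y = (\<Sum>i\<in>S. coord x i * coord y i)"
  unfolding inner_rseq_def using assms by (intro sum.mono_neutral_left) auto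

instance
proof
  fix x y z :: rseq and a :: real
  define S where "S = {i. coord x i \<noteq> 0} \<union> {i. coord y i \<noteq> 0}"
  have S: "finite S" "{i. coord x i \<noteq> 0} \<subseteq> S" "{i. coord y i \<noteq> 0} \<subseteq> S"
    "{i. coord (x + y) i \<noteq> 0} \<subseteq> S" "{i. coord (a *\<^sub>R x) i \<noteq> 0} \<subseteq> S"
    by (auto simp: S_def finite_coord)
  show "inner x y = inner y x"
    using S by (simp add: inner_rseq_sum[of S] mult.commute)
  show "inner (x + y) z = inner x z + inner y z"
    using S by (simp add: inner_rseq_sum[of S] sum.distrib algebra_simps)
  show "inner (a *\<^sub>R x) y = a * inner x y"
    using S by (simp add: inner_rseq_sum[of S] sum_distrib_left algebra_simps)
  show "0 \<le> inner x x"
    by (simp add: inner_rseq_def sum_nonneg)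
  show "(inner x x = 0) = (x = 0)"
  proof
    assume "inner x x = 0"
    then have "\<forall>i\<in>{i. coord x i \<noteq> 0}. coord x i * coord x i = 0"
      unfolding inner_rseq_def by (subst (asm) sum_nonneg_eq_0_iff) (auto simp: finite_coord)
    then show "x = 0" by (auto intro!: rseq_eqI)
  qed (simp add: inner_rseq_def)
qed (rule norm_rseq_def dist_rseq_def sgn_rseq_def uniformity_rseq_def open_rseq_def)+

end

definition Rn :: "nat \<Rightarrow> rseq set" where
  "Rn d = {x. \<forall>i\<ge>d. coord x i = 0}"

definition vec_of :: "nat \<Rightarrow> (nat \<Rightarrow> real) \<Rightarrow> rseq" where
  "vec_of d y = mk_rseq (\<lambda>i. if i < d then y i else 0)"

lemma coord_vec_of: "coord (vec_of d y) i = (if i < d then y i else 0)"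
  by (simp add: vec_of_def coord_mk)

lemma subspace_Rn: "subspace (Rn d)"
  by (auto simp: Rn_def subspace_def)

lemma inner_Rn: "x \<in> Rn d \<Longrightarrow> inner x y = (\<Sum>i<d. coord x i * coord y i)"
  by (rule inner_rseq_sum) (auto simp: Rn_def, meson not_less)

text \<open>Uniform distribution on the unit sphere of \<open>\<real>\<^sup>d\<close>: the normalised cone measure, i.e. the
  image of the uniform distribution on the (punctured) unit ball under \<open>x \<mapsto> x / \<parallel>x\<parallel>\<close>.\<close>

definition sphere_uniform :: "nat \<Rightarrow> rseq measure" where
  "sphere_uniform d =
     distr (uniform_measure (\<Pi>\<^sub>M i\<in>{..<d}. lborel)
              {y \<in> space (\<Pi>\<^sub>M i\<in>{..<d}. lborel). 0 < norm (vec_of d y) \<and> norm (vec_of d y) \<le> 1})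
       borel (\<lambda>y. sgn (vec_of d y))"

text \<open>One independent draw for each outer iteration; the draw is only looked at if the gradient
  there is small.\<close>

definition draws :: "nat \<Rightarrow> (nat \<Rightarrow> rseq) measure" where
  "draws d = (\<Pi>\<^sub>M k\<in>UNIV. sphere_uniform d)"


section \<open>Twice continuously differentiable functions on a subspace\<close>

definition C2_on ::
  "'a::real_inner set \<Rightarrow> ('a \<Rightarrow> real) \<Rightarrow> ('a \<Rightarrow> 'a) \<Rightarrow> ('a \<Rightarrow> 'a \<Rightarrow> 'a) \<Rightarrow> bool" where
  "C2_on V f g H \<longleftrightarrow>
     (\<forall>x\<in>V. g x \<in> V \<and> (f has_derivative (\<lambda>h. inner (g x) h)) (at x within V)) \<and>
     (\<forall>x\<in>V. H x ` V \<subseteq> V \<and> (g has_derivative H x) (at x within V)) \<and>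
     (\<forall>v\<in>V. continuous_on V (\<lambda>x. H x v))"

definition opnorm_on :: "'a::real_normed_vector set \<Rightarrow> ('a \<Rightarrow> 'a) \<Rightarrow> real" where
  "opnorm_on V A = (SUP v\<in>V. norm (A v) / norm v)"


section \<open>Spectral notation\<close>

definition eigenspace :: "'a::real_inner set \<Rightarrow> ('a \<Rightarrow> 'a) \<Rightarrow> real \<Rightarrow> 'a set" where
  "eigenspace V A l = {v \<in> V. A v = l *\<^sub>R v}"

definition eigenvalues :: "'a::real_inner set \<Rightarrow> ('a \<Rightarrow> 'a) \<Rightarrow> real set" where
  "eigenvalues V A = {l. \<exists>v\<in>eigenspace V A l. v \<noteq> 0}"

definition lambda_min :: "'a::real_inner set \<Rightarrow> ('a \<Rightarrow> 'a) \<Rightarrow> real" where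
  "lambda_min V A = Min (eigenvalues V A)"

definition relevant :: "'a::real_inner set \<Rightarrow> ('a \<Rightarrow> 'a) \<Rightarrow> 'a \<Rightarrow> real set" where
  "relevant V A b = {l \<in> eigenvalues V A. \<not> (\<forall>v\<in>eigenspace V A l. orthogonal b v)}"

definition psi_pos :: "'a::real_inner set \<Rightarrow> ('a \<Rightarrow> 'a) \<Rightarrow> 'a \<Rightarrow> nat" where
  "psi_pos V A b = card {l \<in> relevant V A b. l > 0}"

definition psi_neg :: "'a::real_inner set \<Rightarrow> ('a \<Rightarrow> 'a) \<Rightarrow> 'a \<Rightarrow> nat" where
  "psi_neg V A b = card {l \<in> relevant V A b. l < 0}"

definition psi_zero :: "'a::real_inner set \<Rightarrow> ('a \<Rightarrow> 'a) \<Rightarrow> 'a \<Rightarrow> nat" where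
  "psi_zero V A b = card {l \<in> relevant V A b. l = 0}"

definition psi :: "'a::real_inner set \<Rightarrow> ('a \<Rightarrow> 'a) \<Rightarrow> 'a \<Rightarrow> nat" where
  "psi V A b = psi_pos V A b + psi_neg V A b + psi_zero V A b"

text \<open>The relevant eigenvalues in decreasing order, indexed from 1.\<close>

definition lam :: "'a::real_inner set \<Rightarrow> ('a \<Rightarrow> 'a) \<Rightarrow> 'a \<Rightarrow> nat \<Rightarrow> real" where
  "lam V A b i = rev (sorted_list_of_set (relevant V A b)) ! (i - 1)"

text \<open>A matrix with orthonormal columns is represented by the set of its columns; the choice of
  the basis does not influence any of the quantities below.\<close>

definition eigbasis :: "'a::real_inner set \<Rightarrow> ('a \<Rightarrow> 'a) \<Rightarrow> real set \<Rightarrow> 'a set" where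
  "eigbasis V A L =
     (SOME B. finite B \<and> pairwise orthogonal B \<and>
        (\<forall>u\<in>B. norm u = 1 \<and> (\<exists>l\<in>L. u \<in> eigenspace V A l)) \<and>
        span B = span (\<Union>l\<in>L. eigenspace V A l))"

definition U_all :: "'a::real_inner set \<Rightarrow> ('a \<Rightarrow> 'a) \<Rightarrow> 'a \<Rightarrow> 'a set" where
  "U_all V A b = eigbasis V A (relevant V A b - {0})"

definition U_pos :: "'a::real_inner set \<Rightarrow> ('a \<Rightarrow> 'a) \<Rightarrow> 'a \<Rightarrow> nat \<Rightarrow> 'a set" where
  "U_pos V A b i = eigbasis V A (lam V A b ` {1..i})"

definition U_neg :: "'a::real_inner set \<Rightarrow> ('a \<Rightarrow> 'a) \<Rightarrow> 'a \<Rightarrow> nat \<Rightarrow> 'a set" where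
  "U_neg V A b j = eigbasis V A (lam V A b ` {j..psi V A b})"

text \<open>\<open>U U\<^sup>\<top> b\<close> for the matrix \<open>U\<close> with set of columns \<open>B\<close>.\<close>

definition UUt :: "'a::real_inner set \<Rightarrow> 'a \<Rightarrow> 'a" where
  "UUt B b = (\<Sum>u\<in>B. inner u b *\<^sub>R u)"

text \<open>Spectral norm of \<open>U\<^sup>\<top> A U\<close>, the matrix with entries \<open>\<langle>u, A w\<rangle>\<close> for columns \<open>u, w\<close>.\<close>

definition UtAU_norm :: "'a::real_inner set \<Rightarrow> ('a \<Rightarrow> 'a) \<Rightarrow> real" where
  "UtAU_norm B A =
     (SUP c :: 'a \<Rightarrow> real. L2_set (\<lambda>u. \<Sum>w\<in>B. inner u (A w) * c w) B / L2_set c B)"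


section \<open>MINRES\<close>

definition krylov :: "('a::real_inner \<Rightarrow> 'a) \<Rightarrow> 'a \<Rightarrow> nat \<Rightarrow> 'a set" where
  "krylov A b t = span ((\<lambda>i. (A ^^ i) b) ` {..<t})"

definition grade :: "('a::real_inner \<Rightarrow> 'a) \<Rightarrow> 'a \<Rightarrow> nat" where
  "grade A b = (THE m. \<forall>t\<ge>1. dim (krylov A b t) = min t m)"

definition minres_argmin :: "('a::real_inner \<Rightarrow> 'a) \<Rightarrow> 'a \<Rightarrow> nat \<Rightarrow> 'a \<Rightarrow> bool" where
  "minres_argmin A b t s \<longleftrightarrow>
     s \<in> krylov A b t \<and> (\<forall>s'\<in>krylov A b t. (norm (A s + b))\<^sup>2 \<le> (norm (A s' + b))\<^sup>2)"

primrec minres_s :: "('a::real_inner \<Rightarrow> 'a) \<Rightarrow> 'a \<Rightarrow> nat \<Rightarrow> 'a" where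
  "minres_s A b 0 = 0"
| "minres_s A b (Suc t) =
     (if \<exists>!s. minres_argmin A b (Suc t) s then THE s. minres_argmin A b (Suc t) s
      else minres_s A b t)"

definition minres_r :: "('a::real_inner \<Rightarrow> 'a) \<Rightarrow> 'a \<Rightarrow> nat \<Rightarrow> 'a" where
  "minres_r A b t = - b - A (minres_s A b t)"

definition npc_at :: "('a::real_inner \<Rightarrow> 'a) \<Rightarrow> 'a \<Rightarrow> nat \<Rightarrow> bool" where
  "npc_at A b t \<longleftrightarrow>
     minres_r A b (t - 1) \<noteq> 0 \<and> inner (minres_r A b (t - 1)) (A (minres_r A b (t - 1))) \<le> 0"

definition sol_at :: "('a::real_inner \<Rightarrow> 'a) \<Rightarrow> 'a \<Rightarrow> real \<Rightarrow> nat \<Rightarrow> bool" where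
  "sol_at A b \<eta> t \<longleftrightarrow> norm (A (minres_r A b (t - 1))) \<le> \<eta> * norm (A (minres_s A b (t - 1)))"

text \<open>The iteration in which the procedure returns; this is also its number of iterations.\<close>

definition minres_iters :: "('a::real_inner \<Rightarrow> 'a) \<Rightarrow> 'a \<Rightarrow> real \<Rightarrow> nat" where
  "minres_iters A b \<eta> = (LEAST t. 1 \<le> t \<and> (npc_at A b t \<or> sol_at A b \<eta> t))"

datatype flag = NPC | SOL

definition minres :: "('a::real_inner \<Rightarrow> 'a) \<Rightarrow> 'a \<Rightarrow> real \<Rightarrow> flag \<times> 'a" where
  "minres A b \<eta> =
     (let t = minres_iters A b \<eta> in
      if npc_at A b t then (NPC, minres_r A b (t - 1)) else (SOL, minres_s A b (t - 1)))"


section \<open>The second-order Newton-MR method\<close>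

record params =
  eps_g :: real
  eps_H :: real
  theta :: real
  rho_S :: real
  rho_N :: real
  rho_C :: real

definition shifted :: "params \<Rightarrow> ('a::real_inner \<Rightarrow> 'a) \<Rightarrow> 'a \<Rightarrow> 'a" where
  "shifted P A v = A v + (eps_H P / 2) *\<^sub>R v"

text \<open>The MINRES call of an outer iteration at the point \<open>x\<close> with random draw \<open>q\<close>, and the
  number of its iterations.\<close>

definition minres_call ::
  "params \<Rightarrow> ('a::real_inner \<Rightarrow> 'a) \<Rightarrow> ('a \<Rightarrow> 'a \<Rightarrow> 'a) \<Rightarrow> 'a \<Rightarrow> 'a \<Rightarrow> flag \<times> 'a" where
  "minres_call P g H q x =
     (if norm (g x) > eps_g P then minres (H x) (g x) (theta P * sqrt (eps_g P))
      else minres (shifted P (H x)) q 0)"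

definition call_iters ::
  "params \<Rightarrow> ('a::real_inner \<Rightarrow> 'a) \<Rightarrow> ('a \<Rightarrow> 'a \<Rightarrow> 'a) \<Rightarrow> 'a \<Rightarrow> 'a \<Rightarrow> nat" where
  "call_iters P g H q x =
     (if norm (g x) > eps_g P then minres_iters (H x) (g x) (theta P * sqrt (eps_g P))
      else minres_iters (shifted P (H x)) q 0)"

definition Sign :: "real \<Rightarrow> real \<Rightarrow> real" where
  "Sign z c = (if c = 0 then z else sgn c)"

text \<open>One outer iteration; \<open>z\<close> is the value used for \<open>Sign(0)\<close>, and \<open>None\<close> means that the method
  terminates.\<close>

definition newton_mr_step ::
  "params \<Rightarrow> ('a::real_inner \<Rightarrow> real) \<Rightarrow> ('a \<Rightarrow> 'a) \<Rightarrow> ('a \<Rightarrow> 'a \<Rightarrow> 'a) \<Rightarrow> real \<Rightarrow> 'a \<Rightarrow> 'a \<Rightarrow> 'a option"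
where
  "newton_mr_step P f g H z q x =
     (case minres_call P g H q x of (flg, r) \<Rightarrow>
        if norm (g x) > eps_g P then
          (case flg of
             SOL \<Rightarrow>
               Some (x + (GREATEST \<alpha>. 0 < \<alpha> \<and> \<alpha> \<le> 1 \<and>
                            f (x + \<alpha> *\<^sub>R r) \<le> f x + rho_S P * \<alpha> * inner (g x) r) *\<^sub>R r)
           | NPC \<Rightarrow>
               Some (x + (GREATEST \<alpha>. 0 < \<alpha> \<and>
                            f (x + \<alpha> *\<^sub>R r) \<le> f x + rho_N P * \<alpha> * inner (g x) r) *\<^sub>R r))
        else
          (case flg of
             SOL \<Rightarrow> None
           | NPC \<Rightarrow>
               (let dir = - (Sign z (inner (g x) r) *\<^sub>R (r /\<^sub>R norm r)) in
                Some (x + (GREATEST \<alpha>. 0 < \<alpha> \<and>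
                             f (x + \<alpha> *\<^sub>R dir)
                               \<le> f x + 1 / 2 * rho_C P * \<alpha>\<^sup>2 * inner dir (H x dir)) *\<^sub>R dir))))"

primrec newton_mr ::
  "params \<Rightarrow> ('a::real_inner \<Rightarrow> real) \<Rightarrow> ('a \<Rightarrow> 'a) \<Rightarrow> ('a \<Rightarrow> 'a \<Rightarrow> 'a) \<Rightarrow> (nat \<Rightarrow> real) \<Rightarrow> 'a \<Rightarrow>
   (nat \<Rightarrow> 'a) \<Rightarrow> nat \<Rightarrow> 'a option"
where
  "newton_mr P f g H z x0 \<xi> 0 = Some x0"
| "newton_mr P f g H z x0 \<xi> (Suc k) =
     (case newton_mr P f g H z x0 \<xi> k of
        None \<Rightarrow> None
      | Some x \<Rightarrow> newton_mr_step P f g H (z k) (\<xi> k) x)"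

text \<open>Gradient and Hessian-vector product evaluations up to the point \<open>x\<^sub>k\<close>: the gradients at
  \<open>x\<^sub>0, \<dots>, x\<^sub>k\<close> and one Hessian-vector product for each MINRES iteration of the outer iterations
  \<open>0, \<dots>, k - 1\<close>.\<close>

definition evals ::
  "params \<Rightarrow> ('a::real_inner \<Rightarrow> real) \<Rightarrow> ('a \<Rightarrow> 'a) \<Rightarrow> ('a \<Rightarrow> 'a \<Rightarrow> 'a) \<Rightarrow> (nat \<Rightarrow> real) \<Rightarrow> 'a \<Rightarrow>
   (nat \<Rightarrow> 'a) \<Rightarrow> nat \<Rightarrow> nat"
where
  "evals P f g H z x0 \<xi> k =
     (k + 1) + (\<Sum>j<k. case newton_mr P f g H z x0 \<xi> j of
                        None \<Rightarrow> 0 | Some x \<Rightarrow> call_iters P g H (\<xi> j) x)"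

definition second_order_optimal ::
  "'a::real_inner set \<Rightarrow> params \<Rightarrow> ('a \<Rightarrow> 'a) \<Rightarrow> ('a \<Rightarrow> 'a \<Rightarrow> 'a) \<Rightarrow> 'a \<Rightarrow> bool" where
  "second_order_optimal V P g H x \<longleftrightarrow>
     norm (g x) \<le> eps_g P \<and> lambda_min V (H x) \<ge> - eps_H P"


section \<open>Assumptions\<close>

definition relevant_hessian_bounded ::
  "'a::real_inner set \<Rightarrow> ('a \<Rightarrow> 'a) \<Rightarrow> ('a \<Rightarrow> 'a \<Rightarrow> 'a) \<Rightarrow> real \<Rightarrow> bool" where
  "relevant_hessian_bounded V g H Lg \<longleftrightarrow>
     (\<forall>x\<in>V. UtAU_norm (U_all V (H x) (g x)) (H x) \<le> Lg)"

definition lipschitz_hessian ::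
  "'a::real_inner set \<Rightarrow> ('a \<Rightarrow> 'a \<Rightarrow> 'a) \<Rightarrow> real \<Rightarrow> bool" where
  "lipschitz_hessian V H LH \<longleftrightarrow>
     (\<forall>x\<in>V. \<forall>y\<in>V. opnorm_on V (\<lambda>v. H x v - H y v) \<le> LH * norm (x - y))"

definition krylov_regular_I ::
  "'a::real_inner set \<Rightarrow> ('a \<Rightarrow> 'a) \<Rightarrow> ('a \<Rightarrow> 'a \<Rightarrow> 'a) \<Rightarrow> real \<Rightarrow> bool" where
  "krylov_regular_I V g H \<sigma> \<longleftrightarrow>
     (\<forall>x\<in>V. \<forall>t\<le>grade (H x) (g x).
        (\<forall>i\<in>{1..t}. \<not> npc_at (H x) (g x) i) \<longrightarrow>
        (\<forall>s\<in>krylov (H x) (g x) t. inner s (H x s) \<ge> \<sigma> * (norm s)\<^sup>2))"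

text \<open>Along one run of the method, given by the draws \<open>\<xi>\<close>.\<close>

definition krylov_regular_II ::
  "params \<Rightarrow> ('a::real_inner \<Rightarrow> real) \<Rightarrow> ('a \<Rightarrow> 'a) \<Rightarrow> ('a \<Rightarrow> 'a \<Rightarrow> 'a) \<Rightarrow> (nat \<Rightarrow> real) \<Rightarrow> 'a \<Rightarrow>
   real \<Rightarrow> (nat \<Rightarrow> 'a) \<Rightarrow> bool"
where
  "krylov_regular_II P f g H z x0 \<omega> \<xi> \<longleftrightarrow>
     (\<forall>k x dir. newton_mr P f g H z x0 \<xi> k = Some x \<and> norm (g x) > eps_g P \<and>
        minres_call P g H (\<xi> k) x = (NPC, dir) \<longrightarrow> norm dir \<ge> \<omega> * norm (g x))"

definition spectral_assumption ::
  "'a::real_inner set \<Rightarrow> ('a \<Rightarrow> 'a) \<Rightarrow> ('a \<Rightarrow> 'a \<Rightarrow> 'a) \<Rightarrow> real \<Rightarrow> real \<Rightarrow> bool" where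
  "spectral_assumption V g H \<mu> \<nu> \<longleftrightarrow>
     (\<forall>x\<in>V. H x (g x) \<noteq> 0 \<longrightarrow>
        (let A = H x; b = g x; rhs = \<nu> * (norm (UUt (U_all V A b) b))\<^sup>2;
             pos = {1..psi_pos V A b};
             neg = {psi_pos V A b + psi_zero V A b + 1..psi V A b}
         in
           (psi_pos V A b \<ge> 1 \<and> psi_neg V A b \<ge> 1 \<and>
            (\<exists>i\<in>pos. \<exists>j\<in>neg. min (lam V A b i) \<bar>lam V A b j\<bar> \<ge> \<mu> \<and>
               (norm (UUt (U_pos V A b i) b + UUt (U_neg V A b j) b))\<^sup>2 \<ge> rhs)) \<or>
           (psi_pos V A b \<ge> 1 \<and>
            (\<exists>i\<in>pos. lam V A b i \<ge> \<mu> \<and> (norm (UUt (U_pos V A b i) b))\<^sup>2 \<ge> rhs)) \<or>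
           (psi_neg V A b \<ge> 1 \<and>
            (\<exists>j\<in>neg. \<bar>lam V A b j\<bar> \<ge> \<mu> \<and> (norm (UUt (U_neg V A b j) b))\<^sup>2 \<ge> rhs))))"

end

theory Submission
  imports Defs
begin

text \<open>Almost surely, every outer iteration before the first approximate second-order point decreases
  \<open>f\<close> by a fixed amount, or leads to such a point, or is followed by an iteration with a decrease;
  since \<open>f\<close> is bounded below, this bounds the number of outer iterations.  It remains to bound the
  MINRES iterations of one outer iteration; at points with small gradient this is done in
  expectation.

  \<^emph>\<open>Large gradient.\<close>  MINRES is run by the short recurrence of conjugate residuals.  Until
  nonpositive curvature shows up, its residuals are a conjugate basis of the Krylov space, the form
  is bounded below by \<open>\<sigma>\<close> there, and the residual decreases geometrically
  (\<open>residual_contraction\<close>); hence the call ends after \<open>O(log(1/\<epsilon>\<^sub>g))\<close> iterations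
  (\<open>minres_iters_log_bound\<close>).  A returned direction of nonpositive curvature is
  long enough to decrease \<open>f\<close> by a multiple of \<open>\<epsilon>\<^sub>g\<^sup>3\<^sup>/\<^sup>2\<close> (\<open>npc_descent\<close>).  For an approximate solution \<open>s\<close> with residual \<open>r\<close> one has
  \<open>\<langle>s, r\<rangle> \<ge> 0\<close> (\<open>inner_iterate_residual_nonneg\<close>), so it is a descent direction, and either \<open>f\<close> decreases
  by a multiple of \<open>\<epsilon>\<^sub>g\<close> or the next gradient is small (\<open>newton_descent\<close>).

  \<^emph>\<open>Small gradient.\<close>  If the Hessian has an eigenvalue below \<open>-\<epsilon>\<^sub>H\<close>, the call is made for a matrix \<open>A\<close>
  with an eigenvalue at most \<open>-\<epsilon>\<^sub>H/2\<close>.  Its norm is bounded by a constant: the bound on the relevant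
  eigenvalues at points near \<open>x\<close> also controls the other eigenvalues at \<open>x\<close>
  (\<open>eigenvalue_bound_at_small_gradient\<close>).  As long as no nonpositive curvature is detected, the form
  of \<open>A\<close> is nonnegative on the Krylov space; evaluated at a Chebyshev polynomial in \<open>A\<close> applied to the
  random start \<open>q\<close>, this forces the component of \<open>q\<close> along the negative eigenvector to be
  exponentially small in the number of iterations (\<open>overlap_bound_if_no_npc\<close>).  A random unit vector
  has a component of size at most \<open>\<tau>\<close> with probability at most \<open>8 d \<tau>\<close> (\<open>sphere_uniform_slab\<close>), so
  the expected number of iterations is \<open>O(\<epsilon>\<^sub>H\<^sup>-\<^sup>1\<^sup>/\<^sup>2 (1 + log d))\<close> (\<open>expected_npc_cost\<close>).  Each such step decreases \<open>f\<close> by a multiple of \<open>\<epsilon>\<^sub>H\<^sup>3\<close>.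

  \<^emph>\<open>The whole run.\<close>  The points depend on the earlier draws only, so \<open>f - f_min\<close>, suitably scaled, is a
  potential for the expected cost at small gradients (\<open>expected_total_cost\<close>).  Markov's inequality
  turns the expectation into a bound with probability \<open>1 - \<delta>\<close>; a union bound over the steps would
  cost another logarithm of \<open>1/\<epsilon>\<^sub>H\<close>.  Conditioning on the first draw requires the trajectory to be a
  measurable function of the draws, which is read off from the recurrence formulas.\<close>

section \<open>Finite-dimensional subspaces of an inner product space\<close>

definition orthonormal :: "'a::real_inner set \<Rightarrow> bool" where
  "orthonormal B \<longleftrightarrow> pairwise orthogonal B \<and> (\<forall>u\<in>B. norm u = 1)"

definition fin_dim :: "'a::real_inner set \<Rightarrow> bool" where
  "fin_dim V \<longleftrightarrow> (\<exists>E. finite E \<and> orthonormal E \<and> V = span E)"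

lemma fin_dim_subspace: "fin_dim V \<Longrightarrow> subspace V"
  by (auto simp: fin_dim_def)

lemma orthonormal_inner:
  assumes "orthonormal B" "u \<in> B" "v \<in> B"
  shows "inner u v = (if u = v then 1 else 0)"
  using assms by (auto simp: orthonormal_def pairwise_def orthogonal_def dot_square_norm)

lemma orthonormal_independent:
  assumes "orthonormal B" shows "independent B"
  using assms unfolding orthonormal_def by (intro pairwise_orthogonal_independent) fastforce+

lemma orthogonal_to_span_self:
  fixes x :: "'a::real_inner"
  assumes "x \<in> span B" "\<And>u. u \<in> B \<Longrightarrow> inner u x = 0"
  shows "x = 0"
proof -
  have "inner y x = 0" if "y \<in> span B" for y
    using that by (induction rule: span_induct_alt) (auto simp: inner_add_left assms)
  from this[OF assms(1)] show ?thesis by simp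
qed

lemma orthonormal_expand:
  fixes x :: "'a::real_inner"
  assumes "finite B" "orthonormal B" "x \<in> span B"
  shows "x = (\<Sum>u\<in>B. inner u x *\<^sub>R u)"
proof -
  let ?y = "\<Sum>u\<in>B. inner u x *\<^sub>R u"
  have "x - ?y = 0"
  proof (rule orthogonal_to_span_self)
    show "x - ?y \<in> span B"
      by (intro span_diff assms span_sum span_scale span_base)
    fix v assume v: "v \<in> B"
    have "inner v ?y = (\<Sum>u\<in>B. if v = u then inner u x else 0)"
      unfolding inner_sum_right using assms v by (intro sum.cong) (auto simp: orthonormal_inner)
    also have "\<dots> = inner v x" using assms v by simp
    finally show "inner v (x - ?y) = 0" by (simp add: inner_diff_right)
  qed
  then show ?thesis by simp
qed

lemma orthonormal_inner_expand:
  fixes x :: "'a::real_inner"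
  assumes "finite B" "orthonormal B" "x \<in> span B"
  shows "inner x y = (\<Sum>u\<in>B. inner u x * inner u y)"
  by (subst orthonormal_expand[OF assms]) (simp add: inner_sum_left)

lemma orthonormal_norm_expand:
  fixes x :: "'a::real_inner"
  assumes "finite B" "orthonormal B" "x \<in> span B"
  shows "(norm x)\<^sup>2 = (\<Sum>u\<in>B. (inner u x)\<^sup>2)"
  unfolding power2_norm_eq_inner using orthonormal_inner_expand[OF assms, of x]
  by (simp add: power2_eq_square)

text \<open>The unit ball is a closed part of the cube of all combinations with coefficients in
  \<open>[-1, 1]\<close>, and the cube is built up one basis vector at a time.\<close>

lemma compact_unit_ball:
  fixes V :: "'a::real_inner set"
  assumes "fin_dim V" shows "compact (V \<inter> cball 0 1)"
proof -
  obtain E where E: "finite E" "orthonormal E" "V = span E"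
    using assms by (auto simp: fin_dim_def)
  let ?Q = "\<lambda>E. {(\<Sum>e\<in>E. c e *\<^sub>R e) |c. \<forall>e\<in>E. \<bar>c e\<bar> \<le> (1::real)}"
  have Q: "compact (?Q E)" using E(1)
  proof (induction rule: finite_induct)
    case (insert e F)
    have "?Q (insert e F) = (\<lambda>(t, x). t *\<^sub>R e + x) ` ({-1..1} \<times> ?Q F)"
    proof safe
      fix c :: "'a \<Rightarrow> real" assume c: "\<forall>e\<in>insert e F. \<bar>c e\<bar> \<le> 1"
      then show "(\<Sum>e\<in>insert e F. c e *\<^sub>R e) \<in> (\<lambda>(t, x). t *\<^sub>R e + x) ` ({-1..1} \<times> ?Q F)"
        using insert by (intro image_eqI[of _ _ "(c e, \<Sum>e\<in>F. c e *\<^sub>R e)"]) (auto simp: abs_le_iff)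
    next
      fix t :: real and c :: "'a \<Rightarrow> real" assume t: "t \<in> {-1..1}" and c: "\<forall>e\<in>F. \<bar>c e\<bar> \<le> 1"
      have "t *\<^sub>R e + (\<Sum>e\<in>F. c e *\<^sub>R e) = (\<Sum>x\<in>insert e F. (c(e := t)) x *\<^sub>R x)"
        using insert by (auto intro!: sum.cong)
      then show "\<exists>c'. t *\<^sub>R e + (\<Sum>e\<in>F. c e *\<^sub>R e) = (\<Sum>x\<in>insert e F. c' x *\<^sub>R x) \<and>
          (\<forall>x\<in>insert e F. \<bar>c' x\<bar> \<le> 1)"
        using t c by (intro exI[of _ "c(e := t)"]) auto
    qed
    moreover have "compact ((\<lambda>(t, x). t *\<^sub>R e + x) ` ({-1..1::real} \<times> ?Q F))"
      by (intro compact_continuous_image compact_Times insert.IH)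
         (auto simp: split_beta intro!: continuous_intros)
    ultimately show ?case by simp
  qed simp
  have "V \<inter> cball 0 1 = ?Q E \<inter> cball 0 1"
  proof (intro equalityI subsetI)
    fix x assume x: "x \<in> V \<inter> cball 0 1"
    then have "x = (\<Sum>e\<in>E. inner e x *\<^sub>R e)" using E orthonormal_expand by blast
    moreover have "\<bar>inner e x\<bar> \<le> 1" if "e \<in> E" for e
      using Cauchy_Schwarz_ineq2[of e x] x that E by (auto simp: orthonormal_def)
    ultimately show "x \<in> ?Q E \<inter> cball 0 1" using x by auto
  next
    fix x assume x: "x \<in> ?Q E \<inter> cball 0 1"
    then obtain c where "x = (\<Sum>e\<in>E. c e *\<^sub>R e)" by auto
    also have "\<dots> \<in> V" unfolding E(3) by (intro span_sum span_scale span_base)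
    finally show "x \<in> V \<inter> cball 0 1" using x by auto
  qed
  then show ?thesis using Q by (simp add: compact_Int_closed)
qed

section \<open>Symmetric operators\<close>

locale symmetric_operator =
  fixes V :: "'a::real_inner set" and A :: "'a \<Rightarrow> 'a"
  assumes fin_dim: "fin_dim V"
    and bounded_linear: "bounded_linear A"
    and closed: "x \<in> V \<Longrightarrow> A x \<in> V"
    and symmetric: "x \<in> V \<Longrightarrow> y \<in> V \<Longrightarrow> inner (A x) y = inner x (A y)"
begin

lemma linear: "linear A"
  using bounded_linear by (rule bounded_linear.linear)

lemma subspace: "subspace V"
  using fin_dim by (rule fin_dim_subspace)

lemma shows add: "A (x + y) = A x + A y" and diff: "A (x - y) = A x - A y"
  and scale: "A (c *\<^sub>R x) = c *\<^sub>R A x" and zero [simp]: "A 0 = 0" and neg: "A (- x) = - A x"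
  using linear by (simp_all add: linear_add linear_diff linear_scale linear_0 linear_neg)

lemma continuous_A: "continuous_on S (\<lambda>x. A x)"
  using bounded_linear by (intro linear_continuous_on)

text \<open>A maximiser of the Rayleigh quotient on the unit sphere of an invariant subspace is an
  eigenvector: moving from it in any direction of the subspace gives a nonnegative quadratic with
  a zero at the origin, hence without linear term.\<close>

lemma ex_eigenvector:
  assumes W: "subspace W" "W \<subseteq> V" "\<And>x. x \<in> W \<Longrightarrow> A x \<in> W" "compact (W \<inter> sphere 0 1)" "W \<noteq> {0}"
  obtains x l where "x \<in> W" "norm x = 1" "A x = l *\<^sub>R x"
proof -
  obtain w where w: "w \<in> W" "w \<noteq> 0" using W subspace_0 by blast
  then have ne: "W \<inter> sphere 0 1 \<noteq> {}"
    using subspace_scale[OF W(1), of w "1 / norm w"] by (auto simp: )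
  obtain x where x: "x \<in> W" "norm x = 1"
    and max: "\<And>y. y \<in> W \<Longrightarrow> norm y = 1 \<Longrightarrow> inner y (A y) \<le> inner x (A x)"
  proof -
    have "continuous_on (W \<inter> sphere 0 1) (\<lambda>y. inner y (A y))"
      by (intro continuous_intros continuous_A)
    from continuous_attains_sup[OF W(4) ne this] show ?thesis using that by auto
  qed
  define l where "l = inner x (A x)"
  have quad: "inner y (A y) \<le> l * inner y y" if y: "y \<in> W" for y
  proof (cases "y = 0")
    case False
    have "inner ((1 / norm y) *\<^sub>R y) (A ((1 / norm y) *\<^sub>R y)) \<le> l"
      unfolding l_def using False y by (intro max subspace_scale[OF W(1)]) auto
    then show ?thesis using False
      by (simp add: scale field_simps dot_square_norm power2_eq_square)
  qed simp
  have orth: "inner (A x - l *\<^sub>R x) h = 0" if h: "h \<in> W" for h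
  proof -
    define b where "b = l * inner x h - inner (A x) h"
    define c where "c = l * inner h h - inner h (A h)"
    have nonneg: "0 \<le> 2 * t * b + t\<^sup>2 * c" for t
    proof -
      have "inner (x + t *\<^sub>R h) (A (x + t *\<^sub>R h)) \<le> l * inner (x + t *\<^sub>R h) (x + t *\<^sub>R h)"
        using x h by (intro quad subspace_add subspace_scale W)
      moreover have "inner h (A x) = inner (A x) h" "inner x (A h) = inner (A x) h" "inner h x = inner x h"
        using symmetric[of x h] x(1) h subsetD[OF W(2)] by (simp_all add: inner_commute)
      moreover have "inner x x = 1" using x by (simp add: dot_square_norm)
      ultimately show ?thesis
        by (simp add: add scale inner_add_left inner_add_right b_def c_def l_def
            algebra_simps power2_eq_square)
    qed
    have "b = 0"
    proof (rule ccontr)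
      assume "b \<noteq> 0"
      define r where "r = 1 / (\<bar>c\<bar> + 1)"
      have r: "r > 0" "r * c < 2" by (auto simp: r_def field_simps)
      have "0 \<le> 2 * (- b * r) * b + (- b * r)\<^sup>2 * c" by (rule nonneg)
      also have "\<dots> = b\<^sup>2 * r * (r * c - 2)"
        by (simp add: power2_eq_square algebra_simps)
      also have "\<dots> < 0"
        using \<open>b \<noteq> 0\<close> r by (intro mult_pos_neg) auto
      finally show False by simp
    qed
    then show ?thesis by (simp add: b_def inner_diff_left)
  qed
  have "A x - l *\<^sub>R x \<in> W" using x W by (intro subspace_diff subspace_scale) auto
  from orth[OF this] have "A x = l *\<^sub>R x" by simp
  then show ?thesis using that x by blast
qed

text \<open>A largest orthonormal set of eigenvectors spans \<open>V\<close>, since its orthogonal complement is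
  invariant and would contribute a further eigenvector.\<close>

theorem eigenvector_basis:
  obtains B where "finite B" "orthonormal B" "span B = V" "\<And>u. u \<in> B \<Longrightarrow> \<exists>l. A u = l *\<^sub>R u"
proof -
  obtain E where E: "finite E" "orthonormal E" "V = span E"
    using fin_dim by (auto simp: fin_dim_def)
  define P where "P B \<longleftrightarrow> orthonormal B \<and> B \<subseteq> V \<and> (\<forall>u\<in>B. \<exists>l. A u = l *\<^sub>R u)" for B
  have bound: "finite B \<and> card B \<le> card E" if "P B" for B
    using independent_span_bound[OF E(1), of B] orthonormal_independent that E by (auto simp: P_def)
  have "P {}" by (simp add: P_def orthonormal_def)
  then obtain B where B: "P B" and max: "\<And>B'. P B' \<Longrightarrow> card B' \<le> card B"
    using ex_has_greatest_nat[of P "{}" card "Suc (card E)"] bound by (metis le_imp_less_Suc)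
  have fin: "finite B" using B bound by blast
  define W where "W = {x \<in> V. \<forall>b\<in>B. inner b x = 0}"
  have "W = {0}"
  proof (rule ccontr)
    assume ne: "W \<noteq> {0}"
    have sub: "subspace W"
      using subspace by (auto simp: subspace_def W_def inner_add_right)
    have inv: "A x \<in> W" if "x \<in> W" for x
    proof -
      have "inner b (A x) = 0" if "b \<in> B" for b
      proof -
        obtain l where "A b = l *\<^sub>R b" using B \<open>b \<in> B\<close> unfolding P_def by blast
        then show ?thesis
          using symmetric[of b x] B \<open>b \<in> B\<close> \<open>x \<in> W\<close> by (auto simp: W_def P_def subset_iff)
      qed
      then show ?thesis using that closed by (auto simp: W_def)
    qed
    have "W \<inter> sphere 0 1 = (V \<inter> cball 0 1) \<inter> ({x. norm x = 1} \<inter> (\<Inter>b\<in>B. {x. inner b x = 0}))"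
      by (auto simp: W_def)
    moreover have "compact \<dots>"
      by (rule compact_Int_closed[OF compact_unit_ball[OF fin_dim]])
         (intro closed_Int closed_INT ballI closed_Collect_eq continuous_intros)
    ultimately have "compact (W \<inter> sphere 0 1)" by simp
    then obtain x l where x: "x \<in> W" "norm x = 1" "A x = l *\<^sub>R x"
      using ex_eigenvector[OF sub _ inv _ ne] by (metis (no_types, lifting) W_def mem_Collect_eq subsetI)
    have "x \<notin> B" using x by (auto simp: W_def)
    moreover have "P (insert x B)" using x B
      by (auto simp: P_def W_def orthonormal_def pairwise_insert orthogonal_def inner_commute)
    ultimately show False using max[of "insert x B"] fin by simp
  qed
  have "span B = V"
  proof
    show "span B \<subseteq> V" using B subspace by (auto simp: P_def intro: span_minimal[THEN subsetD])
    show "V \<subseteq> span B"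
    proof
      fix x assume x: "x \<in> V"
      let ?y = "\<Sum>u\<in>B. inner u x *\<^sub>R u"
      have y: "?y \<in> span B" by (intro span_sum span_scale span_base)
      have "inner v ?y = inner v x" if v: "v \<in> B" for v
      proof -
        have "inner v ?y = (\<Sum>u\<in>B. if v = u then inner u x else 0)"
          unfolding inner_sum_right using B v
          by (intro sum.cong) (auto simp: orthonormal_inner P_def)
        also have "\<dots> = inner v x" using fin v by simp
        finally show ?thesis .
      qed
      then have "x - ?y \<in> W"
        using x y \<open>span B \<subseteq> V\<close> subspace by (auto simp: W_def inner_diff_right intro!: subspace_diff)
      then show "x \<in> span B" using \<open>W = {0}\<close> y by simp
    qed
  qed
  then show ?thesis using that[of B] fin B by (auto simp: P_def)
qed

definition eigval :: "'a \<Rightarrow> real" where "eigval u = inner u (A u)"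

definition is_eigenbasis :: "'a set \<Rightarrow> bool" where
  "is_eigenbasis B \<longleftrightarrow> finite B \<and> orthonormal B \<and> span B = V \<and> (\<forall>u\<in>B. A u = eigval u *\<^sub>R u)"

lemma ex_eigenbasis: obtains B where "is_eigenbasis B"
proof -
  obtain B where B: "finite B" "orthonormal B" "span B = V" "\<And>u. u \<in> B \<Longrightarrow> \<exists>l. A u = l *\<^sub>R u"
    using eigenvector_basis by blast
  have "A u = eigval u *\<^sub>R u" if u: "u \<in> B" for u
  proof -
    obtain l where l: "A u = l *\<^sub>R u" using B u by blast
    then show ?thesis using B(2) u by (simp add: eigval_def orthonormal_inner)
  qed
  then show ?thesis using that B by (auto simp: is_eigenbasis_def)
qed

lemma inner_eigenvector:
  assumes "is_eigenbasis B" "u \<in> B" "x \<in> V"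
  shows "inner u (A x) = eigval u * inner u x"
proof -
  have "u \<in> V" using assms by (auto simp: is_eigenbasis_def span_base)
  then show ?thesis
    using symmetric[of u x] assms by (auto simp: is_eigenbasis_def)
qed

lemma eigenbasis_quadratic_form:
  assumes "is_eigenbasis B" "x \<in> V"
  shows "inner x (A x) = (\<Sum>u\<in>B. eigval u * (inner u x)\<^sup>2)"
proof -
  have "inner x (A x) = (\<Sum>u\<in>B. inner u x * inner u (A x))"
    using assms by (intro orthonormal_inner_expand) (auto simp: is_eigenbasis_def)
  also have "\<dots> = (\<Sum>u\<in>B. eigval u * (inner u x)\<^sup>2)"
    using assms by (intro sum.cong) (auto simp: inner_eigenvector power2_eq_square)
  finally show ?thesis .
qed

lemma eigenbasis_norm_image:
  assumes "is_eigenbasis B" "x \<in> V"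
  shows "(norm (A x))\<^sup>2 = (\<Sum>u\<in>B. (eigval u)\<^sup>2 * (inner u x)\<^sup>2)"
proof -
  have "(norm (A x))\<^sup>2 = (\<Sum>u\<in>B. (inner u (A x))\<^sup>2)"
    using assms closed by (intro orthonormal_norm_expand) (auto simp: is_eigenbasis_def)
  also have "\<dots> = (\<Sum>u\<in>B. (eigval u)\<^sup>2 * (inner u x)\<^sup>2)"
    using assms by (intro sum.cong) (auto simp: inner_eigenvector power_mult_distrib)
  finally show ?thesis .
qed

lemma eigenspace_coordinates:
  assumes B: "is_eigenbasis B" and w: "w \<in> eigenspace V A l" and u: "u \<in> B" "inner u w \<noteq> 0"
  shows "eigval u = l"
  using inner_eigenvector[OF B u(1), of w] w u by (auto simp: eigenspace_def)

lemma eigenbasis_eigenspace: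
  assumes "is_eigenbasis B" "u \<in> B" shows "u \<in> eigenspace V A (eigval u)" "u \<noteq> 0"
  using assms by (auto simp: is_eigenbasis_def eigenspace_def span_base orthonormal_def)

lemma eigenspace_nonzero_coordinate:
  assumes "is_eigenbasis B" "w \<in> V" "w \<noteq> 0"
  obtains u where "u \<in> B" "inner u w \<noteq> 0"
  using assms orthogonal_to_span_self[of w B] by (auto simp: is_eigenbasis_def)

lemma eigenvalues_eq:
  assumes B: "is_eigenbasis B" shows "eigenvalues V A = eigval ` B"
proof (intro equalityI subsetI)
  fix l assume "l \<in> eigenvalues V A"
  then obtain w where w: "w \<in> eigenspace V A l" "w \<noteq> 0" by (auto simp: eigenvalues_def)
  then obtain u where "u \<in> B" "inner u w \<noteq> 0"
    using eigenspace_nonzero_coordinate[OF B] by (auto simp: eigenspace_def)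
  then show "l \<in> eigval ` B" using eigenspace_coordinates[OF B w(1)] by auto
next
  fix l assume "l \<in> eigval ` B"
  then show "l \<in> eigenvalues V A" using eigenbasis_eigenspace[OF B] by (auto simp: eigenvalues_def)
qed

text \<open>In this form the condition on the smallest eigenvalue is a family of closed conditions on the
  operator.\<close>

lemma lambda_min_ge_iff:
  assumes "V \<noteq> {0}"
  shows "lambda_min V A \<ge> c \<longleftrightarrow> (\<forall>v\<in>V. inner v (A v) \<ge> c * inner v v)"
proof -
  obtain B where B: "is_eigenbasis B" by (rule ex_eigenbasis)
  then have fin: "finite B" and ne: "B \<noteq> {}"
    using assms by (auto simp: is_eigenbasis_def)
  have "lambda_min V A \<ge> c \<longleftrightarrow> (\<forall>u\<in>B. eigval u \<ge> c)"
    using fin ne by (simp add: lambda_min_def eigenvalues_eq[OF B])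
  also have "\<dots> \<longleftrightarrow> (\<forall>v\<in>V. inner v (A v) \<ge> c * inner v v)"
  proof
    assume l: "\<forall>u\<in>B. eigval u \<ge> c"
    show "\<forall>v\<in>V. inner v (A v) \<ge> c * inner v v"
    proof
      fix v assume v: "v \<in> V"
      have "c * inner v v = (\<Sum>u\<in>B. c * (inner u v)\<^sup>2)"
        using orthonormal_norm_expand[of B v] B v
        by (simp add: is_eigenbasis_def sum_distrib_left dot_square_norm)
      also have "\<dots> \<le> inner v (A v)"
        unfolding eigenbasis_quadratic_form[OF B v] using l by (intro sum_mono mult_right_mono) auto
      finally show "c * inner v v \<le> inner v (A v)" .
    qed
  next
    assume v: "\<forall>v\<in>V. inner v (A v) \<ge> c * inner v v"
    show "\<forall>u\<in>B. eigval u \<ge> c"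
    proof
      fix u assume u: "u \<in> B"
      then have "u \<in> V" "inner u u = 1" using B by (auto simp: is_eigenbasis_def span_base orthonormal_inner)
      then show "eigval u \<ge> c" using v by (auto simp: eigval_def)
    qed
  qed
  finally show ?thesis .
qed

text \<open>The defining choice of \<open>eigbasis\<close> succeeds: the members of an eigenbasis that belong to the
  given eigenvalues are a witness.\<close>

lemma eigbasis_props:
  defines "U \<equiv> \<lambda>L. eigbasis V A L"
  shows "finite (U L)" "orthonormal (U L)" "\<And>u. u \<in> U L \<Longrightarrow> \<exists>l\<in>L. u \<in> eigenspace V A l"
    "span (U L) = span (\<Union>l\<in>L. eigenspace V A l)"
proof -
  obtain B where B: "is_eigenbasis B" by (rule ex_eigenbasis)
  let ?B = "{u \<in> B. eigval u \<in> L}"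
  let ?P = "\<lambda>B. finite B \<and> pairwise orthogonal B \<and>
        (\<forall>u\<in>B. norm u = 1 \<and> (\<exists>l\<in>L. u \<in> eigenspace V A l)) \<and>
        span B = span (\<Union>l\<in>L. eigenspace V A l)"
  have sub: "?B \<subseteq> (\<Union>l\<in>L. eigenspace V A l)"
    using eigenbasis_eigenspace[OF B] by auto
  have "w \<in> span ?B" if w: "l \<in> L" "w \<in> eigenspace V A l" for w l
  proof -
    have "w = (\<Sum>u\<in>B. inner u w *\<^sub>R u)"
      using B w by (intro orthonormal_expand) (auto simp: is_eigenbasis_def eigenspace_def)
    also have "\<dots> = (\<Sum>u\<in>?B. inner u w *\<^sub>R u)"
      using B w eigenspace_coordinates[OF B w(2)]
      by (intro sum.mono_neutral_right) (auto simp: is_eigenbasis_def)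
    also have "\<dots> \<in> span ?B" by (intro span_sum span_scale span_base)
    finally show ?thesis .
  qed
  then have "span (\<Union>l\<in>L. eigenspace V A l) \<subseteq> span ?B"
    by (intro span_minimal) auto
  then have "span ?B = span (\<Union>l\<in>L. eigenspace V A l)"
    using span_mono[OF sub] by auto
  then have "?P ?B"
    using B sub by (auto simp: is_eigenbasis_def orthonormal_def pairwise_def)
  then have "?P (U L)" unfolding U_def eigbasis_def by (rule someI[of ?P])
  then show "finite (U L)" "orthonormal (U L)" "\<And>u. u \<in> U L \<Longrightarrow> \<exists>l\<in>L. u \<in> eigenspace V A l"
    "span (U L) = span (\<Union>l\<in>L. eigenspace V A l)" by (auto simp: orthonormal_def)
qed

text \<open>Testing the spectral norm of \<open>U\<^sup>\<top> A U\<close> with a coordinate vector shows that it dominates every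
  nonzero relevant eigenvalue.\<close>

lemma relevant_le_UtAU_norm:
  assumes l: "l \<in> relevant V A b"
  shows "\<bar>l\<bar> \<le> max 0 (UtAU_norm (U_all V A b) A)"
proof (cases "l = 0")
  case False
  define U where "U = U_all V A b"
  have U: "finite U" "orthonormal U" "\<And>u. u \<in> U \<Longrightarrow> \<exists>l\<in>relevant V A b - {0}. u \<in> eigenspace V A l"
    "span U = span (\<Union>l\<in>relevant V A b - {0}. eigenspace V A l)"
    unfolding U_def U_all_def using eigbasis_props[where L = "relevant V A b - {0}"] by blast+
  let ?q = "\<lambda>c. L2_set (\<lambda>u. \<Sum>w\<in>U. inner u (A w) * c w) U / L2_set c U"
  obtain w where w: "w \<in> eigenspace V A l" "w \<noteq> 0"
    using l by (auto simp: relevant_def eigenvalues_def)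
  have "w \<in> span U" unfolding U(4) using w l False by (intro span_base) auto
  then obtain u where u: "u \<in> U" "inner u w \<noteq> 0"
    using orthogonal_to_span_self w by blast
  obtain l' where "l' \<in> relevant V A b - {0}" "u \<in> eigenspace V A l'" using U(3)[OF u(1)] by auto
  then have "l' = l"
    using symmetric[of u w] u w by (auto simp: eigenspace_def)
  then have Au: "A u = l *\<^sub>R u" using \<open>u \<in> eigenspace V A l'\<close> by (simp add: eigenspace_def)
  define c where "c = (\<lambda>v. if v = u then 1 else 0 :: real)"
  have c: "(\<Sum>w\<in>U. inner v (A w) * c w) = l * c v" if "v \<in> U" for v
  proof -
    have "(\<Sum>w\<in>U. inner v (A w) * c w) = (\<Sum>w\<in>U. if w = u then inner v (A u) else 0)"
      by (intro sum.cong) (auto simp: c_def)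
    also have "\<dots> = inner v (A u)" using U(1) u by simp
    also have "\<dots> = l * c v" using U(2) u that by (simp add: Au orthonormal_inner c_def)
    finally show ?thesis .
  qed
  have "L2_set c U = sqrt (\<Sum>v\<in>U. if v = u then 1 else 0)"
    unfolding L2_set_def c_def by (intro arg_cong[where f=sqrt] sum.cong) auto
  then have "L2_set c U = 1" using U(1) u by simp
  moreover have "L2_set (\<lambda>v. \<Sum>w\<in>U. inner v (A w) * c w) U = \<bar>l\<bar> * L2_set c U"
    using c by (simp add: L2_set_def power_mult_distrib sum_distrib_left[symmetric] real_sqrt_mult cong: sum.cong)
  ultimately have q: "?q c = \<bar>l\<bar>" by simp
  have "bdd_above (range ?q)"
  proof (rule bdd_aboveI2)
    fix c :: "'a \<Rightarrow> real"
    define K where "K = (\<Sum>u\<in>U. \<Sum>w\<in>U. \<bar>inner u (A w)\<bar>)"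
    have K: "0 \<le> K" by (auto simp: K_def intro!: sum_nonneg)
    have "L2_set (\<lambda>u. \<Sum>w\<in>U. inner u (A w) * c w) U \<le> (\<Sum>u\<in>U. \<bar>\<Sum>w\<in>U. inner u (A w) * c w\<bar>)"
      by (rule L2_set_le_sum_abs)
    also have "\<dots> \<le> (\<Sum>u\<in>U. \<Sum>w\<in>U. \<bar>inner u (A w)\<bar> * L2_set c U)"
    proof (intro sum_mono order.trans[OF sum_abs])
      fix u w assume "w \<in> U"
      then have "\<bar>c w\<bar> \<le> L2_set c U" using member_le_L2_set[OF U(1), of w "\<lambda>w. \<bar>c w\<bar>"]
        by (simp add: L2_set_def)
      then show "\<bar>inner u (A w) * c w\<bar> \<le> \<bar>inner u (A w)\<bar> * L2_set c U"
        by (simp add: abs_mult mult_left_mono)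
    qed
    also have "\<dots> = K * L2_set c U" by (simp add: K_def sum_distrib_right)
    finally show "?q c \<le> K" using K L2_set_nonneg[of c U]
      by (cases "L2_set c U = 0") (auto simp: divide_le_eq less_le)
  qed
  then have "?q c \<le> UtAU_norm U A" unfolding UtAU_norm_def by (rule cSUP_upper[OF UNIV_I])
  then show ?thesis using q by (simp add: U_def)
qed simp

section \<open>Krylov spaces\<close>

lemma krylov_0 [simp]: "krylov A b 0 = {0}"
  by (simp add: krylov_def)

lemma subspace_krylov [simp]: "subspace (krylov A b t)"
  by (simp add: krylov_def)

lemma krylov_mono: "s \<le> t \<Longrightarrow> krylov A b s \<subseteq> krylov A b t"
  unfolding krylov_def by (intro span_mono image_mono) auto

lemma power_mem_krylov: "i < t \<Longrightarrow> (A ^^ i) b \<in> krylov A b t"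
  unfolding krylov_def by (intro span_base) auto

lemma krylov_Suc: "krylov A b (Suc t) = {x. \<exists>c. x - c *\<^sub>R (A ^^ t) b \<in> krylov A b t}"
  by (simp add: krylov_def lessThan_Suc span_insert)

lemma krylov_least:
  assumes "subspace W" "b \<in> W" "\<And>x. x \<in> W \<Longrightarrow> A x \<in> W" shows "krylov A b t \<subseteq> W"
proof -
  have "(A ^^ i) b \<in> W" for i by (induction i) (auto simp: assms)
  then show ?thesis unfolding krylov_def using assms(1) by (intro span_minimal) auto
qed

lemma krylov_subset: "b \<in> V \<Longrightarrow> krylov A b t \<subseteq> V"
  using closed subspace by (intro krylov_least)

lemma image_mem_krylov: "x \<in> krylov A b t \<Longrightarrow> A x \<in> krylov A b (Suc t)"
proof (induction t arbitrary: x)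
  case (Suc t)
  then obtain c where c: "x - c *\<^sub>R (A ^^ t) b \<in> krylov A b t" by (auto simp: krylov_Suc)
  from Suc.IH[OF this] have "A x - c *\<^sub>R (A ^^ Suc t) b \<in> krylov A b (Suc t)"
    by (simp add: diff scale)
  then show ?case by (subst krylov_Suc) auto
qed (simp add: subspace_0)

text \<open>On a Krylov space only the relevant eigenvalues act.\<close>

lemma norm_image_krylov:
  assumes b: "b \<in> V" and L: "\<And>l. l \<in> relevant V A b \<Longrightarrow> \<bar>l\<bar> \<le> L" and L0: "0 \<le> L"
    and w: "w \<in> krylov A b t"
  shows "norm (A w) \<le> L * norm w"
proof -
  obtain B where B: "is_eigenbasis B" by (rule ex_eigenbasis)
  define W where "W = {w \<in> V. \<forall>u\<in>B. inner u b = 0 \<longrightarrow> inner u w = 0}"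
  have "krylov A b t \<subseteq> W"
  proof (rule krylov_least)
    show "subspace W" using subspace by (auto simp: subspace_def W_def inner_add_right)
  qed (use b closed in \<open>auto simp: W_def inner_eigenvector[OF B]\<close>)
  with w have W: "w \<in> V" "\<And>u. u \<in> B \<Longrightarrow> inner u w \<noteq> 0 \<Longrightarrow> inner u b \<noteq> 0" by (auto simp: W_def)
  have "(norm (A w))\<^sup>2 = (\<Sum>u\<in>B. (eigval u)\<^sup>2 * (inner u w)\<^sup>2)"
    by (rule eigenbasis_norm_image[OF B W(1)])
  also have "\<dots> \<le> (\<Sum>u\<in>B. L\<^sup>2 * (inner u w)\<^sup>2)"
  proof (rule sum_mono)
    fix u assume u: "u \<in> B"
    show "(eigval u)\<^sup>2 * (inner u w)\<^sup>2 \<le> L\<^sup>2 * (inner u w)\<^sup>2"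
    proof (cases "inner u w = 0")
      case False
      then have "eigval u \<in> relevant V A b"
        using W(2)[OF u] eigenbasis_eigenspace[OF B u]
        by (auto simp: relevant_def eigenvalues_def orthogonal_def inner_commute)
      then have "\<bar>eigval u\<bar> \<le> L" by (rule L)
      then have "(eigval u)\<^sup>2 \<le> L\<^sup>2" using L0 by (metis abs_le_square_iff abs_of_nonneg)
      then show ?thesis by (rule mult_right_mono) simp
    qed simp
  qed
  also have "\<dots> = (L * norm w)\<^sup>2"
    using B W by (simp add: is_eigenbasis_def orthonormal_norm_expand[of B w] power_mult_distrib sum_distrib_left)
  finally show ?thesis by (rule power2_le_imp_le) (simp add: L0)
qed

end

section \<open>MINRES as a short recurrence\<close>

text \<open>The iterates of MINRES by conjugate residuals: the state consists of the iterate, its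
  residual and the next search direction.  In contrast to the minimisation that defines MINRES,
  these formulas are visibly measurable in the data.\<close>

primrec cr :: "('a::real_inner \<Rightarrow> 'a) \<Rightarrow> 'a \<Rightarrow> nat \<Rightarrow> 'a \<times> 'a \<times> 'a" where
  "cr A b 0 = (0, - b, - b)"
| "cr A b (Suc t) =
     (let s = fst (cr A b t); r = fst (snd (cr A b t)); p = snd (snd (cr A b t));
          \<alpha> = inner r (A p) / (norm (A p))\<^sup>2;
          r' = r - \<alpha> *\<^sub>R A p;
          \<beta> = inner (A r') (A p) / (norm (A p))\<^sup>2
      in (s + \<alpha> *\<^sub>R p, r', r' - \<beta> *\<^sub>R p))"

definition cr_s :: "('a::real_inner \<Rightarrow> 'a) \<Rightarrow> 'a \<Rightarrow> nat \<Rightarrow> 'a" where "cr_s A b t = fst (cr A b t)"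
definition cr_r :: "('a::real_inner \<Rightarrow> 'a) \<Rightarrow> 'a \<Rightarrow> nat \<Rightarrow> 'a" where "cr_r A b t = fst (snd (cr A b t))"
definition cr_p :: "('a::real_inner \<Rightarrow> 'a) \<Rightarrow> 'a \<Rightarrow> nat \<Rightarrow> 'a" where "cr_p A b t = snd (snd (cr A b t))"

lemma cr_0: "cr_s A b 0 = 0" "cr_r A b 0 = - b" "cr_p A b 0 = - b"
  by (simp_all add: cr_s_def cr_r_def cr_p_def)

lemma cr_Suc:
  "cr_s A b (Suc t) =
     cr_s A b t + (inner (cr_r A b t) (A (cr_p A b t)) / (norm (A (cr_p A b t)))\<^sup>2) *\<^sub>R cr_p A b t"
  "cr_r A b (Suc t) =
     cr_r A b t - (inner (cr_r A b t) (A (cr_p A b t)) / (norm (A (cr_p A b t)))\<^sup>2) *\<^sub>R A (cr_p A b t)"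
  "cr_p A b (Suc t) = cr_r A b (Suc t) -
     (inner (A (cr_r A b (Suc t))) (A (cr_p A b t)) / (norm (A (cr_p A b t)))\<^sup>2) *\<^sub>R cr_p A b t"
  by (simp_all add: cr_s_def cr_r_def cr_p_def Let_def)

definition cr_npc :: "('a::real_inner \<Rightarrow> 'a) \<Rightarrow> 'a \<Rightarrow> nat \<Rightarrow> bool" where
  "cr_npc A b t \<longleftrightarrow> cr_r A b (t - 1) \<noteq> 0 \<and> inner (cr_r A b (t - 1)) (A (cr_r A b (t - 1))) \<le> 0"

definition cr_sol :: "('a::real_inner \<Rightarrow> 'a) \<Rightarrow> 'a \<Rightarrow> real \<Rightarrow> nat \<Rightarrow> bool" where
  "cr_sol A b \<eta> t \<longleftrightarrow> norm (A (cr_r A b (t - 1))) \<le> \<eta> * norm (A (cr_s A b (t - 1)))"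

locale minres_run = symmetric_operator +
  fixes b :: 'a
  assumes b: "b \<in> V"
begin

abbreviation "K \<equiv> krylov A b"
abbreviation "s \<equiv> cr_s A b"
abbreviation "r \<equiv> cr_r A b"
abbreviation "p \<equiv> cr_p A b"

text \<open>The first \<open>t\<close> residuals have positive curvature, that is, neither the NPC condition nor an exact
  solution has occurred among them.\<close>

definition regular :: "nat \<Rightarrow> bool" where
  "regular t \<longleftrightarrow> (\<forall>i<t. 0 < inner (r i) (A (r i)))"

lemma regular_Suc: "regular (Suc t) \<longleftrightarrow> regular t \<and> 0 < inner (r t) (A (r t))"
  by (auto simp: regular_def less_Suc_eq)

lemma regular_mono: "regular t \<Longrightarrow> i \<le> t \<Longrightarrow> regular i"
  by (auto simp: regular_def)

lemma K_subset: "K t \<subseteq> V" using b by (rule krylov_subset)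

lemma K_Suc_decompose:
  assumes "q \<in> K (Suc t)" "q \<notin> K t" "w \<in> K (Suc t)"
  obtains c where "w - c *\<^sub>R q \<in> K t"
proof -
  obtain c1 where c1: "q - c1 *\<^sub>R (A ^^ t) b \<in> K t" using assms(1) by (auto simp: krylov_Suc)
  obtain c2 where c2: "w - c2 *\<^sub>R (A ^^ t) b \<in> K t" using assms(3) by (auto simp: krylov_Suc)
  have "c1 \<noteq> 0" using c1 assms(2) by auto
  have "w - (c2 / c1) *\<^sub>R q = (w - c2 *\<^sub>R (A ^^ t) b) - (c2 / c1) *\<^sub>R (q - c1 *\<^sub>R (A ^^ t) b)"
    using \<open>c1 \<noteq> 0\<close> by (simp add: scaleR_diff_right)
  also have "\<dots> \<in> K t" by (intro subspace_diff subspace_scale c1 c2 subspace_krylov)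
  finally show ?thesis by (rule that)
qed

lemma cr_mem: "s t \<in> V" "r t \<in> V" "p t \<in> V"
proof -
  have "s t \<in> V \<and> r t \<in> V \<and> p t \<in> V"
    by (induction t)
       (auto simp: cr_0 cr_Suc intro!: subspace_add subspace_diff subspace_scale subspace_neg
         subspace_0 subspace b closed)
  then show "s t \<in> V" "r t \<in> V" "p t \<in> V" by auto
qed

text \<open>As long as the residuals have positive curvature, every search direction enlarges the Krylov
  space, and the orthogonality of \<open>r\<^sub>t\<close> and \<open>A p\<^sub>t\<close> to \<open>A K\<^sub>t\<close> is passed on to the next step.\<close>

lemma cr_invariant:
  assumes "regular t"
  shows "s t \<in> K t \<and> r t = - b - A (s t) \<and> r t \<in> K (Suc t) \<and> p t \<in> K (Suc t) \<and> p t - r t \<in> K t \<and>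
    (\<forall>w\<in>K t. inner (r t) (A w) = 0 \<and> inner (A (p t)) (A w) = 0)"
  using assms
proof (induction t)
  case 0
  have "b \<in> K (Suc 0)" using power_mem_krylov[of 0 "Suc 0" b] by simp
  then have "- b \<in> K (Suc 0)" by (intro subspace_neg) auto
  then show ?case by (simp add: cr_0)
next
  case (Suc t)
  then have pos: "0 < inner (r t) (A (r t))" and reg: "regular t" by (auto simp: regular_Suc)
  have IH: "s t \<in> K t" "r t \<in> K (Suc t)" "p t \<in> K (Suc t)" "p t - r t \<in> K t"
    "\<And>w. w \<in> K t \<Longrightarrow> inner (r t) (A w) = 0" "\<And>w. w \<in> K t \<Longrightarrow> inner (A (p t)) (A w) = 0"
    and IH_r: "r t = - b - A (s t)"
    using Suc.IH[OF reg] by blast+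
  define \<alpha> where "\<alpha> = inner (r t) (A (p t)) / (norm (A (p t)))\<^sup>2"
  define \<beta> where "\<beta> = inner (A (r (Suc t))) (A (p t)) / (norm (A (p t)))\<^sup>2"
  have s': "s (Suc t) = s t + \<alpha> *\<^sub>R p t" and r': "r (Suc t) = r t - \<alpha> *\<^sub>R A (p t)"
    and p': "p (Suc t) = r (Suc t) - \<beta> *\<^sub>R p t"
    by (simp_all only: cr_Suc \<alpha>_def \<beta>_def)
  have rp: "inner (r t) (A (p t)) = inner (r t) (A (r t))"
    using IH(5)[OF IH(4)] by (simp add: diff inner_diff_right)
  then have Ap: "norm (A (p t)) \<noteq> 0" using pos by auto
  have "r t \<notin> K t" using IH pos by auto
  then have pK: "p t \<notin> K t"
    using subspace_diff[OF subspace_krylov _ IH(4), of "p t"] by auto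
  have mono: "K t \<subseteq> K (Suc t)" "K (Suc t) \<subseteq> K (Suc (Suc t))" by (intro krylov_mono; simp)+
  have sK: "s (Suc t) \<in> K (Suc t)"
    unfolding s' using IH mono by (intro subspace_add subspace_scale) auto
  have rK: "r (Suc t) \<in> K (Suc (Suc t))"
    unfolding r' using IH mono by (intro subspace_diff subspace_scale image_mem_krylov) auto
  have diffK: "p (Suc t) - r (Suc t) \<in> K (Suc t)"
    unfolding p' using IH by (simp, intro subspace_neg subspace_scale) auto
  have pK': "p (Suc t) \<in> K (Suc (Suc t))"
    unfolding p' using IH mono rK by (intro subspace_diff subspace_scale) auto
  have req: "r (Suc t) = - b - A (s (Suc t))"
    by (simp add: r' s' add scale IH_r)
  have lift: "inner x (A w) = 0"
    if x: "\<And>w. w \<in> K t \<Longrightarrow> inner x (A w) = 0" "inner x (A (p t)) = 0" and w: "w \<in> K (Suc t)" for x w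
  proof -
    obtain c where c: "w - c *\<^sub>R p t \<in> K t" using K_Suc_decompose[OF _ pK w] IH by auto
    have "inner x (A w) = inner x (A (w - c *\<^sub>R p t)) + c * inner x (A (p t))"
      by (simp add: diff scale inner_diff_right)
    then show ?thesis using x c by simp
  qed
  have r_orth: "inner (r (Suc t)) (A w) = 0" if "w \<in> K (Suc t)" for w
  proof (rule lift[OF _ _ that])
    show "inner (r (Suc t)) (A w) = 0" if "w \<in> K t" for w
      using IH that by (simp add: r' inner_diff_left)
    show "inner (r (Suc t)) (A (p t)) = 0"
      using Ap by (simp add: r' inner_diff_left \<alpha>_def dot_square_norm)
  qed
  have p_orth: "inner (A (p (Suc t))) (A w) = 0" if "w \<in> K (Suc t)" for w
  proof (rule lift[OF _ _ that])
    show "inner (A (p (Suc t))) (A w) = 0" if w: "w \<in> K t" for w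
    proof -
      have "inner (A (r (Suc t))) (A w) = inner (r (Suc t)) (A (A w))"
        using cr_mem subsetD[OF K_subset w] by (intro symmetric closed)
      also have "\<dots> = 0" using w by (intro r_orth image_mem_krylov)
      finally show ?thesis using IH w by (simp add: p' diff scale inner_diff_left)
    qed
    show "inner (A (p (Suc t))) (A (p t)) = 0"
      using Ap by (simp add: p' diff scale inner_diff_left \<beta>_def dot_square_norm)
  qed
  show ?case by (intro conjI ballI sK rK pK' diffK req r_orth p_orth)
qed

lemma shows s_mem: "regular t \<Longrightarrow> s t \<in> K t"
  and r_eq: "regular t \<Longrightarrow> r t = - b - A (s t)"
  and r_mem: "regular t \<Longrightarrow> r t \<in> K (Suc t)"
  and r_orthogonal: "regular t \<Longrightarrow> w \<in> K t \<Longrightarrow> inner (r t) (A w) = 0"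
  using cr_invariant by blast+

lemma r_not_mem: "regular (Suc t) \<Longrightarrow> r t \<notin> K t"
  using r_orthogonal[of t "r t"] by (auto simp: regular_Suc)

lemma K_Suc_residual:
  assumes "regular (Suc t)" "w \<in> K (Suc t)"
  obtains c k where "k \<in> K t" "w = c *\<^sub>R r t + k"
proof -
  obtain c where "w - c *\<^sub>R r t \<in> K t"
    using K_Suc_decompose[OF r_mem r_not_mem[OF assms(1)] assms(2)] assms(1)
    by (auto simp: regular_Suc)
  then show ?thesis by (intro that[of "w - c *\<^sub>R r t" c]) auto
qed

text \<open>The residuals are conjugate and span the Krylov space, hence the form is positive there.\<close>

lemma positive_on_krylov:
  assumes "regular t" "w \<in> K t" "w \<noteq> 0"
  shows "0 < inner w (A w)"
  using assms
proof (induction t arbitrary: w)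
  case (Suc t)
  obtain c k where k: "k \<in> K t" and w: "w = c *\<^sub>R r t + k" using K_Suc_residual Suc.prems by metis
  have pos: "0 < inner (r t) (A (r t))" and reg: "regular t" using Suc.prems by (auto simp: regular_Suc)
  have "inner (r t) (A k) = 0" using r_orthogonal[OF reg k] .
  moreover from this have "inner k (A (r t)) = 0"
    using symmetric[of k "r t"] k K_subset cr_mem by (metis inner_commute subsetD)
  ultimately have eq: "inner w (A w) = c\<^sup>2 * inner (r t) (A (r t)) + inner k (A k)"
    by (simp add: w add scale inner_add_left inner_add_right power2_eq_square)
  show ?case
  proof (cases "k = 0")
    case True
    then have "c \<noteq> 0" using Suc.prems w by auto
    then show ?thesis using eq True pos by simp
  next
    case False
    then have "0 < inner k (A k)" by (intro Suc.IH reg k)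
    then show ?thesis using eq pos by (simp add: add_nonneg_pos)
  qed
qed simp

lemma residual_pythagoras:
  assumes "regular t" "w \<in> K t"
  shows "(norm (A w + b))\<^sup>2 = (norm (r t))\<^sup>2 + (norm (A (w - s t)))\<^sup>2"
proof -
  have "A w + b = A (w - s t) - r t" using r_eq[OF assms(1)] by (simp add: diff)
  moreover have "inner (r t) (A (w - s t)) = 0"
    using assms s_mem by (intro r_orthogonal subspace_diff subspace_krylov) auto
  ultimately show ?thesis
    by (simp add: power2_norm_eq_inner inner_diff_left inner_diff_right inner_commute)
qed

text \<open>Positivity makes \<open>A\<close> injective on the Krylov space, so the minimiser is unique there.\<close>

lemma minres_argmin_iff:
  assumes "regular t"
  shows "minres_argmin A b t x \<longleftrightarrow> x = s t"
proof
  assume x: "minres_argmin A b t x"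
  then have xK: "x \<in> K t" by (simp add: minres_argmin_def)
  have "(norm (A x + b))\<^sup>2 \<le> (norm (A (s t) + b))\<^sup>2"
    using x s_mem[OF assms] by (auto simp: minres_argmin_def)
  then have "A (x - s t) = 0"
    using residual_pythagoras[OF assms xK] residual_pythagoras[OF assms s_mem[OF assms]] by simp
  moreover have "x - s t \<in> K t" using assms s_mem xK by (intro subspace_diff) auto
  ultimately show "x = s t" using positive_on_krylov[OF assms, of "x - s t"] by auto
next
  show "minres_argmin A b t x" if "x = s t"
    using that s_mem[OF assms] residual_pythagoras[OF assms] by (auto simp: minres_argmin_def)
qed

lemma minres_s_eq: "regular t \<Longrightarrow> minres_s A b t = s t"
  by (cases t) (auto simp: cr_0 minres_argmin_iff)

lemma minres_r_eq: "regular t \<Longrightarrow> minres_r A b t = r t"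
  by (simp add: minres_r_def minres_s_eq r_eq)

lemma npc_at_eq: "regular (t - 1) \<Longrightarrow> npc_at A b t = cr_npc A b t"
  by (simp add: npc_at_def cr_npc_def minres_r_eq)

lemma sol_at_eq: "regular (t - 1) \<Longrightarrow> sol_at A b \<eta> t = cr_sol A b \<eta> t"
  by (simp add: sol_at_def cr_sol_def minres_r_eq minres_s_eq)

lemma inner_residuals:
  assumes "regular t" "j \<le> t"
  shows "inner (r j) (r t) = (norm (r t))\<^sup>2"
proof -
  have reg: "regular j" using assms regular_mono by blast
  have "r j - r t = A (s t - s j)" using r_eq[OF reg] r_eq[OF assms(1)] by (simp add: diff)
  moreover have "s t - s j \<in> K t"
    using s_mem[OF reg] s_mem[OF assms(1)] krylov_mono[OF assms(2)] by (intro subspace_diff) auto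
  ultimately have "inner (r t) (r j - r t) = 0" using r_orthogonal[OF assms(1)] by simp
  then show ?thesis by (simp add: inner_diff_right power2_norm_eq_inner inner_commute)
qed

lemma inner_b_residual: "regular t \<Longrightarrow> inner b (r t) = - (norm (r t))\<^sup>2"
  using inner_residuals[of t 0] by (simp add: cr_0)

lemma norm_residual_mono:
  assumes "regular t" "j \<le> t"
  shows "norm (r t) \<le> norm (r j)"
proof -
  have "norm (r t) * norm (r t) \<le> norm (r j) * norm (r t)"
    using inner_residuals[OF assms] norm_cauchy_schwarz[of "r j" "r t"] by (simp add: power2_eq_square)
  then show ?thesis by (cases "r t = 0") auto
qed

lemma norm_image_iterate:
  assumes "regular t" shows "(norm (A (s t)))\<^sup>2 = (norm b)\<^sup>2 - (norm (r t))\<^sup>2"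
proof -
  have "A (s t) = - b - r t" using r_eq[OF assms] by simp
  then show ?thesis using inner_b_residual[OF assms]
    by (simp add: power2_norm_eq_inner inner_diff_left inner_diff_right inner_commute)
qed

text \<open>In the conjugate basis of the residuals the coefficient of \<open>r\<^sub>j\<close> in \<open>s\<^sub>t\<close> has the sign of
  \<open>\<langle>r\<^sub>j, A s\<^sub>t\<rangle> = \<parallel>r\<^sub>j\<parallel>\<^sup>2 - \<parallel>r\<^sub>t\<parallel>\<^sup>2 \<ge> 0\<close>, while \<open>\<langle>r\<^sub>j, r\<^sub>t\<rangle> = \<parallel>r\<^sub>t\<parallel>\<^sup>2\<close>.\<close>

lemma inner_iterate_residual_nonneg:
  assumes "regular t" shows "0 \<le> inner (s t) (r t)"
proof -
  have cone: "0 \<le> inner w v"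
    if "regular n" "w \<in> K n" "\<And>j. j < n \<Longrightarrow> 0 \<le> inner (r j) (A w)" "\<And>j. j < n \<Longrightarrow> 0 \<le> inner (r j) v"
    for n w v
    using that
  proof (induction n arbitrary: w)
    case (Suc n)
    obtain c k where k: "k \<in> K n" and w: "w = c *\<^sub>R r n + k" using K_Suc_residual Suc.prems by metis
    have pos: "0 < inner (r n) (A (r n))" and reg: "regular n"
      using Suc.prems by (auto simp: regular_Suc)
    have "0 \<le> inner (r n) (A w)" using Suc.prems by simp
    also have "inner (r n) (A w) = c * inner (r n) (A (r n))"
      using r_orthogonal[OF reg k] by (simp add: w add scale inner_add_right)
    finally have "0 \<le> c" using pos by (simp add: zero_le_mult_iff)
    have "0 \<le> inner (r j) (A k)" if j: "j < n" for j
    proof -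
      have "r j \<in> K n"
        using r_mem[OF regular_mono[OF reg, of j]] krylov_mono[of "Suc j" n b] j by auto
      then have "inner (r j) (A (r n)) = 0"
        using r_orthogonal[OF reg, of "r j"] symmetric[of "r j" "r n"] cr_mem by (metis inner_commute)
      then show ?thesis using Suc.prems(3)[of j] j by (simp add: w add scale inner_add_right)
    qed
    then have "0 \<le> inner k v" by (rule Suc.IH[OF reg k _ Suc.prems(4)[OF less_SucI]])
    then show ?case using \<open>0 \<le> c\<close> Suc.prems(4)[of n] by (simp add: w inner_add_left)
  qed simp
  show ?thesis
  proof (rule cone[OF assms s_mem[OF assms]])
    fix j assume j: "j < t"
    show "0 \<le> inner (r j) (r t)" using inner_residuals[OF assms, of j] j by simp
    have "A (s t) = r 0 - r t" using r_eq[OF assms] by (simp add: cr_0)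
    then have "inner (r j) (A (s t)) = (norm (r j))\<^sup>2 - (norm (r t))\<^sup>2"
      using inner_residuals[OF assms, of j] inner_residuals[of j 0] regular_mono[OF assms, of j] j
      by (simp add: inner_diff_right inner_commute[of "r j" "r 0"])
    then show "0 \<le> inner (r j) (A (s t))" using norm_residual_mono[OF assms, of j] j by simp
  qed
qed

text \<open>One step of steepest descent for the residual is available in the next Krylov space.\<close>

lemma residual_contraction:
  assumes reg: "regular (Suc t)" and L: "0 < L" and \<sigma>: "0 < \<sigma>"
    and lower: "\<sigma> * (norm (r t))\<^sup>2 \<le> inner (r t) (A (r t))" and upper: "norm (A (r t)) \<le> L * norm (r t)"
  shows "(norm (r (Suc t)))\<^sup>2 \<le> (1 - (\<sigma> / L)\<^sup>2) * (norm (r t))\<^sup>2"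
proof -
  have reg': "regular t" using reg by (simp add: regular_Suc)
  \<comment> \<open>the minimiser of the quadratic bound in the second estimate below\<close>
  define a where "a = \<sigma> / L\<^sup>2"
  define w where "w = s t + a *\<^sub>R r t"
  have "w \<in> K (Suc t)"
    unfolding w_def using s_mem[OF reg'] r_mem[OF reg'] krylov_mono[of t "Suc t" b]
    by (intro subspace_add subspace_scale) auto
  then have "(norm (r (Suc t)))\<^sup>2 \<le> (norm (A w + b))\<^sup>2"
    using residual_pythagoras[OF reg] by simp
  also have "A w + b = - (r t - a *\<^sub>R A (r t))"
    using r_eq[OF reg'] by (simp add: w_def add scale)
  also have "(norm (- (r t - a *\<^sub>R A (r t))))\<^sup>2 =
      (norm (r t))\<^sup>2 - 2 * a * inner (r t) (A (r t)) + a\<^sup>2 * (norm (A (r t)))\<^sup>2"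
    unfolding power2_norm_eq_inner
    by (simp add: inner_diff_left inner_diff_right inner_commute power2_eq_square algebra_simps)
  also have "\<dots> \<le> (norm (r t))\<^sup>2 - 2 * a * (\<sigma> * (norm (r t))\<^sup>2) + a\<^sup>2 * (L * norm (r t))\<^sup>2"
    using \<sigma> by (intro add_mono diff_mono mult_left_mono lower power_mono upper) (auto simp: a_def)
  also have "\<dots> = (1 - (\<sigma> / L)\<^sup>2) * (norm (r t))\<^sup>2"
    using L by (simp add: a_def field_simps power2_eq_square)
  finally show ?thesis .
qed

subsection \<open>Termination and the grade\<close>

lemma regular_bound:
  assumes "finite E" "V \<subseteq> span E" "regular t" shows "t \<le> card E"
proof -
  have "\<exists>S. independent S \<and> S \<subseteq> K t \<and> finite S \<and> card S = t" using assms(3)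
  proof (induction t)
    case 0
    show ?case by (intro exI[of _ "{}"]) (auto simp: independent_empty)
  next
    case (Suc t)
    then have reg: "regular t" by (simp add: regular_Suc)
    then obtain S where S: "independent S" "S \<subseteq> K t" "finite S" "card S = t" using Suc.IH by blast
    have "span S \<subseteq> K t" using S by (intro span_minimal) auto
    then have "r t \<notin> span S" using r_not_mem[OF Suc.prems] by auto
    moreover have "S \<subseteq> K (Suc t)" using S krylov_mono[of t "Suc t" b] by auto
    moreover have "r t \<notin> S" using \<open>r t \<notin> span S\<close> span_base[of "r t" S] by blast
    ultimately show ?case using S r_mem[OF reg]
      by (intro exI[of _ "insert (r t) S"]) (simp add: independent_insert)
  qed
  then obtain S where S: "independent S" "S \<subseteq> K t" "card S = t" by blast
  have "S \<subseteq> span E" using S K_subset assms(2) by blast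
  then show ?thesis using independent_span_bound[OF assms(1) S(1)] S by auto
qed

lemma K_stationary:
  assumes "(A ^^ j) b \<in> K j" shows "K n \<subseteq> K j"
proof -
  have eq: "K (Suc j) = K j"
  proof
    show "K (Suc j) \<subseteq> K j"
    proof
      fix x assume "x \<in> K (Suc j)"
      then obtain c where "x - c *\<^sub>R (A ^^ j) b \<in> K j" by (auto simp: krylov_Suc)
      from subspace_add[OF subspace_krylov this subspace_scale[OF subspace_krylov assms, of c]]
      show "x \<in> K j" by simp
    qed
  qed (intro krylov_mono, simp)
  show ?thesis
  proof (rule krylov_least)
    show "b \<in> K j" using assms power_mem_krylov[of 0 j b] by (cases j) auto
    show "A x \<in> K j" if "x \<in> K j" for x using image_mem_krylov[OF that] eq by simp
  qed simp
qed

lemma K_dim_new: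
  assumes "\<And>j. j < t \<Longrightarrow> (A ^^ j) b \<notin> K j"
  shows "independent ((\<lambda>i. (A ^^ i) b) ` {..<t}) \<and> card ((\<lambda>i. (A ^^ i) b) ` {..<t}) = t"
  using assms
proof (induction t)
  case 0 then show ?case by (simp add: independent_empty)
next
  case (Suc t)
  let ?S = "(\<lambda>i. (A ^^ i) b) ` {..<t}"
  have IH: "independent ?S \<and> card ?S = t" using Suc by auto
  have new: "(A ^^ t) b \<notin> span ?S" using Suc.prems[of t] by (simp add: krylov_def)
  then have "(A ^^ t) b \<notin> ?S" using span_base[of "(A ^^ t) b" ?S] by blast
  then show ?case using IH new by (simp add: lessThan_Suc independent_insert)
qed

text \<open>The dimensions of the Krylov spaces grow by one up to the first power of \<open>A\<close> that brings
  nothing new; this index is the grade, and every regular step brings something new.\<close>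

lemma regular_le_grade:
  assumes "regular t" shows "t \<le> grade A b"
proof -
  obtain E where E: "finite E" "V = span E" using fin_dim by (auto simp: fin_dim_def)
  have "\<exists>j. (A ^^ j) b \<in> K j"
  proof (rule ccontr)
    assume "\<nexists>j. (A ^^ j) b \<in> K j"
    then have *: "independent ((\<lambda>i. (A ^^ i) b) ` {..<Suc (card E)})"
      "card ((\<lambda>i. (A ^^ i) b) ` {..<Suc (card E)}) = Suc (card E)"
      using K_dim_new[of "Suc (card E)"] by auto
    have "(\<lambda>i. (A ^^ i) b) ` {..<Suc (card E)} \<subseteq> span E"
      using power_mem_krylov K_subset E(2) by blast
    from independent_span_bound[OF E(1) *(1) this] *(2) show False by simp
  qed
  define m where "m = (LEAST j. (A ^^ j) b \<in> K j)"
  have m: "(A ^^ m) b \<in> K m" unfolding m_def using \<open>\<exists>j. (A ^^ j) b \<in> K j\<close> by (rule LeastI_ex)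
  have new: "(A ^^ j) b \<notin> K j" if "j < m" for j using that not_less_Least unfolding m_def by blast
  have small: "dim (K n) = n" if "n \<le> m" for n
    using K_dim_new[of n] new that by (auto simp: krylov_def dim_eq_card_independent)
  have dimK: "dim (K n) = min n m" for n
  proof (cases "n \<le> m")
    case False
    then have "K n = K m" using K_stationary[OF m, of n] krylov_mono[of m n b] by auto
    then show ?thesis using small[of m] False by simp
  qed (simp add: small)
  have "grade A b = m" unfolding grade_def
  proof (rule the_equality)
    show "\<forall>t\<ge>1. dim (krylov A b t) = min t m" using dimK by simp
    fix m' assume "\<forall>t\<ge>1. dim (krylov A b t) = min t m'"
    then have "min (Suc (m + m')) m = min (Suc (m + m')) m'" using dimK by (metis le_add1 plus_1_eq_Suc)
    then show "m' = m" by simp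
  qed
  moreover have "t \<le> m"
  proof (rule ccontr)
    assume "\<not> t \<le> m"
    then have reg: "regular (Suc m)" using assms regular_mono by simp
    then have "r m \<in> K m" using r_mem[of m] K_stationary[OF m, of "Suc m"] by (auto simp: regular_Suc)
    then show False using r_not_mem[OF reg] by simp
  qed
  ultimately show ?thesis by simp
qed

lemma regular_if_no_stop:
  assumes "0 \<le> \<eta>" "\<And>i. 1 \<le> i \<Longrightarrow> i \<le> t \<Longrightarrow> \<not> cr_npc A b i \<and> \<not> cr_sol A b \<eta> i"
  shows "regular t"
  unfolding regular_def
proof (intro allI impI)
  fix i assume "i < t"
  then have *: "\<not> cr_npc A b (Suc i)" "\<not> cr_sol A b \<eta> (Suc i)" using assms(2)[of "Suc i"] by auto
  then have "r i \<noteq> 0" using assms(1) by (auto simp: cr_sol_def)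
  then show "0 < inner (r i) (A (r i))" using * by (auto simp: cr_npc_def)
qed

text \<open>The procedure stops where its recurrence version stops, within \<open>d + 1\<close> iterations, and all
  residuals before the last one are regular.\<close>

lemma minres_iters_props:
  assumes \<eta>: "0 \<le> \<eta>" and E: "finite E" "V \<subseteq> span E"
  defines "N \<equiv> minres_iters A b \<eta>"
  shows "N = (LEAST t. 1 \<le> t \<and> (cr_npc A b t \<or> cr_sol A b \<eta> t))"
    "1 \<le> N" "N \<le> Suc (card E)" "cr_npc A b N \<or> cr_sol A b \<eta> N" "regular (N - 1)"
    "\<And>t. 1 \<le> t \<Longrightarrow> t < N \<Longrightarrow> \<not> cr_npc A b t \<and> \<not> cr_sol A b \<eta> t"
    "minres A b \<eta> = (if cr_npc A b N then (NPC, r (N - 1)) else (SOL, s (N - 1)))"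
proof -
  let ?Q = "\<lambda>t. 1 \<le> t \<and> (cr_npc A b t \<or> cr_sol A b \<eta> t)"
  define m where "m = (LEAST t. ?Q t)"
  have "\<exists>t\<le>Suc (card E). ?Q t"
  proof (rule ccontr)
    assume "\<not> (\<exists>t\<le>Suc (card E). ?Q t)"
    then have "regular (Suc (card E))" by (intro regular_if_no_stop[OF \<eta>]) auto
    from regular_bound[OF E this] show False by simp
  qed
  then obtain t where t: "t \<le> Suc (card E)" "?Q t" by blast
  have Qm: "?Q m" unfolding m_def using t(2) by (rule LeastI)
  have le: "m \<le> Suc (card E)" using Least_le[of ?Q, OF t(2)] t(1) by (simp add: m_def)
  have less: "\<not> cr_npc A b t \<and> \<not> cr_sol A b \<eta> t" if "1 \<le> t" "t < m" for t
    using not_less_Least[of t ?Q] that by (auto simp: m_def)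
  have reg: "regular (t - 1)" if "t \<le> m" for t
    using that Qm less by (intro regular_if_no_stop[OF \<eta>]) auto
  have agree: "npc_at A b t = cr_npc A b t" "sol_at A b \<eta> t = cr_sol A b \<eta> t" if "t \<le> m" for t
    using reg[OF that] npc_at_eq sol_at_eq by auto
  have N: "N = m" unfolding N_def minres_iters_def
  proof (rule Least_equality)
    show "1 \<le> m \<and> (npc_at A b m \<or> sol_at A b \<eta> m)" using Qm agree[of m] by simp
    show "m \<le> y" if "1 \<le> y \<and> (npc_at A b y \<or> sol_at A b \<eta> y)" for y
      using that agree[of y] less[of y] by (meson not_le_imp_less less_imp_le)
  qed
  show "N = (LEAST t. 1 \<le> t \<and> (cr_npc A b t \<or> cr_sol A b \<eta> t))" using N by (simp add: m_def)
  show "1 \<le> N" "N \<le> Suc (card E)" "cr_npc A b N \<or> cr_sol A b \<eta> N" "regular (N - 1)"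
    "\<And>t. 1 \<le> t \<Longrightarrow> t < N \<Longrightarrow> \<not> cr_npc A b t \<and> \<not> cr_sol A b \<eta> t"
    using Qm le reg[of m] less by (auto simp: N)
  show "minres A b \<eta> = (if cr_npc A b N then (NPC, r (N - 1)) else (SOL, s (N - 1)))"
    using agree[of m] reg[of m] N
    by (simp add: minres_def Let_def N_def[symmetric] minres_r_eq minres_s_eq)
qed

text \<open>If a regular run ends with residual zero, then \<open>-b = A s\<close> for some \<open>s\<close> in the Krylov space;
  the leading power of \<open>A\<close> in \<open>s\<close> shows that the space is invariant.\<close>

lemma K_invariant_if_solved:
  assumes reg: "regular m" and zero: "r m = 0" shows "K n \<subseteq> K m"
proof (cases "b = 0")
  case True
  have "(A ^^ i) b = 0" for i by (induction i) (auto simp: True)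
  then have "K n \<subseteq> {0}" unfolding krylov_def by (intro span_minimal) auto
  then show ?thesis using subspace_0[OF subspace_krylov] by blast
next
  case False
  have lead: "\<exists>j<n. \<exists>c. c \<noteq> 0 \<and> x - c *\<^sub>R (A ^^ j) b \<in> K j" if "x \<in> K n" "x \<noteq> 0" for n x
    using that
  proof (induction n)
    case (Suc n)
    then obtain c where c: "x - c *\<^sub>R (A ^^ n) b \<in> K n" by (auto simp: krylov_Suc)
    show ?case
    proof (cases "c = 0")
      case True
      then show ?thesis using Suc c by (auto simp: less_Suc_eq)
    qed (use c in blast)
  qed simp
  have As: "A (s m) = - b" using r_eq[OF reg] zero by (simp add: eq_neg_iff_add_eq_0)
  have "s m \<noteq> 0" using As False by auto
  then obtain j c where j: "j < m" "c \<noteq> 0" "s m - c *\<^sub>R (A ^^ j) b \<in> K j" using lead[OF s_mem[OF reg]] by blast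
  from image_mem_krylov[OF j(3)] have "- b - c *\<^sub>R (A ^^ Suc j) b \<in> K (Suc j)"
    by (simp add: diff scale As)
  moreover have "b \<in> K (Suc j)" using power_mem_krylov[of 0 "Suc j" b] by simp
  ultimately have "(- 1 / c) *\<^sub>R ((- b - c *\<^sub>R (A ^^ Suc j) b) + b) \<in> K (Suc j)"
    by (intro subspace_scale subspace_add subspace_krylov)
  then have "(A ^^ Suc j) b \<in> K (Suc j)" using j(2) by simp
  from K_stationary[OF this, of n] show ?thesis using krylov_mono[of "Suc j" m b] j by auto
qed

text \<open>With tolerance zero the flag SOL means that the system was solved exactly, so without an NPC
  flag in the first \<open>n\<close> iterations the form is nonnegative on the \<open>n\<close>-th Krylov space.\<close>

lemma nonneg_on_krylov_if_no_npc:
  assumes N: "\<not> (minres_iters A b 0 \<le> n \<and> fst (minres A b 0) = NPC)" and w: "w \<in> K n"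
  shows "0 \<le> inner w (A w)"
proof -
  obtain E where E: "finite E" "V \<subseteq> span E" using fin_dim by (auto simp: fin_dim_def)
  define N where "N = minres_iters A b 0"
  note props = minres_iters_props[OF order.refl E, folded N_def]
  show ?thesis
  proof (cases "N \<le> n")
    case False
    then have "regular n" using regular_mono[OF props(5)] by simp
    then show ?thesis using positive_on_krylov[of n w] w by (cases "w = 0") (auto intro: less_imp_le)
  next
    case True
    then have "\<not> cr_npc A b N" using N props(7) by (auto simp: N_def split: if_splits)
    moreover from this have "A (r (N - 1)) = 0" using props(4) by (auto simp: cr_sol_def)
    ultimately have "r (N - 1) = 0" by (auto simp: cr_npc_def)
    from K_invariant_if_solved[OF props(5) this, of n] have "w \<in> K (N - 1)" using w by auto
    then show ?thesis using positive_on_krylov[OF props(5), of w] by (cases "w = 0") (auto intro: less_imp_le)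
  qed
qed

end

section \<open>Coordinates of finitely supported sequences\<close>

definition axis_seq :: "nat \<Rightarrow> rseq" where
  "axis_seq i = mk_rseq (\<lambda>j. if j = i then 1 else 0)"

lemma coord_axis_seq [simp]: "coord (axis_seq i) j = (if j = i then 1 else 0)"
  by (simp add: axis_seq_def coord_mk)

lemma inner_axis_seq [simp]: "inner (axis_seq i) x = coord x i"
  by (subst inner_rseq_sum[of "{i}"]) auto

lemma coord_sum [simp]: "coord (\<Sum>i\<in>S. h i) j = (\<Sum>i\<in>S. coord (h i) j)"
  by (induction S rule: infinite_finite_induct) auto

lemma vec_of_eq_sum: "vec_of d y = (\<Sum>i<d. y i *\<^sub>R axis_seq i)"
  by (rule rseq_eqI) (simp add: coord_vec_of if_distrib[where f = "\<lambda>x. _ * x"] sum.delta cong: if_cong)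

lemma norm_axis_seq [simp]: "norm (axis_seq i) = 1"
  by (simp add: norm_eq_1)

lemma orthonormal_axis_seq: "orthonormal (axis_seq ` S)"
  by (auto simp: orthonormal_def pairwise_def orthogonal_def)

lemma vec_of_coord: "x \<in> Rn d \<Longrightarrow> vec_of d (coord x) = x"
  by (rule rseq_eqI) (auto simp: coord_vec_of Rn_def)

lemma vec_of_in_Rn [simp]: "vec_of d y \<in> Rn d"
  by (simp add: Rn_def coord_vec_of)

lemma Rn_expand: "x \<in> Rn d \<Longrightarrow> x = (\<Sum>i<d. coord x i *\<^sub>R axis_seq i)"
  using vec_of_coord[of x d] by (simp add: vec_of_eq_sum)

lemma axis_seq_in_Rn: "i < d \<Longrightarrow> axis_seq i \<in> Rn d"
  by (auto simp: Rn_def)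

lemma Rn_eq_span: "Rn d = span (axis_seq ` {..<d})"
proof
  show "Rn d \<subseteq> span (axis_seq ` {..<d})"
  proof
    fix x assume "x \<in> Rn d"
    from Rn_expand[OF this] show "x \<in> span (axis_seq ` {..<d})"
      by (rule ssubst) (intro span_sum span_scale span_base, auto)
  qed
  show "span (axis_seq ` {..<d}) \<subseteq> Rn d"
    by (intro span_minimal subspace_Rn) (auto intro: axis_seq_in_Rn)
qed

lemma fin_dim_Rn: "fin_dim (Rn d)"
  unfolding fin_dim_def
  by (intro exI[of _ "axis_seq ` {..<d}"]) (simp add: orthonormal_axis_seq Rn_eq_span)

lemma closed_Rn: "closed (Rn d)"
proof -
  have "Rn d = (\<Inter>i\<in>{d..}. {x. inner (axis_seq i) x = 0})" by (auto simp: Rn_def)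
  also have "closed \<dots>" by (intro closed_INT ballI closed_Collect_eq continuous_intros)
  finally show ?thesis .
qed

lemma norm_vec_of_le: "norm (vec_of d y) \<le> (\<Sum>i<d. \<bar>y i\<bar>)"
  unfolding vec_of_eq_sum by (rule order.trans[OF norm_sum]) simp

lemma vec_of_diff: "vec_of d y - vec_of d z = vec_of d (\<lambda>i. y i - z i)"
  by (rule rseq_eqI) (simp add: coord_vec_of)

lemma ex_Rn: "\<exists>d. x \<in> Rn d"
proof -
  obtain d where "{i. coord x i \<noteq> 0} \<subseteq> {..<d}"
    using finite_coord[of x] unfolding finite_nat_iff_bounded by blast
  then have "x \<in> Rn d" by (auto simp: Rn_def subset_iff not_less[symmetric])
  then show ?thesis by blast
qed

text \<open>The finite rational sequences are dense, so the balls of rational radius around them form a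
  countable base.  This makes sums, products and inner products of measurable functions
  measurable.\<close>

instance rseq :: second_countable_topology
proof
  define D where "D = range (\<lambda>l :: rat list. vec_of (length l) (\<lambda>i. of_rat (l ! i)))"
  define B where "B = (\<lambda>(c, q). ball c (of_rat q)) ` (D \<times> {q :: rat. 0 < q})"
  have dense: "\<exists>c\<in>D. dist x c < e" if e: "0 < e" for x :: rseq and e :: real
  proof -
    obtain d where x: "x \<in> Rn d" using ex_Rn by blast
    have "\<forall>i. \<exists>q::rat. coord x i < of_rat q \<and> of_rat q < coord x i + e / (d + 1)"
      using e by (intro allI of_rat_dense) (simp add: field_simps)
    then obtain q :: "nat \<Rightarrow> rat"
      where q: "\<And>i. coord x i < of_rat (q i) \<and> of_rat (q i) < coord x i + e / (d + 1)" by metis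
    define l where "l = map q [0..<d]"
    have l: "vec_of (length l) (\<lambda>i. of_rat (l ! i)) = vec_of d (\<lambda>i. of_rat (q i))"
      by (rule rseq_eqI) (simp add: coord_vec_of l_def)
    have "dist x (vec_of d (\<lambda>i. of_rat (q i))) = norm (vec_of d (coord x) - vec_of d (\<lambda>i. of_rat (q i)))"
      by (simp add: dist_norm vec_of_coord[OF x])
    also have "\<dots> \<le> (\<Sum>i<d. \<bar>coord x i - of_rat (q i)\<bar>)"
      unfolding vec_of_diff by (rule norm_vec_of_le)
    also have "\<dots> \<le> (\<Sum>i<d. e / (d + 1))"
    proof (rule sum_mono)
      fix i show "\<bar>coord x i - of_rat (q i)\<bar> \<le> e / (d + 1)" using q[of i] by (simp add: abs_le_iff)
    qed
    also have "\<dots> < e" using e by (simp add: field_simps)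
    finally show ?thesis using l unfolding D_def by (metis rangeI)
  qed
  have "topological_basis B"
  proof (rule topological_basisI)
    fix b assume "b \<in> B" then show "open b" by (auto simp: B_def)
  next
    fix O' and x :: rseq assume "open O'" "x \<in> O'"
    then obtain e where e: "0 < e" "ball x e \<subseteq> O'" by (metis open_contains_ball)
    obtain q :: rat where q: "(0::real) < of_rat q" "of_rat q < e / 2"
      using of_rat_dense[of 0 "e / 2"] half_gt_zero[OF e(1)] by blast
    obtain c where c: "c \<in> D" "dist x c < of_rat q" using dense[OF q(1)] by blast
    have "ball c (of_rat q) \<subseteq> O'"
    proof
      fix y assume "y \<in> ball c (of_rat q)"
      then have "dist x y < e" using c q dist_triangle[of x y c] by auto
      then show "y \<in> O'" using e by auto
    qed
    moreover have "ball c (of_rat q) \<in> B" using c q by (auto simp: B_def intro!: image_eqI[of _ _ "(c, q)"])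
    moreover have "x \<in> ball c (of_rat q)" using c(2) by (simp add: dist_commute[of c x])
    ultimately show "\<exists>B'\<in>B. x \<in> B' \<and> B' \<subseteq> O'" by blast
  qed
  have "countable (UNIV :: rat list set)" by (rule countableI_type)
  then have D: "countable D" unfolding D_def by (rule countable_image)
  have "countable {q :: rat. 0 < q}" by (rule countableI_type)
  with D have "countable (D \<times> {q :: rat. 0 < q})" by (rule countable_SIGMA)
  then have "countable B" unfolding B_def by (rule countable_image)
  with \<open>topological_basis B\<close> show "\<exists>B::rseq set set. countable B \<and> open = generate_topology B"
    using topological_basis_imp_subbasis by blast
qed

section \<open>Slabs of the sphere have small measure\<close>

abbreviation cube_space :: "nat \<Rightarrow> (nat \<Rightarrow> real) measure" where
  "cube_space d \<equiv> \<Pi>\<^sub>M i\<in>{..<d}. lborel"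

interpretation lborel_prod: product_sigma_finite "\<lambda>i::nat. lborel :: real measure"
  by standard

lemma measurable_vec_of [measurable]: "vec_of d \<in> borel_measurable (cube_space d)"
proof -
  have "(\<lambda>y. \<Sum>i<d. y i *\<^sub>R axis_seq i) \<in> borel_measurable (cube_space d)" by measurable
  then show ?thesis by (simp add: vec_of_eq_sum[abs_def])
qed

lemma measurable_affine_coordinates [measurable]:
  "(\<lambda>x. \<lambda>i\<in>{..<d}. (x i - t i) / c) \<in> measurable (cube_space d) (cube_space d)"
  by measurable

lemma emeasure_lborel_affine:
  fixes c t :: real
  assumes "0 < c" "A \<in> sets borel"
  shows "emeasure lborel ((\<lambda>x. (x - t) / c) -` A) = ennreal c * emeasure lborel A"
proof -
  have eq: "(\<lambda>x. - t / c + 1 / c * x) = (\<lambda>x. (x - t) / c)"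
    using assms by (auto simp: field_simps)
  have "emeasure lborel A = emeasure (density (distr lborel borel (\<lambda>x. (x - t) / c)) (\<lambda>_. ennreal (1 / c))) A"
    using lborel_real_affine[of "1 / c" "- t / c"] assms unfolding eq by simp
  also have "\<dots> = ennreal (1 / c) * emeasure lborel ((\<lambda>x. (x - t) / c) -` A)"
    using assms by (simp add: emeasure_density_const emeasure_distr)
  finally show ?thesis
    using assms by (simp add: mult.assoc[symmetric] ennreal_mult[symmetric])
qed

lemma emeasure_cube_space_affine:
  assumes c: "0 < c" and S: "S \<in> sets (cube_space d)"
  shows "emeasure (cube_space d) {x \<in> space (cube_space d). (\<lambda>i\<in>{..<d}. (x i - t i) / c) \<in> S} =
    ennreal (c ^ d) * emeasure (cube_space d) S"
proof -
  let ?\<phi> = "\<lambda>x. \<lambda>i\<in>{..<d}. (x i - t i) / c"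
  let ?Q = "scale_measure (ennreal ((1 / c) ^ d)) (distr (cube_space d) (cube_space d) ?\<phi>)"
  have "?Q = cube_space d"
  proof (rule lborel_prod.PiM_eqI)
    fix A :: "nat \<Rightarrow> real set" assume A: "\<And>i. i \<in> {..<d} \<Longrightarrow> A i \<in> sets lborel"
    have "?\<phi> -` (Pi\<^sub>E {..<d} A) \<inter> space (cube_space d) = Pi\<^sub>E {..<d} (\<lambda>i. (\<lambda>x. (x - t i) / c) -` A i)"
      by (auto simp: space_PiM PiE_iff)
    moreover have "(\<lambda>x. (x - t i) / c) -` A i \<in> sets lborel" if "i < d" for i
      using measurable_sets[of "\<lambda>x. (x - t i) / c" borel borel "A i"] A[of i] that by simp
    moreover from this have "emeasure (cube_space d) (Pi\<^sub>E {..<d} (\<lambda>i. (\<lambda>x. (x - t i) / c) -` A i)) =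
        (\<Prod>i<d. emeasure lborel ((\<lambda>x. (x - t i) / c) -` A i))"
      by (intro lborel_prod.emeasure_PiM) auto
    ultimately have "emeasure ?Q (Pi\<^sub>E {..<d} A) =
        ennreal ((1 / c) ^ d) * (\<Prod>i<d. emeasure lborel ((\<lambda>x. (x - t i) / c) -` A i))"
      using A by (simp add: emeasure_distr sets_PiM_I_finite)
    also have "\<dots> = ennreal ((1 / c) ^ d) * (\<Prod>i<d. ennreal c * emeasure lborel (A i))"
      using A c by (simp add: emeasure_lborel_affine)
    also have "\<dots> = (ennreal ((1 / c) ^ d) * ennreal (c ^ d)) * (\<Prod>i<d. emeasure lborel (A i))"
      using c by (simp add: prod.distrib ennreal_power mult.assoc)
    also have "ennreal ((1 / c) ^ d) * ennreal (c ^ d) = 1"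
      using c by (simp add: ennreal_mult[symmetric] power_mult_distrib[symmetric])
    finally show "emeasure ?Q (Pi\<^sub>E {..<d} A) = (\<Prod>i\<in>{..<d}. emeasure lborel (A i))"
      by (simp only: mult_1)
  qed simp_all
  then have "emeasure (cube_space d) S = emeasure ?Q S" by simp
  also have "\<dots> = ennreal ((1 / c) ^ d) * emeasure (cube_space d) {x \<in> space (cube_space d). ?\<phi> x \<in> S}"
    using S by (simp add: emeasure_distr vimage_def Int_def conj_commute)
  finally have "ennreal (c ^ d) * emeasure (cube_space d) S = (ennreal (c ^ d) * ennreal ((1 / c) ^ d)) *
      emeasure (cube_space d) {x \<in> space (cube_space d). ?\<phi> x \<in> S}"
    by (simp add: mult.assoc)
  also have "ennreal (c ^ d) * ennreal ((1 / c) ^ d) = 1"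
    using c by (simp add: ennreal_mult[symmetric] power_mult_distrib[symmetric])
  finally show ?thesis by (simp only: mult_1)
qed

definition unit_ball :: "nat \<Rightarrow> (nat \<Rightarrow> real) set" where
  "unit_ball d = {y \<in> space (cube_space d). norm (vec_of d y) \<le> 1}"

lemma unit_ball_sets [measurable]: "unit_ball d \<in> sets (cube_space d)"
  unfolding unit_ball_def by measurable

lemma emeasure_unit_ball_finite: "emeasure (cube_space d) (unit_ball d) < \<infinity>"
proof -
  have "unit_ball d \<subseteq> Pi\<^sub>E {..<d} (\<lambda>_. {-1..1})"
  proof
    fix y assume y: "y \<in> unit_ball d"
    have "\<bar>y i\<bar> \<le> 1" if "i < d" for i
      using Cauchy_Schwarz_ineq2[of "axis_seq i" "vec_of d y"] that y
      by (simp add: unit_ball_def coord_vec_of)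
    then show "y \<in> Pi\<^sub>E {..<d} (\<lambda>_. {-1..1})"
      using y by (auto simp: unit_ball_def space_PiM PiE_iff abs_le_iff minus_le_iff)
  qed
  then have "emeasure (cube_space d) (unit_ball d) \<le> emeasure (cube_space d) (Pi\<^sub>E {..<d} (\<lambda>_. {-1..1}))"
    by (intro emeasure_mono) (auto intro!: sets_PiM_I_finite)
  also have "\<dots> = (\<Prod>i<d. ennreal 2)"
    by (subst lborel_prod.emeasure_PiM) auto
  also have "\<dots> = ennreal (\<Prod>i<d. 2)" by (rule prod_ennreal) simp
  also have "\<dots> < \<infinity>" by (simp only: infinity_ennreal_def ennreal_less_top)
  finally show ?thesis .
qed

definition punctured_ball :: "nat \<Rightarrow> (nat \<Rightarrow> real) set" where
  "punctured_ball d = {y \<in> space (cube_space d). 0 < norm (vec_of d y) \<and> norm (vec_of d y) \<le> 1}"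

lemma punctured_ball_sets [measurable]: "punctured_ball d \<in> sets (cube_space d)"
  unfolding punctured_ball_def by measurable

lemma emeasure_punctured_ball:
  assumes "1 \<le> d"
  shows "emeasure (cube_space d) (punctured_ball d) = emeasure (cube_space d) (unit_ball d)"
proof -
  let ?Z = "Pi\<^sub>E {..<d} (\<lambda>_. {0::real})"
  have "emeasure (cube_space d) ?Z = (\<Prod>i<d. emeasure lborel {0::real})"
    by (subst lborel_prod.emeasure_PiM) auto
  then have "emeasure (cube_space d) ?Z = 0" using assms by simp
  moreover have "?Z \<in> sets (cube_space d)" by (rule sets_PiM_I_finite) auto
  ultimately have Z: "?Z \<in> null_sets (cube_space d)" by (simp only: null_sets_def mem_Collect_eq simp_thms)
  have "punctured_ball d = unit_ball d - ?Z"
  proof -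
    have "vec_of d y = 0 \<longleftrightarrow> y \<in> ?Z" if "y \<in> space (cube_space d)" for y
    proof -
      have "vec_of d y = 0 \<longleftrightarrow> (\<forall>i<d. y i = 0)"
        by (auto simp: coord_vec_of intro!: rseq_eqI dest!: arg_cong[of _ _ coord] dest: fun_cong)
           (metis coord_vec_of coord_zero)
      then show ?thesis using that by (auto simp: space_PiM PiE_iff extensional_def fun_eq_iff)
    qed
    then show ?thesis by (auto simp: punctured_ball_def unit_ball_def)
  qed
  then show ?thesis using Z by (simp add: emeasure_Diff_null_set)
qed

lemma emeasure_punctured_ball_pos:
  assumes d: "1 \<le> d" shows "0 < emeasure (cube_space d) (punctured_ball d)"
proof -
  let ?R = "Pi\<^sub>E {..<d} (\<lambda>_. {1 / (2 * d) .. 1 / real d})"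
  have R: "emeasure (cube_space d) ?R = ennreal ((1 / (2 * d)) ^ d)"
    using d by (subst lborel_prod.emeasure_PiM) (auto simp: ennreal_power field_simps)
  have "?R \<subseteq> punctured_ball d"
  proof
    fix y assume y: "y \<in> ?R"
    have "norm (vec_of d y) \<le> (\<Sum>i<d. \<bar>y i\<bar>)" by (rule norm_vec_of_le)
    also have "\<dots> \<le> (\<Sum>i<d. 1 / real d)"
    proof (rule sum_mono)
      fix i assume "i \<in> {..<d}"
      then have "1 / (2 * d) \<le> y i" "y i \<le> 1 / real d" using y by (auto simp: PiE_iff)
      moreover have "0 \<le> 1 / (2 * real d)" by simp
      ultimately show "\<bar>y i\<bar> \<le> 1 / real d" by linarith
    qed
    also have "\<dots> = 1" using d by simp
    finally have "norm (vec_of d y) \<le> 1" .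
    moreover have "coord (vec_of d y) 0 \<noteq> 0"
    proof -
      have "1 / (2 * real d) \<le> y 0" using y d by (auto simp: PiE_iff)
      moreover have "0 < 1 / (2 * real d)" using d by simp
      ultimately have "0 < y 0" by linarith
      then show ?thesis using d by (simp add: coord_vec_of)
    qed
    then have "vec_of d y \<noteq> 0" by auto
    ultimately show "y \<in> punctured_ball d" using y by (auto simp: punctured_ball_def space_PiM PiE_iff)
  qed
  then have "emeasure (cube_space d) ?R \<le> emeasure (cube_space d) (punctured_ball d)"
    by (rule emeasure_mono) simp
  moreover have "0 < emeasure (cube_space d) ?R" unfolding R using d by simp
  ultimately show ?thesis by (meson less_le_trans)
qed

text \<open>Shrink the slab of the ball by the factor \<open>1 - 1 / (2d)\<close>, which costs at most half of its
  volume, and push it in the direction of the normal by multiples of its width.  About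
  \<open>1 / (4 d \<tau>)\<close> of these copies are pairwise disjoint and still contained in the ball.  The factor
  \<open>d\<close> is not optimal, but only its logarithm enters the complexity.\<close>

lemma slab_volume:
  assumes d: "1 \<le> d" and v: "v \<in> Rn d" "norm v = 1" and \<tau>: "0 < \<tau>"
  shows "measure (cube_space d) {y \<in> unit_ball d. \<bar>inner v (vec_of d y)\<bar> \<le> \<tau>}
    \<le> 8 * d * \<tau> * measure (cube_space d) (unit_ball d)"
proof -
  define M where "M = cube_space d"
  define S where "S = {y \<in> unit_ball d. \<bar>inner v (vec_of d y)\<bar> \<le> \<tau>}"
  define c where "c = 1 - 1 / (2 * real d)"
  define N where "N = nat \<lfloor>1 / (4 * d * \<tau>)\<rfloor>"
  define \<phi> where "\<phi> k = (\<lambda>x. \<lambda>i\<in>{..<d}. (x i - 2 * real k * \<tau> * coord v i) / c)" for k :: nat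
  define T where "T k = {x \<in> space M. \<phi> k x \<in> S}" for k
  have c: "1 / 2 \<le> c" "c < 1" using d by (auto simp: c_def field_simps)
  have unit: "unit_ball d \<in> sets M" by (simp add: M_def)
  have fin: "emeasure M (unit_ball d) < \<infinity>" unfolding M_def by (rule emeasure_unit_ball_finite)
  have S: "S \<in> sets M" unfolding S_def M_def by measurable
  have T: "T k \<in> sets M" for k
    unfolding T_def \<phi>_def M_def by (measurable, use S in \<open>simp add: M_def\<close>)
  have T_measure: "measure M (T k) = c ^ d * measure M S" for k
    using emeasure_cube_space_affine[of c S d "\<lambda>i. 2 * real k * \<tau> * coord v i"] c S
    by (simp add: T_def \<phi>_def M_def measure_def enn2real_mult)
  have T_vec: "\<exists>y. norm y \<le> 1 \<and> \<bar>inner v y\<bar> \<le> \<tau> \<and> vec_of d x = c *\<^sub>R y + (2 * real k * \<tau>) *\<^sub>R v"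
    if x: "x \<in> T k" for x k
  proof (intro exI conjI)
    show "norm (vec_of d (\<phi> k x)) \<le> 1" "\<bar>inner v (vec_of d (\<phi> k x))\<bar> \<le> \<tau>"
      using x by (auto simp: T_def S_def unit_ball_def)
    show "vec_of d x = c *\<^sub>R vec_of d (\<phi> k x) + (2 * real k * \<tau>) *\<^sub>R v"
      using c v(1) by (intro rseq_eqI) (auto simp: coord_vec_of \<phi>_def Rn_def)
  qed
  have T_ball: "T k \<subseteq> unit_ball d" if k: "k \<le> N" for k
  proof
    fix x assume x: "x \<in> T k"
    obtain y where y: "norm y \<le> 1" "vec_of d x = c *\<^sub>R y + (2 * real k * \<tau>) *\<^sub>R v"
      using T_vec[OF x] by blast
    have "real N \<le> 1 / (4 * d * \<tau>)" unfolding N_def using \<tau> by (intro of_nat_floor) simp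
    then have "real k \<le> 1 / (4 * d * \<tau>)" using k by linarith
    then have "2 * real k * \<tau> \<le> 1 / (2 * real d)" using \<tau> d by (simp add: field_simps)
    moreover have "norm (vec_of d x) \<le> c * norm y + 2 * real k * \<tau>"
      unfolding y(2) using c \<tau> v(2) by (intro norm_triangle_le) simp
    moreover have "c * norm y \<le> c" using y c by (intro mult_left_le) auto
    ultimately have "norm (vec_of d x) \<le> 1" by (simp add: c_def)
    then show "x \<in> unit_ball d" using x by (auto simp: T_def M_def unit_ball_def)
  qed
  have T_disj: "disjoint_family_on T {..N}"
    unfolding disjoint_family_on_def
  proof safe
    fix k l x assume kl: "k \<noteq> l" and x: "x \<in> T k" "x \<in> T l"
    have vv: "inner v v = 1" using v(2) by (simp add: dot_square_norm)
    have range: "\<bar>inner v (vec_of d x) - 2 * real j * \<tau>\<bar> < \<tau>" if "x \<in> T j" for j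
    proof -
      obtain y where y: "\<bar>inner v y\<bar> \<le> \<tau>" "vec_of d x = c *\<^sub>R y + (2 * real j * \<tau>) *\<^sub>R v"
        using T_vec[OF \<open>x \<in> T j\<close>] by blast
      have "inner v (vec_of d x) - 2 * real j * \<tau> = c * inner v y"
        using vv by (simp add: y(2) inner_add_right)
      also have "\<bar>c * inner v y\<bar> \<le> c * \<tau>" using y c by (simp add: abs_mult)
      also have "c * \<tau> < \<tau>" using c \<tau> by simp
      finally show ?thesis .
    qed
    have "\<bar>2 * real k * \<tau> - 2 * real l * \<tau>\<bar> < 2 * \<tau>" using range[OF x(1)] range[OF x(2)] by linarith
    moreover have "2 * real k * \<tau> - 2 * real l * \<tau> = (real k - real l) * (2 * \<tau>)"
      by (simp add: algebra_simps)
    ultimately have "\<bar>real k - real l\<bar> * (2 * \<tau>) < 1 * (2 * \<tau>)" using \<tau> by (simp add: abs_mult)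
    then have "\<bar>real k - real l\<bar> < 1" using \<tau> by (subst (asm) mult_less_cancel_right) simp
    then show "x \<in> {}" using kl by linarith
  qed
  have "real (N + 1) * (c ^ d * measure M S) = (\<Sum>k\<le>N. measure M (T k))" by (simp add: T_measure)
  also have "\<dots> = measure M (\<Union>k\<le>N. T k)"
  proof (rule measure_finite_Union[symmetric])
    show "emeasure M (T k) \<noteq> \<infinity>" if "k \<in> {..N}" for k
    proof -
      have "emeasure M (T k) \<le> emeasure M (unit_ball d)"
        using T_ball[of k] that unit by (intro emeasure_mono) auto
      then show ?thesis using fin by (auto simp: top_unique)
    qed
  qed (use T T_disj in auto)
  also have "\<dots> \<le> measure M (unit_ball d)"
    using T_ball T unit fin by (intro measure_mono_fmeasurable) (auto simp: fmeasurable_def)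
  finally have main: "real (N + 1) * (c ^ d * measure M S) \<le> measure M (unit_ball d)" .
  have "1 / 2 \<le> c ^ d"
    using Bernoulli_inequality[of "- 1 / (2 * real d)" d] d by (simp add: c_def field_simps)
  moreover have "1 / (4 * d * \<tau>) \<le> real (N + 1)"
    unfolding N_def using real_of_int_floor_add_one_ge[of "1 / (4 * d * \<tau>)"] \<tau>
    by (simp add: add.commute)
  ultimately have "1 / (4 * d * \<tau>) * (1 / 2 * measure M S) \<le> real (N + 1) * (c ^ d * measure M S)"
    using \<tau> by (intro mult_mono) (auto intro: mult_right_mono)
  with main have "1 / (4 * d * \<tau>) * (1 / 2 * measure M S) \<le> measure M (unit_ball d)" by simp
  then show ?thesis using \<tau> d by (simp add: M_def S_def field_simps)
qed

lemma sphere_uniform_eq: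
  "sphere_uniform d = distr (uniform_measure (cube_space d) (punctured_ball d)) borel (\<lambda>y. sgn (vec_of d y))"
  by (simp add: sphere_uniform_def punctured_ball_def)

lemma measurable_sgn_rseq [measurable]: "(sgn :: rseq \<Rightarrow> rseq) \<in> borel_measurable borel"
  unfolding sgn_div_norm[abs_def] by measurable

lemma sets_sphere_uniform [simp, measurable_cong]: "sets (sphere_uniform d) = sets borel"
  by (simp add: sphere_uniform_def)

lemma space_sphere_uniform [simp]: "space (sphere_uniform d) = UNIV"
  by (simp add: sphere_uniform_def)

lemma prob_space_sphere_uniform:
  assumes "1 \<le> d" shows "prob_space (sphere_uniform d)"
proof -
  interpret U: prob_space "uniform_measure (cube_space d) (punctured_ball d)"
    using emeasure_punctured_ball_pos[OF assms] emeasure_punctured_ball[OF assms]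
      emeasure_unit_ball_finite[of d]
    by (intro prob_space_uniform_measure) auto
  show ?thesis unfolding sphere_uniform_eq by (rule U.prob_space_distr) measurable
qed

lemma AE_sphere_uniform:
  assumes "1 \<le> d" shows "AE q in sphere_uniform d. q \<in> Rn d \<and> norm q = 1"
proof -
  have "Rn d \<in> sets borel" using closed_Rn by simp
  then have Rn: "{q \<in> space borel. q \<in> Rn d \<and> norm q = 1} \<in> sets borel" by measurable
  have "AE y in uniform_measure (cube_space d) (punctured_ball d).
      sgn (vec_of d y) \<in> Rn d \<and> norm (sgn (vec_of d y)) = 1"
  proof (rule AE_uniform_measureI)
    show "AE x in cube_space d. x \<in> punctured_ball d \<longrightarrow>
        sgn (vec_of d x) \<in> Rn d \<and> norm (sgn (vec_of d x)) = 1"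
      by (intro AE_I2)
         (auto simp: punctured_ball_def norm_sgn sgn_div_norm intro!: subspace_scale subspace_Rn)
  qed simp
  then show ?thesis unfolding sphere_uniform_eq by (subst AE_distr_iff[OF _ Rn]) simp_all
qed

text \<open>Normalising a point of the ball moves it away from the hyperplane, so the slab of the sphere
  comes from the slab of the ball.\<close>

theorem sphere_uniform_slab:
  assumes d: "1 \<le> d" and v: "v \<in> Rn d" "norm v = 1" and \<tau>: "0 < \<tau>"
  shows "emeasure (sphere_uniform d) {q. \<bar>inner v q\<bar> \<le> \<tau>} \<le> ennreal (8 * d * \<tau>)"
proof -
  let ?M = "cube_space d"
  let ?S = "{y \<in> unit_ball d. \<bar>inner v (vec_of d y)\<bar> \<le> \<tau>}"
  let ?A = "{y \<in> space ?M. \<bar>inner v (sgn (vec_of d y))\<bar> \<le> \<tau>}"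
  have fin: "emeasure ?M (unit_ball d) = ennreal (measure ?M (unit_ball d))"
    using emeasure_unit_ball_finite[of d] by (simp add: emeasure_eq_ennreal_measure)
  have pos: "0 < measure ?M (unit_ball d)"
    using emeasure_punctured_ball_pos[OF d] emeasure_punctured_ball[OF d] fin by simp
  have sub: "punctured_ball d \<inter> ?A \<subseteq> ?S"
  proof
    fix y assume y: "y \<in> punctured_ball d \<inter> ?A"
    have n: "0 < norm (vec_of d y)" "norm (vec_of d y) \<le> 1" using y by (auto simp: punctured_ball_def)
    have "\<bar>inner v (vec_of d y)\<bar> = norm (vec_of d y) * \<bar>inner v (sgn (vec_of d y))\<bar>"
      using n by (simp add: sgn_div_norm abs_mult)
    also have "\<dots> \<le> 1 * \<tau>" using y n by (intro mult_mono) auto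
    finally show "y \<in> ?S" using y by (auto simp: punctured_ball_def unit_ball_def)
  qed
  have S: "?S \<in> sets ?M" by measurable
  have "emeasure (sphere_uniform d) {q. \<bar>inner v q\<bar> \<le> \<tau>} =
      emeasure (uniform_measure ?M (punctured_ball d)) ?A"
    unfolding sphere_uniform_eq by (subst emeasure_distr) (simp_all add: vimage_def Int_def conj_commute)
  also have "\<dots> = emeasure ?M (punctured_ball d \<inter> ?A) / emeasure ?M (punctured_ball d)"
    by (rule emeasure_uniform_measure) measurable
  also have "\<dots> \<le> emeasure ?M ?S / emeasure ?M (unit_ball d)"
    unfolding emeasure_punctured_ball[OF d] by (intro divide_right_mono_ennreal emeasure_mono sub S)
  also have "emeasure ?M ?S = ennreal (measure ?M ?S)"
  proof -
    have "emeasure ?M ?S \<le> emeasure ?M (unit_ball d)" by (intro emeasure_mono) auto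
    then show ?thesis using emeasure_unit_ball_finite[of d]
      by (intro emeasure_eq_ennreal_measure) (auto simp: top_unique)
  qed
  also have "ennreal (measure ?M ?S) / emeasure ?M (unit_ball d) =
      ennreal (measure ?M ?S / measure ?M (unit_ball d))"
    using pos by (simp add: fin divide_ennreal)
  also have "\<dots> \<le> ennreal (8 * d * \<tau>)"
    using slab_volume[OF assms] pos by (intro ennreal_leI) (simp add: field_simps)
  finally show ?thesis by simp
qed

section \<open>Detecting negative curvature from a random start\<close>

text \<open>The polynomial \<open>\<Phi>\<^sub>n\<close> with \<open>x \<Phi>\<^sub>n(x\<^sup>2) = \<plusminus>T\<^sub>2\<^sub>n\<^sub>+\<^sub>1(x)\<close> for the Chebyshev polynomials \<open>T\<close>.  The weight
  \<open>x\<close> is what makes it fit the quadratic form: \<open>\<lambda> \<Phi>\<^sub>n(\<lambda>)\<^sup>2\<close> is at most 1 on \<open>[0, 1]\<close>, and at \<open>\<lambda> = -sinh\<^sup>2 t\<close>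
  it is \<open>-sinh\<^sup>2 ((2n + 1) t)\<close>.  With a plain Chebyshev polynomial the factor \<open>\<bar>\<lambda>\<bar>\<close> would be lost
  for small negative \<open>\<lambda>\<close>, at the price of a factor \<open>log(1/\<epsilon>\<^sub>H)\<close> in the complexity.\<close>

fun odd_cheb :: "nat \<Rightarrow> real \<Rightarrow> real" where
  "odd_cheb 0 x = 1"
| "odd_cheb (Suc 0) x = 3 - 4 * x"
| "odd_cheb (Suc (Suc n)) x = (2 - 4 * x) * odd_cheb (Suc n) x - odd_cheb n x"

lemma odd_cheb_sin: "sin t * odd_cheb n ((sin t)\<^sup>2) = sin ((2 * real n + 1) * t)"
proof (induction n "(sin t)\<^sup>2" rule: odd_cheb.induct)
  case 2
  have "sin (3 * t) = sin (t + 2 * t)" by simp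
  also have "\<dots> = sin t * (1 - 2 * (sin t)\<^sup>2) + cos t * (2 * sin t * cos t)"
    by (simp only: sin_add sin_double cos_double_sin)
  also have "\<dots> = sin t * (3 - 4 * (sin t)\<^sup>2)"
    using cos_squared_eq[of t] by algebra
  finally show ?case by simp
next
  case (3 n)
  let ?s = "(2 * real (Suc n) + 1) * t"
  have "sin ((2 * real (Suc (Suc n)) + 1) * t) + sin ((2 * real n + 1) * t) = sin (?s + 2 * t) + sin (?s - 2 * t)"
    by (simp add: algebra_simps)
  also have "\<dots> = 2 * sin ?s * (1 - 2 * (sin t)\<^sup>2)"
    by (simp only: sin_add sin_diff cos_double_sin)
  finally have "sin ((2 * real (Suc (Suc n)) + 1) * t) + sin ((2 * real n + 1) * t) = 2 * sin ?s * (1 - 2 * (sin t)\<^sup>2)" .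
  moreover have "sin t * odd_cheb (Suc n) ((sin t)\<^sup>2) = sin ?s"
    "sin t * odd_cheb n ((sin t)\<^sup>2) = sin ((2 * real n + 1) * t)"
    using 3 by auto
  ultimately show ?case unfolding odd_cheb.simps by algebra
qed simp

lemma odd_cheb_sinh: "sinh t * odd_cheb n (- (sinh t)\<^sup>2) = sinh ((2 * real n + 1) * t)"
proof (induction n "- (sinh t)\<^sup>2" rule: odd_cheb.induct)
  case 2
  have "sinh (3 * t) = sinh (t + 2 * t)" by simp
  also have "\<dots> = sinh t * (3 + 4 * (sinh t)\<^sup>2)"
    unfolding sinh_add sinh_double cosh_double using cosh_square_eq[of t] by algebra
  finally show ?case by simp
next
  case (3 n)
  let ?s = "(2 * real (Suc n) + 1) * t"
  have "sinh ((2 * real (Suc (Suc n)) + 1) * t) + sinh ((2 * real n + 1) * t) = sinh (?s + 2 * t) + sinh (?s - 2 * t)"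
    by (simp add: algebra_simps)
  also have "\<dots> = 2 * sinh ?s * cosh (2 * t)"
    by (simp only: sinh_add sinh_diff)
  also have "cosh (2 * t) = 1 + 2 * (sinh t)\<^sup>2"
    by (simp add: cosh_double cosh_square_eq)
  finally have "sinh ((2 * real (Suc (Suc n)) + 1) * t) + sinh ((2 * real n + 1) * t) = 2 * sinh ?s * (1 + 2 * (sinh t)\<^sup>2)" .
  moreover have "sinh t * odd_cheb (Suc n) (- (sinh t)\<^sup>2) = sinh ?s"
    "sinh t * odd_cheb n (- (sinh t)\<^sup>2) = sinh ((2 * real n + 1) * t)"
    using 3 by auto
  ultimately show ?case unfolding odd_cheb.simps by algebra
qed simp

lemma odd_cheb_bound:
  assumes "0 < M" "l \<le> M" shows "l * (odd_cheb n (l / M))\<^sup>2 \<le> M"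
proof (cases "0 \<le> l")
  case True
  define t where "t = arcsin (sqrt (l / M))"
  have "0 \<le> l / M" "l / M \<le> 1" using assms True by auto
  then have "0 \<le> sqrt (l / M)" "sqrt (l / M) \<le> 1" by auto
  then have "sin t = sqrt (l / M)" unfolding t_def by (intro sin_arcsin) linarith+
  then have "(sin t)\<^sup>2 = l / M" using True assms by simp
  then have "l * (odd_cheb n (l / M))\<^sup>2 = M * (sin t * odd_cheb n ((sin t)\<^sup>2))\<^sup>2"
    using assms by (simp add: power_mult_distrib)
  also have "\<dots> \<le> M * 1"
    unfolding odd_cheb_sin using assms by (intro mult_left_mono) (auto simp: abs_square_le_1)
  finally show ?thesis by simp
next
  case False
  then have "l * (odd_cheb n (l / M))\<^sup>2 \<le> 0" by (intro mult_nonpos_nonneg) auto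
  then show ?thesis using assms by simp
qed

lemma odd_cheb_growth:
  assumes M: "0 < M" and a: "0 \<le> a" and l: "l \<le> - M * (sinh a)\<^sup>2"
  shows "l * (odd_cheb n (l / M))\<^sup>2 \<le> - M * (sinh ((2 * real n + 1) * a))\<^sup>2"
proof -
  define t where "t = arsinh (sqrt (- l / M))"
  have "0 \<le> M * (sinh a)\<^sup>2" using M by simp
  then have l0: "l \<le> 0" using l by linarith
  have "sinh t = sqrt (- l / M)" by (simp add: t_def)
  then have t: "- (sinh t)\<^sup>2 = l / M" using M l0 by (simp add: divide_nonpos_pos)
  have "(sinh a)\<^sup>2 \<le> - l / M" using l M by (simp add: field_simps)
  then have "sinh a \<le> sqrt (- l / M)" by (rule real_le_rsqrt)
  then have "a \<le> t" unfolding \<open>sinh t = _\<close>[symmetric] by simp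
  then have "sinh ((2 * real n + 1) * a) \<le> sinh ((2 * real n + 1) * t)"
    by (intro sinh_real_le_iff[THEN iffD2] mult_left_mono) auto
  then have "(sinh ((2 * real n + 1) * a))\<^sup>2 \<le> (sinh ((2 * real n + 1) * t))\<^sup>2"
    using a by (intro power_mono) auto
  moreover have "l * (odd_cheb n (l / M))\<^sup>2 = - M * (sinh t * odd_cheb n (- (sinh t)\<^sup>2))\<^sup>2"
  proof -
    have "l = - M * (sinh t)\<^sup>2" using t M by (simp add: field_simps)
    then show ?thesis unfolding power_mult_distrib t by simp
  qed
  ultimately show ?thesis using M unfolding odd_cheb_sinh by simp
qed

context minres_run
begin

fun cheb_vec :: "real \<Rightarrow> nat \<Rightarrow> 'a" where
  "cheb_vec M 0 = b"
| "cheb_vec M (Suc 0) = 3 *\<^sub>R b - (4 / M) *\<^sub>R A b"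
| "cheb_vec M (Suc (Suc n)) = 2 *\<^sub>R cheb_vec M (Suc n) - (4 / M) *\<^sub>R A (cheb_vec M (Suc n)) - cheb_vec M n"

lemma cheb_vec_mem: "cheb_vec M n \<in> K (Suc n)"
proof (induction M n rule: cheb_vec.induct)
  case (1 M)
  show ?case using power_mem_krylov[of 0 "Suc 0" b] by simp
next
  case (2 M)
  have "b \<in> K (Suc 0)" using power_mem_krylov[of 0 "Suc 0" b] by simp
  then show ?case using krylov_mono[of "Suc 0" "Suc (Suc 0)" b]
    by (auto intro!: subspace_diff subspace_scale image_mem_krylov)
next
  case (3 M n)
  have "K (Suc (Suc n)) \<subseteq> K (Suc (Suc (Suc n)))" "K (Suc n) \<subseteq> K (Suc (Suc (Suc n)))"
    by (intro krylov_mono; simp)+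
  then show ?case using 3
    by (auto intro!: subspace_diff subspace_scale image_mem_krylov)
qed

lemma cheb_vec_coordinate:
  assumes "is_eigenbasis B" "u \<in> B"
  shows "inner u (cheb_vec M n) = odd_cheb n (eigval u / M) * inner u b"
proof (induction M n rule: cheb_vec.induct)
  case (3 M n)
  have "cheb_vec M (Suc n) \<in> V" using cheb_vec_mem K_subset by blast
  from inner_eigenvector[OF assms this] show ?case
    by (simp add: 3 inner_diff_right algebra_simps)
qed (simp_all add: inner_eigenvector[OF assms b] inner_diff_right algebra_simps)

text \<open>If the form is nonnegative on the Krylov space, it is so at the Chebyshev vector.  There the
  component along an eigenvector of negative eigenvalue is amplified exponentially, so the start
  vector can have only a tiny component along it.\<close>

lemma overlap_bound_if_no_npc:
  assumes M: "0 < M" "\<And>x. x \<in> V \<Longrightarrow> norm (A x) \<le> M * norm x"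
    and B: "is_eigenbasis B" and u: "u \<in> B" "eigval u \<le> - M * (sinh a)\<^sup>2" and a: "0 \<le> a"
    and no_npc: "\<not> (minres_iters A b 0 \<le> Suc n \<and> fst (minres A b 0) = NPC)"
  shows "\<bar>inner u b\<bar> * sinh ((2 * real n + 1) * a) \<le> norm b"
proof -
  let ?w = "cheb_vec M n" and ?s = "sinh ((2 * real n + 1) * a)"
  have fin: "finite B" using B by (simp add: is_eigenbasis_def)
  have le: "eigval v \<le> M" if "v \<in> B" for v
  proof -
    have v: "v \<in> V" "norm v = 1" using B that by (auto simp: is_eigenbasis_def span_base orthonormal_def)
    have "eigval v \<le> norm v * norm (A v)" unfolding eigval_def by (rule norm_cauchy_schwarz)
    then show ?thesis using M(2)[OF v(1)] v by simp
  qed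
  have "0 \<le> inner ?w (A ?w)" by (rule nonneg_on_krylov_if_no_npc[OF no_npc cheb_vec_mem])
  also have "\<dots> = (\<Sum>v\<in>B. eigval v * (odd_cheb n (eigval v / M))\<^sup>2 * (inner v b)\<^sup>2)"
    using eigenbasis_quadratic_form[OF B, of ?w] cheb_vec_mem K_subset
    by (auto simp: cheb_vec_coordinate[OF B] power_mult_distrib mult.assoc cong: sum.cong)
  also have "\<dots> = eigval u * (odd_cheb n (eigval u / M))\<^sup>2 * (inner u b)\<^sup>2 +
      (\<Sum>v\<in>B - {u}. eigval v * (odd_cheb n (eigval v / M))\<^sup>2 * (inner v b)\<^sup>2)"
    using fin u by (simp add: sum.remove)
  also have "\<dots> \<le> - M * ?s\<^sup>2 * (inner u b)\<^sup>2 + (\<Sum>v\<in>B - {u}. M * (inner v b)\<^sup>2)"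
    using M a u le by (intro add_mono sum_mono mult_right_mono odd_cheb_growth odd_cheb_bound) auto
  also have "(\<Sum>v\<in>B - {u}. M * (inner v b)\<^sup>2) \<le> (\<Sum>v\<in>B. M * (inner v b)\<^sup>2)"
    using fin M by (intro sum_mono2) auto
  also have "\<dots> = M * (norm b)\<^sup>2"
    using orthonormal_norm_expand[of B b] B b by (simp add: is_eigenbasis_def sum_distrib_left)
  finally have "M * (\<bar>inner u b\<bar> * ?s)\<^sup>2 \<le> M * (norm b)\<^sup>2" by (simp add: power_mult_distrib algebra_simps)
  then have "(\<bar>inner u b\<bar> * ?s)\<^sup>2 \<le> (norm b)\<^sup>2" using M by simp
  then show ?thesis by (rule power2_le_imp_le) simp
qed

end

text \<open>The number of iterations until negative curvature is found; the value \<open>\<infinity>\<close> stands for a run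
  that ends without finding it.\<close>

definition npc_cost :: "('a::real_inner \<Rightarrow> 'a) \<Rightarrow> 'a \<Rightarrow> ennreal" where
  "npc_cost A q = (if fst (minres A q 0) = NPC then of_nat (minres_iters A q 0) else \<top>)"

lemma npc_cost_le_suminf:
  assumes "\<And>n. \<not> (minres_iters A q 0 \<le> n \<and> fst (minres A q 0) = NPC) \<Longrightarrow> q \<in> S n"
  shows "npc_cost A q \<le> (\<Sum>n. indicator (S n) q)"
proof (cases "fst (minres A q 0) = NPC")
  case True
  let ?N = "minres_iters A q 0"
  have "npc_cost A q = (\<Sum>n<?N. (1::ennreal))" using True by (simp add: npc_cost_def)
  also have "\<dots> = (\<Sum>n<?N. indicator (S n) q)"
    using assms by (intro sum.cong) (auto simp: indicator_def)
  also have "\<dots> \<le> (\<Sum>n. indicator (S n) q)" by (rule sum_le_suminf) auto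
  finally show ?thesis .
next
  case False
  have "of_nat m \<le> (\<Sum>n. indicator (S n) q :: ennreal)" for m
  proof -
    have "of_nat m = (\<Sum>n<m. indicator (S n) q :: ennreal)"
      using assms False by (simp add: indicator_def)
    also have "\<dots> \<le> (\<Sum>n. indicator (S n) q)" by (rule sum_le_suminf) auto
    finally show ?thesis .
  qed
  then have "(\<Sum>n. indicator (S n) q :: ennreal) = \<top>"
    using ennreal_Ex_less_of_nat[of "\<Sum>n. indicator (S n) q"] by (meson leD less_top)
  then show ?thesis by simp
qed

lemma exp_le_4_sinh:
  fixes y :: real assumes "1 / 2 * ln 2 \<le> y" shows "exp y \<le> 4 * sinh y"
proof -
  have "2 = exp (ln (2::real))" by simp
  also have "\<dots> \<le> exp (2 * y)" using assms by (subst exp_le_cancel_iff) linarith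
  finally have "2 \<le> exp (2 * y)" .
  then have "2 * exp (- y) \<le> exp (2 * y) * exp (- y)" by (intro mult_right_mono) auto
  also have "\<dots> = exp y" by (simp add: exp_add[symmetric])
  finally show ?thesis by (simp add: sinh_field_def)
qed

text \<open>The tail of the number of iterations decays like \<open>d e\<^sup>-\<^sup>2\<^sup>a\<^sup>n\<close>.  Up to the index \<open>k\<close> where this
  becomes smaller than one, the tail is bounded by one; beyond it one sums a geometric series.\<close>

theorem expected_npc_cost:
  assumes d: "1 \<le> d" and A: "symmetric_operator (Rn d) A"
    and M: "0 < M" "\<And>x. x \<in> Rn d \<Longrightarrow> norm (A x) \<le> M * norm x"
    and a: "0 < a" "a \<le> 1" and l: "l \<in> eigenvalues (Rn d) A" "l \<le> - M * (sinh a)\<^sup>2"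
  shows "(\<integral>\<^sup>+q. npc_cost A q \<partial>sphere_uniform d) \<le> ennreal (6 * (1 + ln d) / a)"
proof -
  interpret symmetric_operator "Rn d" A by (rule A)
  interpret sphere: prob_space "sphere_uniform d" by (rule prob_space_sphere_uniform[OF d])
  obtain B where B: "is_eigenbasis B" by (rule ex_eigenbasis)
  obtain u where u: "u \<in> B" "eigval u = l" using l(1) eigenvalues_eq[OF B] by auto
  have uV: "u \<in> Rn d" "norm u = 1" using B u by (auto simp: is_eigenbasis_def span_base orthonormal_def)
  define k where "k = nat \<lceil>ln (32 * d) / (2 * a)\<rceil>"
  \<comment> \<open>the first \<open>n\<close> iterations only bound the overlap through the polynomial of index \<open>n - 1\<close>\<close>
  define \<tau> where "\<tau> n = 1 / sinh ((2 * real (n - 1) + 1) * a)" for n :: nat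
  define S where "S n = {q. n = 0 \<or> \<bar>inner u q\<bar> \<le> \<tau> n}" for n
  define p where "p n = (if n < k + 1 then 1 else exp (- (2 * a)) ^ (n - (k + 1)))" for n :: nat
  have \<tau>: "0 < \<tau> n" for n unfolding \<tau>_def using a by (auto simp: add_nonneg_pos)
  have cost: "npc_cost A q \<le> (\<Sum>n. indicator (S n) q)" if q: "q \<in> Rn d" "norm q = 1" for q
  proof (rule npc_cost_le_suminf)
    fix n assume no: "\<not> (minres_iters A q 0 \<le> n \<and> fst (minres A q 0) = NPC)"
    interpret minres_run "Rn d" A q by unfold_locales (rule q)
    show "q \<in> S n"
    proof (cases n)
      case (Suc m)
      have "\<bar>inner u q\<bar> * sinh ((2 * real m + 1) * a) \<le> norm q"
        using no u l(2) a(1) Suc by (intro overlap_bound_if_no_npc[OF M B]) auto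
      moreover have "0 < sinh ((2 * real m + 1) * a)" using a by (simp add: add_nonneg_pos)
      ultimately show ?thesis using q(2) by (simp add: S_def \<tau>_def Suc field_simps)
    qed (simp add: S_def)
  qed
  have S_sets: "S n \<in> sets (sphere_uniform d)" for n
    unfolding S_def by measurable
  have tail: "emeasure (sphere_uniform d) (S n) \<le> ennreal (p n)" for n
  proof (cases "n < k + 1")
    case True
    then show ?thesis using sphere.emeasure_le_1[of "S n"] by (simp add: p_def)
  next
    case False
    define m where "m = n - 1"
    have m: "n = Suc m" "k \<le> m" using False by (auto simp: m_def)
    have "ln (32 * d) / (2 * a) \<le> real k" unfolding k_def by (rule real_nat_ceiling_ge)
    then have k: "ln (32 * real d) \<le> 2 * a * real k" using a by (simp add: field_simps)
    have "2 * a * real k \<le> (2 * real m + 1) * a" using m a by (simp add: algebra_simps add_increasing)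
    moreover have "1 / 2 * ln 2 \<le> ln (32 * real d)"
    proof -
      have "ln 2 \<le> ln (32 * real d)" using d by (intro ln_mono) auto
      moreover have "1 / 2 * ln 2 \<le> ln (2::real)" by simp
      ultimately show ?thesis by linarith
    qed
    ultimately have "exp ((2 * real m + 1) * a) \<le> 4 * sinh ((2 * real m + 1) * a)"
      using k by (intro exp_le_4_sinh) linarith
    then have "1 / sinh ((2 * real m + 1) * a) \<le> 4 / exp ((2 * real m + 1) * a)"
      using \<tau>[of n] by (simp add: \<tau>_def m divide_le_eq le_divide_eq)
    then have "\<tau> n \<le> 4 * exp (- ((2 * real m + 1) * a))"
      by (simp add: \<tau>_def m exp_minus divide_inverse)
    also have "\<dots> \<le> 4 * exp (- (2 * a * real m))" using a by (simp add: algebra_simps)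
    also have "exp (- (2 * a * real m)) = exp (- (2 * a * real k)) * exp (- (2 * a)) ^ (m - k)"
      using m by (simp add: exp_of_nat_mult[symmetric] exp_add[symmetric] of_nat_diff algebra_simps)
    also have "exp (- (2 * a * real k)) \<le> exp (- ln (32 * d))" using k by simp
    also have "exp (- ln (32 * d)) = 1 / (32 * d)" using d by (simp add: exp_minus field_simps)
    finally have "\<tau> n \<le> 4 * (1 / (32 * d) * exp (- (2 * a)) ^ (m - k))" by simp
    then have "8 * d * \<tau> n \<le> 8 * d * (4 * (1 / (32 * d) * exp (- (2 * a)) ^ (m - k)))"
      by (intro mult_left_mono) auto
    also have "\<dots> = p n" using d m by (simp add: p_def)
    finally have "8 * d * \<tau> n \<le> p n" .
    moreover have "emeasure (sphere_uniform d) (S n) \<le> ennreal (8 * d * \<tau> n)"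
      using sphere_uniform_slab[OF d uV \<tau>[of n]] m by (simp add: S_def)
    ultimately show ?thesis by (meson ennreal_leI order.trans)
  qed
  have r: "norm (exp (- (2 * a))) < 1" using a by simp
  have "(\<lambda>n. p (n + (k + 1))) sums (1 / (1 - exp (- (2 * a))))"
    using geometric_sums[OF r] by (simp add: p_def)
  then have p_sums: "p sums (1 / (1 - exp (- (2 * a))) + (\<Sum>n<k+1. p n))"
    by (simp only: sums_iff_shift)
  have "(\<integral>\<^sup>+q. npc_cost A q \<partial>sphere_uniform d) \<le> (\<integral>\<^sup>+q. (\<Sum>n. indicator (S n) q) \<partial>sphere_uniform d)"
    by (intro nn_integral_mono_AE eventually_mono[OF AE_sphere_uniform[OF d]]) (auto intro: cost)
  also have "\<dots> = (\<Sum>n. emeasure (sphere_uniform d) (S n))"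
    using S_sets by (subst nn_integral_suminf) auto
  also have "\<dots> \<le> (\<Sum>n. ennreal (p n))" by (intro suminf_le tail) auto
  also have "\<dots> = ennreal (\<Sum>n. p n)"
    by (intro suminf_ennreal2 sums_summable[OF p_sums]) (simp add: p_def)
  also have "(\<Sum>n. p n) = 1 / (1 - exp (- (2 * a))) + real (k + 1)"
    unfolding sums_unique[OF p_sums, symmetric] by (simp add: p_def)
  also have "\<dots> \<le> 6 * (1 + ln d) / a"
  proof -
    have "1 + 2 * a \<le> exp (2 * a)" by simp
    then have "exp (- (2 * a)) \<le> 1 / (1 + 2 * a)" using a by (simp add: exp_minus field_simps)
    then have "2 * a / (1 + 2 * a) \<le> 1 - exp (- (2 * a))" using a by (simp add: field_simps)
    then have "1 / (1 - exp (- (2 * a))) \<le> 1 / (2 * a / (1 + 2 * a))"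
      using a by (intro divide_left_mono) auto
    also have "\<dots> = 1 + 1 / 2 * (1 / a)" using a by (simp add: field_simps)
    finally have 1: "1 / (1 - exp (- (2 * a))) \<le> 1 + 1 / 2 * (1 / a)" .
    have "0 \<le> ln (32 * real d)" using d by simp
    then have "0 \<le> ln (32 * real d) / (2 * a)" using a by simp
    then have 2: "real (k + 1) \<le> ln (32 * d) / (2 * a) + 2"
      using of_int_ceiling_le_add_one[of "ln (32 * real d) / (2 * a)"]
      by (simp add: k_def add.commute[of 1])
    have "ln (32 * real d) = 5 * ln 2 + ln d"
      using d ln_realpow[of 2 5] ln_mult[of 32 "real d"] by simp
    also have "\<dots> \<le> 5 + ln d" using ln_2_less_1 by simp
    finally have "ln (32 * d) / (2 * a) \<le> (5 + ln d) / (2 * a)" using a by (simp add: divide_right_mono)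
    also have "\<dots> = (5 + ln d) / 2 * (1 / a)" by simp
    finally have 3: "ln (32 * d) / (2 * a) \<le> (5 + ln d) / 2 * (1 / a)" .
    have "1 \<le> 1 / a" using a by simp
    then have "1 / (1 - exp (- (2 * a))) + real (k + 1) \<le>
        1 / 2 * (1 / a) + (5 + ln d) / 2 * (1 / a) + 3 * (1 / a)"
      using 1 2 3 by linarith
    also have "\<dots> = (6 + ln d / 2) * (1 / a)" by (simp add: algebra_simps add_divide_distrib)
    also have "\<dots> \<le> (6 * (1 + ln d)) * (1 / a)" using d a by (intro mult_right_mono) auto
    finally show ?thesis by simp
  qed
  finally show ?thesis by (simp add: ennreal_leI)
qed

section \<open>Functions with Lipschitz continuous Hessian\<close>

locale lipschitz_hessian_function =
  fixes V :: "'a::real_inner set" and f :: "'a \<Rightarrow> real" and g :: "'a \<Rightarrow> 'a" and H :: "'a \<Rightarrow> 'a \<Rightarrow> 'a"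
    and L :: real
  assumes fin_dim: "fin_dim V" and C2: "C2_on V f g H"
    and lipschitz: "lipschitz_hessian V H L" and L_pos: "0 < L"
begin

lemma subspace: "subspace V"
  using fin_dim by (rule fin_dim_subspace)

lemma mem_V: "x \<in> V \<Longrightarrow> v \<in> V \<Longrightarrow> x + t *\<^sub>R v \<in> V" "x \<in> V \<Longrightarrow> v \<in> V \<Longrightarrow> x + v \<in> V"
  using subspace by (auto intro: subspace_add subspace_scale)

lemma g_mem: "x \<in> V \<Longrightarrow> g x \<in> V"
  and H_mem: "x \<in> V \<Longrightarrow> v \<in> V \<Longrightarrow> H x v \<in> V"
  and f_deriv: "x \<in> V \<Longrightarrow> (f has_derivative (\<lambda>h. inner (g x) h)) (at x within V)"
  and g_deriv: "x \<in> V \<Longrightarrow> (g has_derivative H x) (at x within V)"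
  and H_continuous: "v \<in> V \<Longrightarrow> continuous_on V (\<lambda>x. H x v)"
  using C2 unfolding C2_on_def by blast+

lemma f_continuous: "continuous_on V f" and g_continuous: "continuous_on V g"
  unfolding continuous_on_eq_continuous_within
  using f_deriv g_deriv has_derivative_continuous by blast+

lemma H_bounded_linear: "x \<in> V \<Longrightarrow> bounded_linear (H x)"
  using g_deriv has_derivative_bounded_linear by blast

lemma H_scale: "x \<in> V \<Longrightarrow> H x (t *\<^sub>R v) = t *\<^sub>R H x v"
  using H_bounded_linear by (simp add: linear_scale bounded_linear.linear)

lemma H_lipschitz:
  assumes "x \<in> V" "y \<in> V" "v \<in> V"
  shows "norm (H x v - H y v) \<le> L * norm (x - y) * norm v"
proof -
  have bl: "bounded_linear (\<lambda>v. H x v - H y v)"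
    using assms H_bounded_linear by (intro bounded_linear_sub) auto
  then obtain K where K: "\<And>v. norm (H x v - H y v) \<le> norm v * K"
    using bounded_linear.bounded by blast
  have "bdd_above ((\<lambda>v. norm (H x v - H y v) / norm v) ` V)"
  proof (rule bdd_aboveI2)
    fix v show "norm (H x v - H y v) / norm v \<le> max K 0"
    proof (cases "v = 0")
      case False
      then have "norm (H x v - H y v) / norm v \<le> K" using K[of v] by (simp add: divide_le_eq mult.commute)
      then show ?thesis by simp
    qed simp
  qed
  then have "norm (H x v - H y v) / norm v \<le> opnorm_on V (\<lambda>v. H x v - H y v)"
    unfolding opnorm_on_def using assms(3) by (rule cSUP_upper[rotated])
  also have "\<dots> \<le> L * norm (x - y)" using lipschitz assms by (simp add: lipschitz_hessian_def)
  finally show ?thesis using K[of v] by (cases "v = 0") (auto simp: divide_le_eq)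
qed

lemma g_line_derivative:
  assumes "x \<in> V" "v \<in> V"
  shows "((\<lambda>t. g (x + t *\<^sub>R v)) has_derivative (\<lambda>s. s *\<^sub>R H (x + t *\<^sub>R v) v)) (at t)"
proof -
  have line: "((\<lambda>t. x + t *\<^sub>R v) has_derivative (\<lambda>s. s *\<^sub>R v)) (at t)"
    by (auto intro!: derivative_eq_intros)
  have "(g has_derivative H (x + t *\<^sub>R v)) (at (x + t *\<^sub>R v) within range (\<lambda>t. x + t *\<^sub>R v))"
    using assms mem_V by (intro has_derivative_subset[OF g_deriv]) auto
  from has_derivative_in_compose[OF line this]
  show ?thesis using assms mem_V by (simp add: H_scale)
qed

lemma inner_g_line_derivative:
  assumes "x \<in> V" "v \<in> V"
  shows "((\<lambda>t. inner w (g (x + t *\<^sub>R v))) has_real_derivative inner w (H (x + t *\<^sub>R v) v)) (at t)"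
proof -
  have "((\<lambda>t. inner w (g (x + t *\<^sub>R v))) has_derivative (\<lambda>s. inner w (s *\<^sub>R H (x + t *\<^sub>R v) v))) (at t)"
    by (rule has_derivative_inner_right[OF g_line_derivative[OF assms]])
  then show ?thesis by (simp add: has_field_derivative_def mult_commute_abs)
qed

lemma f_line_derivative:
  assumes "x \<in> V" "v \<in> V"
  shows "((\<lambda>t. f (x + t *\<^sub>R v)) has_real_derivative inner (g (x + t *\<^sub>R v)) v) (at t)"
proof -
  have line: "((\<lambda>t. x + t *\<^sub>R v) has_derivative (\<lambda>s. s *\<^sub>R v)) (at t)"
    by (auto intro!: derivative_eq_intros)
  have "(f has_derivative (\<lambda>h. inner (g (x + t *\<^sub>R v)) h)) (at (x + t *\<^sub>R v) within range (\<lambda>t. x + t *\<^sub>R v))"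
    using assms mem_V by (intro has_derivative_subset[OF f_deriv]) auto
  from has_derivative_in_compose[OF line this]
  show ?thesis by (simp add: has_field_derivative_def mult_commute_abs)
qed

lemma gradient_taylor:
  assumes x: "x \<in> V" and v: "v \<in> V"
  shows "norm (g (x + v) - g x - H x v) \<le> L * (norm v)\<^sup>2"
proof -
  define w where "w = g (x + v) - g x - H x v"
  define \<psi> where "\<psi> t = inner w (g (x + t *\<^sub>R v)) - t * inner w (H x v)" for t
  have "(\<psi> has_real_derivative inner w (H (x + t *\<^sub>R v) v) - inner w (H x v)) (at t)" for t
    unfolding \<psi>_def by (auto intro!: derivative_eq_intros inner_g_line_derivative assms)
  then obtain t where t: "0 < t" "t < 1" "\<psi> 1 - \<psi> 0 = inner w (H (x + t *\<^sub>R v) v) - inner w (H x v)"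
    using MVT2[of 0 1 \<psi> "\<lambda>t. inner w (H (x + t *\<^sub>R v) v) - inner w (H x v)"] by auto
  have "(norm w)\<^sup>2 = \<psi> 1 - \<psi> 0"
  proof -
    have "\<psi> 1 - \<psi> 0 = inner w (g (x + v)) - inner w (g x) - inner w (H x v)" by (simp add: \<psi>_def)
    also have "\<dots> = inner w w" by (simp only: inner_diff_right[symmetric] w_def[symmetric])
    finally show ?thesis by (simp add: power2_norm_eq_inner)
  qed
  also have "\<dots> = inner w (H (x + t *\<^sub>R v) v - H x v)" using t by (simp add: inner_diff_right)
  also have "\<dots> \<le> norm w * norm (H (x + t *\<^sub>R v) v - H x v)" by (rule norm_cauchy_schwarz)
  also have "norm (H (x + t *\<^sub>R v) v - H x v) \<le> L * norm (x + t *\<^sub>R v - x) * norm v"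
    using assms mem_V by (intro H_lipschitz) auto
  also have "\<dots> = L * t * (norm v)\<^sup>2" using t by (simp add: power2_eq_square)
  also have "\<dots> \<le> L * 1 * (norm v)\<^sup>2" using t L_pos by (intro mult_right_mono mult_left_mono) auto
  finally have "norm w * norm w \<le> norm w * (L * (norm v)\<^sup>2)"
    by (simp add: power2_eq_square mult_left_mono)
  then have "norm w \<le> L * (norm v)\<^sup>2" using L_pos by (cases "w = 0") (auto simp: mult_le_cancel_left)
  then show ?thesis by (simp add: w_def)
qed

lemma function_taylor:
  assumes x: "x \<in> V" and v: "v \<in> V"
  shows "f (x + v) \<le> f x + inner (g x) v + inner v (H x v) / 2 + L * norm v ^ 3"
proof -
  define \<psi> where "\<psi> t = f (x + t *\<^sub>R v) - t * inner (g x) v - t\<^sup>2 / 2 * inner (H x v) v" for t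
  let ?D = "\<lambda>t. inner (g (x + t *\<^sub>R v)) v - inner (g x) v - t * inner (H x v) v"
  have "(\<psi> has_real_derivative ?D t) (at t)" for t
    unfolding \<psi>_def by (auto intro!: derivative_eq_intros f_line_derivative assms)
  then obtain t where t: "0 < t" "t < 1" "\<psi> 1 - \<psi> 0 = ?D t"
    using MVT2[of 0 1 \<psi> ?D] by auto
  have "?D t = inner (g (x + t *\<^sub>R v) - g x - H x (t *\<^sub>R v)) v"
    using x by (simp add: inner_diff_left H_scale)
  also have "\<dots> \<le> norm (g (x + t *\<^sub>R v) - g x - H x (t *\<^sub>R v)) * norm v" by (rule norm_cauchy_schwarz)
  also have "norm (g (x + t *\<^sub>R v) - g x - H x (t *\<^sub>R v)) \<le> L * (norm (t *\<^sub>R v))\<^sup>2"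
    using assms subspace by (intro gradient_taylor subspace_scale)
  also have "\<dots> = t\<^sup>2 * (L * (norm v)\<^sup>2)" by (simp add: power_mult_distrib)
  also have "\<dots> \<le> 1 * (L * (norm v)\<^sup>2)"
    using t L_pos by (intro mult_right_mono) (auto simp: power_le_one)
  finally have "?D t \<le> L * (norm v)\<^sup>2 * norm v" by (simp add: mult_right_mono)
  then have "?D t \<le> L * norm v ^ 3" by (simp add: power2_eq_square power3_eq_cube)
  then show ?thesis using t by (simp add: \<psi>_def inner_commute)
qed

text \<open>Schwarz's theorem: up to \<open>O(t\<^sup>3)\<close>, both \<open>t\<^sup>2 \<langle>H v, u\<rangle>\<close> and \<open>t\<^sup>2 \<langle>H u, v\<rangle>\<close> are the mixed second difference
  of \<open>f\<close>, which is symmetric in \<open>u\<close> and \<open>v\<close>.\<close>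

lemma second_difference:
  assumes x: "x \<in> V" and u: "u \<in> V" and v: "v \<in> V" and t: "0 < t"
  shows "\<bar>f (x + t *\<^sub>R u + t *\<^sub>R v) - f (x + t *\<^sub>R u) - f (x + t *\<^sub>R v) + f x - t\<^sup>2 * inner (H x v) u\<bar>
    \<le> t ^ 3 * (L * norm u * norm v * (norm u + norm v))"
proof -
  define \<phi> where "\<phi> s = f (x + t *\<^sub>R v + s *\<^sub>R u) - f (x + s *\<^sub>R u)" for s
  let ?D = "\<lambda>s. inner (g (x + t *\<^sub>R v + s *\<^sub>R u)) u - inner (g (x + s *\<^sub>R u)) u"
  have "(\<phi> has_real_derivative ?D s) (at s)" for s
    unfolding \<phi>_def using assms mem_V by (auto intro!: derivative_eq_intros f_line_derivative)
  then obtain s where s: "0 < s" "s < t" "\<phi> t - \<phi> 0 = t * ?D s"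
    using MVT2[of 0 t \<phi> ?D] t by auto
  define y where "y = x + s *\<^sub>R u"
  have y: "y \<in> V" unfolding y_def using x u mem_V by simp
  have "?D s - t * inner (H x v) u =
      inner (g (y + t *\<^sub>R v) - g y - H y (t *\<^sub>R v)) u + t * inner (H y v - H x v) u"
    using y by (simp add: y_def H_scale inner_diff_left inner_add_left algebra_simps)
  also have "\<bar>\<dots>\<bar> \<le> norm (g (y + t *\<^sub>R v) - g y - H y (t *\<^sub>R v)) * norm u + t * (norm (H y v - H x v) * norm u)"
    using t by (intro order.trans[OF abs_triangle_ineq] add_mono)
      (auto simp: abs_mult intro!: mult_left_mono Cauchy_Schwarz_ineq2)
  also have "\<dots> \<le> L * (norm (t *\<^sub>R v))\<^sup>2 * norm u + t * (L * norm (y - x) * norm v * norm u)"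
    using t x y v subspace
    by (intro add_mono mult_right_mono mult_left_mono gradient_taylor H_lipschitz subspace_scale) auto
  also have "\<dots> = t\<^sup>2 * (L * (norm v)\<^sup>2 * norm u) + t * s * (L * norm u * norm v * norm u)"
    using s by (simp add: y_def power_mult_distrib)
  also have "\<dots> \<le> t\<^sup>2 * (L * (norm v)\<^sup>2 * norm u) + t * t * (L * norm u * norm v * norm u)"
    using s t L_pos by (intro add_mono mult_right_mono mult_left_mono) auto
  also have "\<dots> = t\<^sup>2 * (L * norm u * norm v * (norm u + norm v))"
    by (simp add: power2_eq_square algebra_simps)
  finally have "t * \<bar>?D s - t * inner (H x v) u\<bar> \<le> t * (t\<^sup>2 * (L * norm u * norm v * (norm u + norm v)))"
    using t by (intro mult_left_mono) auto
  moreover have "t * \<bar>?D s - t * inner (H x v) u\<bar> = \<bar>\<phi> t - \<phi> 0 - t\<^sup>2 * inner (H x v) u\<bar>"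
    using t s(3) by (simp add: abs_mult_pos' right_diff_distrib power2_eq_square)
  ultimately show ?thesis
    by (simp add: \<phi>_def power2_eq_square power3_eq_cube algebra_simps)
qed

lemma H_symmetric:
  assumes x: "x \<in> V" and u: "u \<in> V" and v: "v \<in> V"
  shows "inner (H x u) v = inner u (H x v)"
proof (rule ccontr)
  define c where "c = \<bar>inner (H x u) v - inner (H x v) u\<bar>"
  define C where "C = L * norm u * norm v * (norm u + norm v)"
  assume "inner (H x u) v \<noteq> inner u (H x v)"
  then have c: "0 < c" by (simp add: c_def inner_commute)
  have C: "0 \<le> C" using L_pos by (simp add: C_def)
  have bound: "c \<le> 2 * C * t" if t: "0 < t" for t
  proof -
    have "t\<^sup>2 * c = \<bar>t\<^sup>2 * inner (H x u) v - t\<^sup>2 * inner (H x v) u\<bar>"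
      unfolding c_def right_diff_distrib[symmetric] abs_mult by simp
    also have "\<dots> \<le> t ^ 3 * C + t ^ 3 * C"
      using second_difference[OF x u v t] second_difference[OF x v u t]
      unfolding C_def by (simp add: algebra_simps)
    finally have "t\<^sup>2 * c \<le> t\<^sup>2 * (2 * C * t)" by (simp add: power2_eq_square power3_eq_cube algebra_simps)
    then show ?thesis using t by simp
  qed
  have "2 * C / (4 * C + 2) \<le> 1 / 2" using C by (simp add: field_simps)
  then have "c * (2 * C / (4 * C + 2)) \<le> c * (1 / 2)" using c by (intro mult_left_mono) auto
  moreover have "2 * C * (c / (4 * C + 2)) = c * (2 * C / (4 * C + 2))" by simp
  ultimately have "2 * C * (c / (4 * C + 2)) < c" using c by linarith
  moreover have "c \<le> 2 * C * (c / (4 * C + 2))" using c C by (intro bound divide_pos_pos) auto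
  ultimately show False by simp
qed

lemma symmetric_operator_H: "x \<in> V \<Longrightarrow> symmetric_operator V (H x)"
  by (intro symmetric_operator.intro) (auto intro: fin_dim H_bounded_linear H_mem H_symmetric)

lemma f_line_continuous: "x \<in> V \<Longrightarrow> v \<in> V \<Longrightarrow> continuous_on S (\<lambda>t. f (x + t *\<^sub>R v))"
  using f_line_derivative by (intro DERIV_continuous_on) (auto intro: DERIV_subset)

text \<open>At every \<open>y\<close> the operator \<open>H y\<close> stretches \<open>g y\<close> at most by \<open>R\<close>.  If \<open>H x\<close> had a large
  eigenvalue \<open>l\<close> with eigenvector \<open>v\<close>, then the gradient at \<open>y = x \<plusminus> v\<close> would be close to \<open>l v\<close>, and
  \<open>H y\<close> would still stretch it by about \<open>l\<close>.\<close>

lemma eigenvalue_bound_at_small_gradient: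
  assumes R: "0 \<le> R" "\<And>y. y \<in> V \<Longrightarrow> norm (H y (g y)) \<le> R * norm (g y)"
    and x: "x \<in> V" "norm (g x) \<le> 1" and v: "v \<in> V" "norm v = 1" "H x v = l *\<^sub>R v"
  shows "\<bar>l\<bar> \<le> R + 3 * L + 1"
proof -
  \<comment> \<open>with this sign the gradient at \<open>x\<close> does not cancel the contribution \<open>l w\<close> of the step\<close>
  define w where "w = (if 0 \<le> l * inner v (g x) then v else - v)"
  have w: "w \<in> V" "norm w = 1" "H x w = l *\<^sub>R w" and sgn: "0 \<le> l * inner w (g x)"
    using v subspace H_scale[OF x(1), of "-1" v] by (auto simp: w_def intro: subspace_neg)
  have ww: "inner w w = 1" using w(2) by (simp add: dot_square_norm)
  define y where "y = x + w"
  define e where "e = H y w - H x w"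
  define e' where "e' = g y - g x - H x w"
  have y: "y \<in> V" using x w mem_V by (simp add: y_def)
  have e: "norm e \<le> L" using H_lipschitz[OF y x(1) w(1)] w by (simp add: e_def y_def)
  have e': "norm e' \<le> L" using gradient_taylor[OF x(1) w(1)] w by (simp add: e'_def y_def)
  have gy: "g y = g x + l *\<^sub>R w + e'" using w by (simp add: e'_def)
  have Hy: "l *\<^sub>R w = H y w - e" using w by (simp add: e_def)
  have g_norm: "norm (g y) \<le> 1 + \<bar>l\<bar> + L"
    unfolding gy using x(2) w(2) e' by (intro norm_triangle_le add_mono) auto
  have "\<bar>inner w e'\<bar> \<le> L" using Cauchy_Schwarz_ineq2[of w e'] w e' by simp
  moreover have "inner w (g y) = inner w (g x) + l + inner w e'" using ww by (simp add: gy inner_add_right)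
  moreover have "\<bar>l\<bar> \<le> \<bar>inner w (g x) + l\<bar>" using sgn by (cases "0 \<le> l") (auto simp: zero_le_mult_iff)
  ultimately have lower: "\<bar>l\<bar> - L \<le> \<bar>inner w (g y)\<bar>" by linarith
  have "\<bar>l\<bar> * (\<bar>l\<bar> - L) \<le> \<bar>l\<bar> * \<bar>inner w (g y)\<bar>" using lower by (intro mult_left_mono) auto
  also have "\<dots> = \<bar>inner (l *\<^sub>R w) (g y)\<bar>" by (simp add: abs_mult)
  also have "inner (l *\<^sub>R w) (g y) = inner w (H y (g y)) - inner e (g y)"
    unfolding Hy using H_symmetric[OF y w(1) g_mem[OF y]] by (simp add: inner_diff_left)
  also have "\<bar>\<dots>\<bar> \<le> norm w * norm (H y (g y)) + norm e * norm (g y)"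
    using Cauchy_Schwarz_ineq2[of w "H y (g y)"] Cauchy_Schwarz_ineq2[of e "g y"] by linarith
  also have "\<dots> \<le> R * norm (g y) + L * norm (g y)"
    using w(2) R(2)[OF y] e by (intro add_mono mult_right_mono) auto
  also have "\<dots> \<le> (R + L) * (1 + \<bar>l\<bar> + L)"
    unfolding distrib_right[symmetric] using g_norm R(1) L_pos by (intro mult_left_mono) auto
  finally have key: "\<bar>l\<bar> * (\<bar>l\<bar> - R - 2 * L) \<le> (R + L) * (1 + L)" by (simp add: algebra_simps)
  show ?thesis
  proof (rule ccontr)
    assume "\<not> ?thesis"
    then have "R + L < \<bar>l\<bar>" "1 + L < \<bar>l\<bar> - R - 2 * L" using L_pos by auto
    then have "(R + L) * (1 + L) < \<bar>l\<bar> * (\<bar>l\<bar> - R - 2 * L)"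
      using R(1) L_pos by (intro mult_strict_mono) auto
    then show False using key by simp
  qed
qed

lemma hessian_bound_at_small_gradient:
  assumes R: "0 \<le> R" "\<And>y. y \<in> V \<Longrightarrow> norm (H y (g y)) \<le> R * norm (g y)"
    and x: "x \<in> V" "norm (g x) \<le> 1" and v: "v \<in> V"
  shows "norm (H x v) \<le> (R + 3 * L + 1) * norm v"
proof -
  interpret symmetric_operator V "H x" using x(1) by (rule symmetric_operator_H)
  obtain B where B: "is_eigenbasis B" by (rule ex_eigenbasis)
  let ?M = "R + 3 * L + 1"
  have "(norm (H x v))\<^sup>2 = (\<Sum>u\<in>B. (eigval u)\<^sup>2 * (inner u v)\<^sup>2)" by (rule eigenbasis_norm_image[OF B v])
  also have "\<dots> \<le> (\<Sum>u\<in>B. ?M\<^sup>2 * (inner u v)\<^sup>2)"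
  proof (intro sum_mono mult_right_mono)
    fix u assume "u \<in> B"
    then have "\<bar>eigval u\<bar> \<le> ?M"
      using B by (intro eigenvalue_bound_at_small_gradient[OF R x, of u])
        (auto simp: is_eigenbasis_def span_base orthonormal_def)
    then show "(eigval u)\<^sup>2 \<le> ?M\<^sup>2" using power_mono[of "\<bar>eigval u\<bar>" ?M 2] by simp
  qed auto
  also have "\<dots> = (?M * norm v)\<^sup>2"
    using B v by (simp add: is_eigenbasis_def orthonormal_norm_expand[of B v] power_mult_distrib sum_distrib_left)
  finally show ?thesis by (rule power2_le_imp_le) (use R(1) L_pos in simp)
qed

end

section \<open>Line search\<close>

lemma greatest_step:
  fixes \<phi> :: "real \<Rightarrow> real"
  assumes cont: "continuous_on UNIV \<phi>" and a: "0 < a" "\<phi> a \<le> 0"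
    and bound: "\<And>t. 0 < t \<Longrightarrow> \<phi> t \<le> 0 \<Longrightarrow> t \<le> b"
  defines "m \<equiv> (GREATEST t. 0 < t \<and> \<phi> t \<le> 0)"
  shows "\<phi> m \<le> 0" "a \<le> m"
proof -
  let ?S = "{a..b} \<inter> {t. \<phi> t \<le> 0}"
  have "closed {t. \<phi> t \<le> 0}" using cont by (intro closed_Collect_le) auto
  then have "compact ?S" by (intro compact_Int_closed) auto
  moreover have "a \<in> ?S" using a bound by auto
  then have "?S \<noteq> {}" by blast
  ultimately obtain t where t: "t \<in> ?S" "\<And>t'. t' \<in> ?S \<Longrightarrow> t' \<le> t"
    by (meson compact_attains_sup)
  have "m = t" unfolding m_def
  proof (rule Greatest_equality)
    show "0 < t \<and> \<phi> t \<le> 0" using t a by auto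
    show "y \<le> t" if "0 < y \<and> \<phi> y \<le> 0" for y
      using that t bound[of y] by (cases "a \<le> y") auto
  qed
  then show "\<phi> m \<le> 0" "a \<le> m" using t by auto
qed

context lipschitz_hessian_function
begin

context
  fixes f_min :: real and x dir :: 'a
  assumes lower: "\<And>y. y \<in> V \<Longrightarrow> f_min \<le> f y" and x: "x \<in> V" and dir: "dir \<in> V"
begin

lemma line_taylor:
  assumes "0 < t"
  shows "f (x + t *\<^sub>R dir) \<le> f x + t * inner (g x) dir + t\<^sup>2 / 2 * inner dir (H x dir) + t ^ 3 * (L * norm dir ^ 3)"
  using function_taylor[OF x subspace_scale[OF subspace dir, of t]] assms x
  by (simp add: H_scale power_mult_distrib power2_eq_square algebra_simps)

text \<open>At \<open>t = sqrt ((1 - \<rho>) / (L \<parallel>dir\<parallel>))\<close> the cubic term of the Taylor bound uses up the part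
  \<open>1 - \<rho>\<close> of the linear decrease, so the step is at least as long.\<close>

lemma npc_descent:
  assumes \<rho>: "0 < \<rho>" "\<rho> < 1" and d0: "dir \<noteq> 0"
    and slope: "inner (g x) dir = - (norm dir)\<^sup>2" and curv: "inner dir (H x dir) \<le> 0"
  defines "m \<equiv> (GREATEST t. 0 < t \<and> f (x + t *\<^sub>R dir) \<le> f x + \<rho> * t * inner (g x) dir)"
  shows "f (x + m *\<^sub>R dir) \<le> f x - \<rho> * sqrt ((1 - \<rho>) / L) * (norm dir * sqrt (norm dir))"
proof -
  define n where "n = norm dir"
  have n: "0 < n" using d0 by (simp add: n_def)
  define a where "a = sqrt ((1 - \<rho>) / (L * n))"
  define \<phi> where "\<phi> t = f (x + t *\<^sub>R dir) - (f x + \<rho> * t * inner (g x) dir)" for t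
  have a: "0 < a" "a\<^sup>2 = (1 - \<rho>) / (L * n)" using n L_pos \<rho> by (auto simp: a_def)
  have cont: "continuous_on UNIV \<phi>"
    unfolding \<phi>_def by (intro continuous_intros f_line_continuous x dir)
  have \<phi>a: "\<phi> a \<le> 0"
  proof -
    have "a\<^sup>2 / 2 * inner dir (H x dir) \<le> 0" using curv by (intro mult_nonneg_nonpos) auto
    then have "\<phi> a \<le> - (1 - \<rho>) * a * n\<^sup>2 + a ^ 3 * (L * n ^ 3)"
      using line_taylor[OF a(1)] slope by (simp add: \<phi>_def n_def algebra_simps)
    also have "a ^ 3 * (L * n ^ 3) = a\<^sup>2 * (L * n) * (a * n\<^sup>2)"
      by (simp add: power2_eq_square power3_eq_cube)
    also have "a\<^sup>2 * (L * n) = 1 - \<rho>" using n L_pos by (simp add: a(2))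
    finally show ?thesis by (simp add: algebra_simps)
  qed
  have "t \<le> (f x - f_min) / (\<rho> * n\<^sup>2)" if "0 < t" "\<phi> t \<le> 0" for t
    using lower[OF mem_V(1)[OF x dir], of t] that \<rho> n slope by (simp add: \<phi>_def n_def field_simps)
  note m = greatest_step[OF cont a(1) \<phi>a this]
  have m_eq: "(GREATEST t. 0 < t \<and> \<phi> t \<le> 0) = m" by (simp add: m_def \<phi>_def)
  have "f (x + m *\<^sub>R dir) \<le> f x - \<rho> * m * n\<^sup>2"
    using m(1) slope unfolding m_eq by (simp add: \<phi>_def n_def)
  also have "\<dots> \<le> f x - \<rho> * a * n\<^sup>2"
    using m(2) \<rho> unfolding m_eq by (intro diff_mono mult_right_mono mult_left_mono) auto
  also have "a * n\<^sup>2 = sqrt ((1 - \<rho>) / L) * (n * sqrt n)"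
  proof -
    have "a = sqrt ((1 - \<rho>) / L) / sqrt n" by (simp add: a_def real_sqrt_divide real_sqrt_mult)
    moreover have "n\<^sup>2 / sqrt n = n * (n / sqrt n)" by (simp add: power2_eq_square)
    moreover have "n / sqrt n = sqrt n" using n by (simp add: real_div_sqrt)
    ultimately show ?thesis by (metis times_divide_eq_left times_divide_eq_right)
  qed
  then have "\<rho> * a * n\<^sup>2 = \<rho> * sqrt ((1 - \<rho>) / L) * (n * sqrt n)" by (simp add: mult.assoc)
  finally show ?thesis by (simp add: n_def)
qed

text \<open>Here the cubic term is balanced with the part \<open>1 - \<rho>\<close> of the quadratic decrease, up to steps of
  length proportional to \<open>\<epsilon>\<close>.\<close>

lemma negative_curvature_descent:
  assumes \<rho>: "0 < \<rho>" "\<rho> < 1" and \<epsilon>: "0 < \<epsilon>" and d1: "norm dir = 1"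
    and slope: "inner (g x) dir \<le> 0" and curv: "inner dir (H x dir) \<le> - \<epsilon> / 2"
  defines "m \<equiv> (GREATEST t. 0 < t \<and> f (x + t *\<^sub>R dir) \<le> f x + 1 / 2 * \<rho> * t\<^sup>2 * inner dir (H x dir))"
  shows "f (x + m *\<^sub>R dir) \<le> f x - \<rho> * (1 - \<rho>)\<^sup>2 / (64 * L\<^sup>2) * \<epsilon> ^ 3"
proof -
  define c where "c = - inner dir (H x dir)"
  have c: "\<epsilon> / 2 \<le> c" using curv by (simp add: c_def)
  define a where "a = (1 - \<rho>) * \<epsilon> / (4 * L)"
  define \<phi> where "\<phi> t = f (x + t *\<^sub>R dir) - (f x + 1 / 2 * \<rho> * t\<^sup>2 * inner dir (H x dir))" for t
  have a: "0 < a" using L_pos \<rho> \<epsilon> by (simp add: a_def)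
  have cont: "continuous_on UNIV \<phi>"
    unfolding \<phi>_def by (intro continuous_intros f_line_continuous x dir)
  have \<phi>a: "\<phi> a \<le> 0"
  proof -
    have "a * inner (g x) dir \<le> 0" using a slope by (intro mult_nonneg_nonpos) auto
    then have "\<phi> a \<le> a\<^sup>2 / 2 * inner dir (H x dir) + a ^ 3 * L - 1 / 2 * \<rho> * a\<^sup>2 * inner dir (H x dir)"
      using line_taylor[OF a] d1 by (simp add: \<phi>_def)
    also have "\<dots> = a\<^sup>2 * (L * a - (1 - \<rho>) * (c / 2))"
      by (simp add: c_def power2_eq_square power3_eq_cube field_simps)
    finally have "\<phi> a \<le> a\<^sup>2 * (L * a - (1 - \<rho>) * (c / 2))" .
    moreover have "L * a \<le> (1 - \<rho>) * (c / 2)"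
    proof -
      have "L * a = (1 - \<rho>) * (\<epsilon> / 4)" using L_pos by (simp add: a_def)
      also have "\<dots> \<le> (1 - \<rho>) * (c / 2)" using c \<rho> by (intro mult_left_mono) auto
      finally show ?thesis .
    qed
    ultimately show ?thesis using mult_nonneg_nonpos[of "a\<^sup>2" "L * a - (1 - \<rho>) * (c / 2)"] by simp
  qed
  have "t \<le> max 1 (4 * (f x - f_min) / (\<rho> * \<epsilon>))" if t: "0 < t" "\<phi> t \<le> 0" for t
  proof (cases "t \<le> 1")
    case False
    have "t * (\<rho> * \<epsilon>) \<le> t\<^sup>2 * (\<rho> * (2 * c))"
      using False c \<rho> \<epsilon> by (intro mult_mono) (auto simp: power2_eq_square)
    also have "\<dots> \<le> 4 * (f x - f_min)"
      using lower[OF mem_V(1)[OF x dir], of t] t by (simp add: \<phi>_def c_def algebra_simps)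
    finally show ?thesis using \<rho> \<epsilon> by (simp add: le_max_iff_disj pos_le_divide_eq)
  qed simp
  note m = greatest_step[OF cont a \<phi>a this]
  have m_eq: "(GREATEST t. 0 < t \<and> \<phi> t \<le> 0) = m" by (simp add: m_def \<phi>_def)
  have "a\<^sup>2 * (\<epsilon> / 2) \<le> m\<^sup>2 * c"
    using m(2) a c \<epsilon> unfolding m_eq by (intro mult_mono power_mono) auto
  then have "\<rho> / 2 * (a\<^sup>2 * (\<epsilon> / 2)) \<le> \<rho> / 2 * (m\<^sup>2 * c)" using \<rho> by (intro mult_left_mono) auto
  moreover have "f (x + m *\<^sub>R dir) \<le> f x - \<rho> / 2 * (m\<^sup>2 * c)"
    using m(1) unfolding m_eq by (simp add: \<phi>_def c_def)
  moreover have "\<rho> / 2 * (a\<^sup>2 * (\<epsilon> / 2)) = \<rho> * (1 - \<rho>)\<^sup>2 / (64 * L\<^sup>2) * \<epsilon> ^ 3"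
    by (simp add: a_def power2_eq_square power3_eq_cube)
  ultimately show ?thesis by linarith
qed

text \<open>A step with a residual small compared to its length: either the step is long, and the
  decrease is at least of order \<open>\<epsilon>\<close>, or the full Newton step is taken and the new gradient is
  small.\<close>

lemma newton_descent:
  assumes \<rho>: "0 < \<rho>" "\<rho> < 1 / 2" and \<sigma>: "0 < \<sigma>" and \<epsilon>: "0 < \<epsilon>" "\<epsilon> \<le> 1" and c: "0 \<le> c" and d0: "dir \<noteq> 0"
    and slope: "inner (g x) dir \<le> - inner dir (H x dir)" and curv: "\<sigma> * (norm dir)\<^sup>2 \<le> inner dir (H x dir)"
    and residual: "norm (g x + H x dir) \<le> c * sqrt \<epsilon> * norm dir"
  defines "m \<equiv> (GREATEST t. 0 < t \<and> t \<le> 1 \<and> f (x + t *\<^sub>R dir) \<le> f x + \<rho> * t * inner (g x) dir)"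
    and "\<kappa> \<equiv> \<sigma> * (1 / 2 - \<rho>) / L" and "\<tau> \<equiv> 1 / (c + L + 1)"
  shows "f (x + m *\<^sub>R dir) \<le> f x"
    "norm (g (x + m *\<^sub>R dir)) \<le> \<epsilon> \<or> f (x + m *\<^sub>R dir) \<le> f x - \<rho> * \<sigma> * (min \<kappa> \<tau>)\<^sup>2 * \<epsilon>"
proof -
  define n where "n = norm dir"
  define G where "G = - inner (g x) dir"
  have n: "0 < n" using d0 by (simp add: n_def)
  have G: "\<sigma> * n\<^sup>2 \<le> G" "inner dir (H x dir) \<le> G" using slope curv by (auto simp: G_def n_def)
  have G0: "0 \<le> G" using G(1) \<sigma> by (meson less_imp_le mult_nonneg_nonneg order.trans zero_le_power2)
  have \<kappa>: "0 < \<kappa>" using \<sigma> \<rho> L_pos by (simp add: \<kappa>_def)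
  have \<tau>: "0 < \<tau>" "\<tau> \<le> 1" using c L_pos by (auto simp: \<tau>_def)
  define a where "a = min 1 (sqrt (\<kappa> / n))"
  define \<phi> where "\<phi> t = max (t - 1) (f (x + t *\<^sub>R dir) - (f x - \<rho> * t * G))" for t
  have a: "0 < a" "a \<le> 1" using \<kappa> n by (auto simp: a_def)
  have "a\<^sup>2 \<le> (sqrt (\<kappa> / n))\<^sup>2" using a by (intro power_mono) (auto simp: a_def)
  then have a2: "a\<^sup>2 * n \<le> \<kappa>" using \<kappa> n by (simp add: field_simps)
  have cont: "continuous_on UNIV \<phi>"
    unfolding \<phi>_def by (intro continuous_intros f_line_continuous x dir)
  have \<phi>a: "\<phi> a \<le> 0"
  proof -
    have "a\<^sup>2 / 2 * inner dir (H x dir) \<le> a\<^sup>2 / 2 * G" using G by (intro mult_left_mono) auto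
    moreover have "a\<^sup>2 / 2 * G \<le> a / 2 * G" using a G0
      by (intro mult_right_mono) (auto simp: power2_eq_square mult_left_le)
    ultimately have "f (x + a *\<^sub>R dir) - (f x - \<rho> * a * G) \<le> - (1 / 2 - \<rho>) * a * G + a ^ 3 * (L * n ^ 3)"
      using line_taylor[OF a(1)] by (simp add: G_def n_def algebra_simps)
    also have "a ^ 3 * (L * n ^ 3) = L * (a\<^sup>2 * n) * (a * n\<^sup>2)" by (simp add: power2_eq_square power3_eq_cube)
    also have "\<dots> \<le> L * \<kappa> * (a * n\<^sup>2)" using a2 L_pos a n by (intro mult_right_mono mult_left_mono) auto
    also have "\<dots> = (1 / 2 - \<rho>) * a * (\<sigma> * n\<^sup>2)" using L_pos by (simp add: \<kappa>_def)
    also have "\<dots> \<le> (1 / 2 - \<rho>) * a * G" using G \<rho> a by (intro mult_left_mono) auto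
    finally show ?thesis using a by (simp add: \<phi>_def algebra_simps)
  qed
  have "t \<le> 1" if "0 < t" "\<phi> t \<le> 0" for t using that by (simp add: \<phi>_def)
  note m = greatest_step[OF cont a(1) \<phi>a this]
  have m_eq: "(GREATEST t. 0 < t \<and> \<phi> t \<le> 0) = m"
    unfolding m_def by (rule arg_cong[where f = Greatest]) (auto simp: \<phi>_def G_def fun_eq_iff)
  have m1: "a \<le> m" "m \<le> 1" "f (x + m *\<^sub>R dir) \<le> f x - \<rho> * m * G"
    using m unfolding m_eq by (auto simp: \<phi>_def)
  have dec: "f (x + m *\<^sub>R dir) \<le> f x - \<rho> * \<sigma> * (a * n\<^sup>2)"
  proof -
    have "\<rho> * a * (\<sigma> * n\<^sup>2) \<le> \<rho> * m * G" using m1 G \<rho> \<sigma> a n by (intro mult_mono) auto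
    then show ?thesis using m1(3) by (simp add: algebra_simps)
  qed
  have dec0: "0 \<le> \<rho> * \<sigma> * (a * n\<^sup>2)" using \<rho> \<sigma> a by simp
  show "f (x + m *\<^sub>R dir) \<le> f x" using dec dec0 by simp
  have goal: "norm (g (x + m *\<^sub>R dir)) \<le> \<epsilon> \<or> f (x + m *\<^sub>R dir) \<le> f x - \<rho> * \<sigma> * (min \<kappa> \<tau>)\<^sup>2 * \<epsilon>"
    if "(min \<kappa> \<tau>)\<^sup>2 * \<epsilon> \<le> a * n\<^sup>2"
  proof -
    have "\<rho> * \<sigma> * ((min \<kappa> \<tau>)\<^sup>2 * \<epsilon>) \<le> \<rho> * \<sigma> * (a * n\<^sup>2)" using that \<rho> \<sigma> by (intro mult_left_mono) auto
    then show ?thesis using dec by (simp add: mult.assoc)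
  qed
  show "norm (g (x + m *\<^sub>R dir)) \<le> \<epsilon> \<or> f (x + m *\<^sub>R dir) \<le> f x - \<rho> * \<sigma> * (min \<kappa> \<tau>)\<^sup>2 * \<epsilon>"
  proof (cases "n \<le> \<kappa>")
    case False
    have le1: "0 \<le> \<kappa> / n" "\<kappa> / n \<le> 1" using False \<kappa> n by auto
    have "\<kappa> / n \<le> sqrt (\<kappa> / n)" using power_decreasing[of 1 2 "\<kappa> / n"] le1 by (intro real_le_rsqrt) simp
    then have "\<kappa> / n \<le> a" using le1 by (simp add: a_def)
    then have "\<kappa> / n * n\<^sup>2 \<le> a * n\<^sup>2" by (intro mult_right_mono) auto
    then have "\<kappa> * n \<le> a * n\<^sup>2" using n by (simp add: power2_eq_square)
    moreover have "(min \<kappa> \<tau>)\<^sup>2 * \<epsilon> \<le> \<kappa>\<^sup>2 * 1" using \<kappa> \<tau> \<epsilon> by (intro mult_mono power_mono) auto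
    moreover have "\<kappa>\<^sup>2 \<le> \<kappa> * n" using False \<kappa> by (simp add: power2_eq_square)
    ultimately have "(min \<kappa> \<tau>)\<^sup>2 * \<epsilon> \<le> a * n\<^sup>2" by linarith
    then show ?thesis by (rule goal)
  next
    case True
    then have "1 \<le> \<kappa> / n" using n by simp
    then have "a = 1" by (simp add: a_def)
    then have "m = 1" using m1 by simp
    show ?thesis
    proof (cases "n < \<tau> * sqrt \<epsilon>")
      case True
      have "g (x + dir) = (g (x + dir) - g x - H x dir) + (g x + H x dir)" by simp
      then have "norm (g (x + dir)) \<le> L * n\<^sup>2 + c * sqrt \<epsilon> * n"
        using gradient_taylor[OF x dir] residual unfolding n_def by (metis add_mono norm_triangle_le)
      also have "\<dots> \<le> L * (\<tau> * sqrt \<epsilon>)\<^sup>2 + c * sqrt \<epsilon> * (\<tau> * sqrt \<epsilon>)"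
        using True n L_pos c \<epsilon> by (intro add_mono mult_left_mono power_mono) auto
      also have "\<dots> = (L * (\<tau> * \<tau>) + c * \<tau>) * \<epsilon>"
        using \<epsilon> by (simp add: power_mult_distrib algebra_simps power2_eq_square[of \<tau>])
      also have "\<dots> \<le> (L * \<tau> + c * \<tau>) * \<epsilon>"
        using L_pos \<tau> \<epsilon> by (intro mult_right_mono add_mono mult_left_mono) (auto simp: mult_left_le)
      also have "\<dots> \<le> 1 * \<epsilon>"
      proof (rule mult_right_mono)
        have "L * \<tau> + c * \<tau> = (L + c) * \<tau>" by (simp add: distrib_right)
        also have "\<dots> \<le> 1" using L_pos c by (simp add: \<tau>_def)
        finally show "L * \<tau> + c * \<tau> \<le> 1" .
      qed (use \<epsilon> in simp)
      finally show ?thesis using \<open>m = 1\<close> by simp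
    next
      case False
      have "(min \<kappa> \<tau>)\<^sup>2 * \<epsilon> \<le> \<tau>\<^sup>2 * \<epsilon>" using \<kappa> \<tau> \<epsilon> by (intro mult_right_mono power_mono) auto
      also have "\<dots> = (\<tau> * sqrt \<epsilon>)\<^sup>2" using \<epsilon> by (simp add: power_mult_distrib)
      also have "\<dots> \<le> n\<^sup>2" using False \<tau> \<epsilon> by (intro power_mono) auto
      finally show ?thesis using \<open>a = 1\<close> by (intro goal) simp
    qed
  qed
qed

end

end

section \<open>One outer iteration\<close>

lemma sinh_le_double:
  fixes a :: real assumes "0 \<le> a" "a \<le> 1" shows "sinh a \<le> 2 * a"
proof -
  have "exp a \<le> 1 + a + a\<^sup>2" using assms by (rule exp_bound)
  moreover have "1 - a \<le> exp (- a)" using exp_ge_add_one_self[of "- a"] by simp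
  moreover have "a\<^sup>2 \<le> a" using assms by (simp add: power2_eq_square mult_left_le)
  ultimately show ?thesis using assms by (simp add: sinh_field_def)
qed

context minres_run
begin

text \<open>With a uniform lower bound \<open>\<sigma>\<close> for the curvature on the Krylov spaces, the residual decreases
  geometrically, and the run cannot go on for more than logarithmically many iterations.\<close>

context
  fixes \<sigma> R \<eta> :: real
  assumes \<sigma>: "0 < \<sigma>" and R: "0 < R" and \<eta>: "0 < \<eta>"
    and lower: "\<And>t w. regular t \<Longrightarrow> w \<in> K t \<Longrightarrow> \<sigma> * (norm w)\<^sup>2 \<le> inner w (A w)"
    and upper: "\<And>t w. w \<in> K t \<Longrightarrow> norm (A w) \<le> R * norm w"
begin

lemma norm_image_ge:
  assumes "regular t" "w \<in> K t" shows "\<sigma> * norm w \<le> norm (A w)"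
proof -
  have "\<sigma> * norm w * norm w \<le> norm (A w) * norm w"
    using lower[OF assms] norm_cauchy_schwarz[of w "A w"] by (simp add: power2_eq_square mult_ac)
  then show ?thesis by (cases "w = 0") auto
qed

lemma residual_geometric:
  assumes "regular t" shows "(norm (r t))\<^sup>2 \<le> exp (- ((\<sigma> / R)\<^sup>2 * t)) * (norm b)\<^sup>2"
  using assms
proof (induction t)
  case (Suc t)
  then have reg: "regular t" by (simp add: regular_Suc)
  have "(norm (r (Suc t)))\<^sup>2 \<le> (1 - (\<sigma> / R)\<^sup>2) * (norm (r t))\<^sup>2"
    using Suc.prems reg by (intro residual_contraction R \<sigma> lower[of "Suc t"] upper[of _ "Suc t"] r_mem)
  also have "\<dots> \<le> exp (- (\<sigma> / R)\<^sup>2) * (norm (r t))\<^sup>2"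
    using exp_ge_add_one_self[of "- (\<sigma> / R)\<^sup>2"] by (intro mult_right_mono) auto
  also have "\<dots> \<le> exp (- (\<sigma> / R)\<^sup>2) * (exp (- ((\<sigma> / R)\<^sup>2 * t)) * (norm b)\<^sup>2)"
    by (intro mult_left_mono Suc.IH reg) auto
  also have "\<dots> = exp (- (\<sigma> / R)\<^sup>2 + - ((\<sigma> / R)\<^sup>2 * t)) * (norm b)\<^sup>2"
    by (simp only: exp_add mult.assoc)
  also have "- (\<sigma> / R)\<^sup>2 + - ((\<sigma> / R)\<^sup>2 * t) = - ((\<sigma> / R)\<^sup>2 * Suc t)" by (simp add: distrib_left)
  finally show ?case .
qed (simp add: cr_0)

lemma minres_iters_log_bound:
  assumes b0: "b \<noteq> 0"
  shows "real (minres_iters A b \<eta>) \<le> 2 + (R / \<sigma>)\<^sup>2 * ln (1 + R\<^sup>2 / \<eta>\<^sup>2)"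
proof -
  obtain E where E: "finite E" "V \<subseteq> span E" using fin_dim by (auto simp: fin_dim_def)
  define N where "N = minres_iters A b \<eta>"
  note props = minres_iters_props[OF less_imp_le[OF \<eta>] E, folded N_def]
  have ln0: "0 \<le> (R / \<sigma>)\<^sup>2 * ln (1 + R\<^sup>2 / \<eta>\<^sup>2)" by (intro mult_nonneg_nonneg ln_ge_zero) auto
  show ?thesis
  proof (cases "N \<le> 2")
    case False
    define t where "t = N - 2"
    have N: "N = Suc (Suc t)" using False by (simp add: t_def)
    have reg: "regular t" using props(5) N regular_mono by auto
    have "\<not> cr_sol A b \<eta> (Suc t)" using props(6)[of "Suc t"] N by simp
    then have "\<eta> * norm (A (s t)) < norm (A (r t))" by (simp add: cr_sol_def)
    also have "\<dots> \<le> R * norm (r t)" by (rule upper[OF r_mem[OF reg]])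
    finally have "(\<eta> * norm (A (s t)))\<^sup>2 < (R * norm (r t))\<^sup>2" using \<eta> by (intro power_strict_mono) auto
    then have "\<eta>\<^sup>2 * ((norm b)\<^sup>2 - (norm (r t))\<^sup>2) < R\<^sup>2 * (norm (r t))\<^sup>2"
      by (simp add: power_mult_distrib norm_image_iterate[OF reg])
    then have "\<eta>\<^sup>2 * (norm b)\<^sup>2 < (R\<^sup>2 + \<eta>\<^sup>2) * (norm (r t))\<^sup>2" by (simp add: algebra_simps)
    also have "\<dots> \<le> (R\<^sup>2 + \<eta>\<^sup>2) * (exp (- ((\<sigma> / R)\<^sup>2 * t)) * (norm b)\<^sup>2)"
      by (intro mult_left_mono residual_geometric reg) auto
    finally have "\<eta>\<^sup>2 < (R\<^sup>2 + \<eta>\<^sup>2) * exp (- ((\<sigma> / R)\<^sup>2 * t))"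
      using b0 by (simp add: mult.assoc[symmetric])
    then have "exp ((\<sigma> / R)\<^sup>2 * t) < 1 + R\<^sup>2 / \<eta>\<^sup>2"
      using \<eta> by (simp add: exp_minus field_simps)
    moreover have "0 < 1 + R\<^sup>2 / \<eta>\<^sup>2" by (simp add: add_pos_nonneg)
    ultimately have "(\<sigma> / R)\<^sup>2 * t < ln (1 + R\<^sup>2 / \<eta>\<^sup>2)" by (metis exp_less_cancel_iff exp_ln)
    then have "(R / \<sigma>)\<^sup>2 * ((\<sigma> / R)\<^sup>2 * t) \<le> (R / \<sigma>)\<^sup>2 * ln (1 + R\<^sup>2 / \<eta>\<^sup>2)"
      by (intro mult_left_mono) auto
    moreover have "(R / \<sigma>)\<^sup>2 * ((\<sigma> / R)\<^sup>2 * t) = real t"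
      using \<sigma> R by (simp add: power_divide)
    ultimately show ?thesis by (simp add: N_def[symmetric] N)
  next
    case True
    then have "real N \<le> 2" by simp
    then show ?thesis using ln0 unfolding N_def by linarith
  qed
qed

text \<open>The slope is \<open>\<langle>b, s\<rangle> = -\<langle>s, A s\<rangle> - \<langle>s, r\<rangle>\<close> with \<open>\<langle>s, r\<rangle> \<ge> 0\<close>, and the residual is controlled by
  \<open>\<sigma> \<parallel>r\<parallel> \<le> \<parallel>A r\<parallel> \<le> \<eta> \<parallel>A s\<parallel>\<close>.\<close>

lemma minres_SOL_direction:
  assumes b0: "b \<noteq> 0" and sol: "minres A b \<eta> = (SOL, dir)"
  shows "dir \<in> V" "dir \<noteq> 0" "inner b dir \<le> - inner dir (A dir)" "\<sigma> * (norm dir)\<^sup>2 \<le> inner dir (A dir)"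
    "norm (b + A dir) \<le> \<eta> * R / \<sigma> * norm dir"
proof -
  obtain E where E: "finite E" "V \<subseteq> span E" using fin_dim by (auto simp: fin_dim_def)
  define N where "N = minres_iters A b \<eta>"
  note props = minres_iters_props[OF less_imp_le[OF \<eta>] E, folded N_def]
  define t where "t = N - 1"
  have reg: "regular t" using props(5) by (simp add: t_def)
  have npc: "\<not> cr_npc A b N" and dir: "dir = s t"
    using sol props(7) by (auto simp: t_def split: if_splits)
  then have sol': "norm (A (r t)) \<le> \<eta> * norm (A (s t))" using props(4) by (simp add: cr_sol_def t_def)
  have req: "r t = - (b + A dir)" using r_eq[OF reg] by (simp add: dir)
  show "dir \<in> V" using s_mem[OF reg] K_subset by (auto simp: dir)
  show curv: "\<sigma> * (norm dir)\<^sup>2 \<le> inner dir (A dir)" unfolding dir by (rule lower[OF reg s_mem[OF reg]])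
  have "inner b dir = - inner dir (A dir) - inner dir (r t)"
    by (simp add: req inner_diff_right inner_commute[of b])
  then show "inner b dir \<le> - inner dir (A dir)"
    using inner_iterate_residual_nonneg[OF reg] by (simp add: dir)
  have reg': "r t = 0 \<or> regular (Suc t)"
    using npc reg by (auto simp: cr_npc_def t_def regular_Suc)
  have "\<sigma> * norm (r t) \<le> \<eta> * (R * norm dir)"
  proof (cases "r t = 0")
    case False
    then have "\<sigma> * norm (r t) \<le> norm (A (r t))" using reg' norm_image_ge[of "Suc t" "r t"] r_mem[OF reg] by auto
    also have "\<dots> \<le> \<eta> * (R * norm dir)"
      using sol' upper[OF s_mem[OF reg]] \<eta> unfolding dir by (meson mult_left_mono less_imp_le order.trans)
    finally show ?thesis .
  qed (use \<eta> R in simp)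
  then have res: "norm (r t) \<le> \<eta> * R / \<sigma> * norm dir" using \<sigma> by (simp add: field_simps)
  then show "norm (b + A dir) \<le> \<eta> * R / \<sigma> * norm dir" unfolding req by (simp only: norm_minus_cancel)
  show "dir \<noteq> 0"
  proof
    assume "dir = 0"
    then show False using res req b0 by simp
  qed
qed

end

lemma minres_NPC_direction:
  assumes \<eta>: "0 \<le> \<eta>" and npc: "minres A b \<eta> = (NPC, dir)"
  shows "dir \<in> V" "dir \<noteq> 0" "inner b dir = - (norm dir)\<^sup>2" "inner dir (A dir) \<le> 0"
proof -
  obtain E where E: "finite E" "V \<subseteq> span E" using fin_dim by (auto simp: fin_dim_def)
  define N where "N = minres_iters A b \<eta>"
  note props = minres_iters_props[OF \<eta> E, folded N_def]
  have "cr_npc A b N" "dir = r (N - 1)" using npc props(7) by (auto split: if_splits)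
  then show "dir \<in> V" "dir \<noteq> 0" "inner b dir = - (norm dir)\<^sup>2" "inner dir (A dir) \<le> 0"
    using cr_mem inner_b_residual[OF props(5)] by (auto simp: cr_npc_def)
qed

end

locale newton_mr_problem = lipschitz_hessian_function V f g H L
  for V :: "'a::real_inner set" and f g H L +
  fixes P :: params and \<sigma> R f_min :: real
  assumes eps_g: "0 < eps_g P" "eps_g P \<le> 1" and eps_H: "0 < eps_H P" "eps_H P \<le> 1"
    and theta: "0 < theta P"
    and rho: "0 < rho_S P" "rho_S P < 1 / 2" "0 < rho_N P" "rho_N P < 1" "0 < rho_C P" "rho_C P < 1"
    and \<sigma>: "0 < \<sigma>" and regular_I: "krylov_regular_I V g H \<sigma>"
    and R: "0 < R" "\<And>x l. x \<in> V \<Longrightarrow> l \<in> relevant V (H x) (g x) \<Longrightarrow> \<bar>l\<bar> \<le> R"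
    and f_min: "\<And>x. x \<in> V \<Longrightarrow> f_min \<le> f x"
begin

abbreviation tol :: real where "tol \<equiv> theta P * sqrt (eps_g P)"

lemma tol_pos: "0 < tol"
  using theta eps_g by simp

lemma minres_run_H: "x \<in> V \<Longrightarrow> minres_run V (H x) (g x)"
  using symmetric_operator_H g_mem by (simp add: minres_run_def minres_run_axioms_def)

lemma krylov_upper:
  assumes "x \<in> V" "w \<in> krylov (H x) (g x) t" shows "norm (H x w) \<le> R * norm w"
proof -
  interpret minres_run V "H x" "g x" using assms(1) by (rule minres_run_H)
  show ?thesis using assms R by (intro norm_image_krylov[OF b _ _ assms(2)]) auto
qed

text \<open>Regular steps are not flagged NPC and do not exceed the grade, so the regularity of the Krylov
  spaces applies to them.\<close>

lemma krylov_lower: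
  assumes x: "x \<in> V" and reg: "minres_run.regular (H x) (g x) t" and w: "w \<in> krylov (H x) (g x) t"
  shows "\<sigma> * (norm w)\<^sup>2 \<le> inner w (H x w)"
proof -
  interpret minres_run V "H x" "g x" using x by (rule minres_run_H)
  have "\<not> npc_at (H x) (g x) i" if "i \<in> {1..t}" for i
  proof -
    define j where "j = i - 1"
    have j: "i = Suc j" "j < t" using that by (auto simp: j_def)
    then have "0 < inner (r j) (H x (r j))" using reg by (simp add: regular_def)
    moreover have "regular (i - 1)" using regular_mono[OF reg] j by simp
    ultimately show ?thesis using npc_at_eq by (simp add: cr_npc_def j)
  qed
  then show ?thesis using regular_I regular_le_grade[OF reg] x w by (auto simp: krylov_regular_I_def)
qed

lemma large_gradient_iters:
  assumes x: "x \<in> V" and large: "eps_g P < norm (g x)"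
  shows "real (call_iters P g H q x) \<le> 2 + (R / \<sigma>)\<^sup>2 * ln (1 + R\<^sup>2 / tol\<^sup>2)"
proof -
  interpret minres_run V "H x" "g x" using x by (rule minres_run_H)
  have "g x \<noteq> 0" using large eps_g by auto
  then show ?thesis
    using minres_iters_log_bound[OF \<sigma> R(1) tol_pos krylov_lower[OF x] krylov_upper[OF x]] large
    by (simp add: call_iters_def)
qed

text \<open>The coefficients of the guaranteed decrease of \<open>f\<close> by the three kinds of steps, as multiples of
  \<open>\<epsilon>\<^sub>g\<close>, \<open>\<epsilon>\<^sub>g\<^sup>3\<^sup>/\<^sup>2\<close> and \<open>\<epsilon>\<^sub>H\<^sup>3\<close>.\<close>

definition newton_const :: real where
  "newton_const =
     rho_S P * \<sigma> * (min (\<sigma> * (1 / 2 - rho_S P) / L) (1 / (theta P * R / \<sigma> + L + 1)))\<^sup>2"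

definition npc_const :: "real \<Rightarrow> real" where
  "npc_const \<omega> = rho_N P * sqrt ((1 - rho_N P) / L) * (\<omega> * sqrt \<omega>)"

definition curvature_const :: real where
  "curvature_const = rho_C P * (1 - rho_C P)\<^sup>2 / (64 * L\<^sup>2)"

text \<open>An NPC step decreases \<open>f\<close> by a multiple of \<open>\<parallel>dir\<parallel>\<^sup>3\<^sup>/\<^sup>2\<close>, which is where the lower bound on the
  length of the direction enters.\<close>

lemma large_gradient_step:
  assumes x: "x \<in> V" and large: "eps_g P < norm (g x)" and \<omega>: "0 < \<omega>"
  obtains y where "newton_mr_step P f g H z q x = Some y" "y \<in> V" "f y \<le> f x"
    "norm (g y) \<le> eps_g P \<or>
     f y \<le> f x - min newton_const (npc_const \<omega>) * (eps_g P * sqrt (eps_g P)) \<or>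
     (\<exists>dir. minres_call P g H q x = (NPC, dir) \<and> norm dir < \<omega> * norm (g x))"
proof -
  interpret run: minres_run V "H x" "g x" using x by (rule minres_run_H)
  have g0: "g x \<noteq> 0" using large eps_g by auto
  obtain flg dir where call: "minres (H x) (g x) tol = (flg, dir)" by (cases "minres (H x) (g x) tol")
  define \<epsilon> where "\<epsilon> = eps_g P"
  have \<epsilon>: "0 < \<epsilon>" "\<epsilon> \<le> 1" using eps_g by (auto simp: \<epsilon>_def)
  show ?thesis
  proof (cases flg)
    case NPC
    note d = run.minres_NPC_direction[OF less_imp_le[OF tol_pos] call[unfolded NPC]]
    define y where "y = x + (GREATEST \<alpha>. 0 < \<alpha> \<and>
        f (x + \<alpha> *\<^sub>R dir) \<le> f x + rho_N P * \<alpha> * inner (g x) dir) *\<^sub>R dir"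
    have dec: "f y \<le> f x - rho_N P * sqrt ((1 - rho_N P) / L) * (norm dir * sqrt (norm dir))"
      unfolding y_def by (rule npc_descent[OF f_min x d(1) rho(3,4) d(2-4)])
    have "0 \<le> rho_N P * sqrt ((1 - rho_N P) / L) * (norm dir * sqrt (norm dir))"
      using rho L_pos by simp
    with dec have le: "f y \<le> f x" by linarith
    have big: "f y \<le> f x - min newton_const (npc_const \<omega>) * (eps_g P * sqrt (eps_g P))"
      if "\<not> norm dir < \<omega> * norm (g x)"
    proof -
      have "\<omega> * \<epsilon> \<le> \<omega> * norm (g x)" using large \<omega> by (intro mult_left_mono) (auto simp: \<epsilon>_def)
      with that have n: "\<omega> * \<epsilon> \<le> norm dir" by linarith
      have "min newton_const (npc_const \<omega>) * (\<epsilon> * sqrt \<epsilon>) \<le> npc_const \<omega> * (\<epsilon> * sqrt \<epsilon>)"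
        using \<epsilon> by (intro mult_right_mono) auto
      also have "\<dots> = rho_N P * sqrt ((1 - rho_N P) / L) * ((\<omega> * \<epsilon>) * sqrt (\<omega> * \<epsilon>))"
        by (simp add: npc_const_def real_sqrt_mult)
      also have "\<dots> \<le> rho_N P * sqrt ((1 - rho_N P) / L) * (norm dir * sqrt (norm dir))"
        using n \<omega> \<epsilon> rho L_pos by (intro mult_left_mono mult_mono) auto
      finally show ?thesis using dec by (simp add: \<epsilon>_def)
    qed
    show ?thesis
    proof (rule that)
      show "newton_mr_step P f g H z q x = Some y"
        using large by (simp add: newton_mr_step_def minres_call_def call NPC y_def)
      show "y \<in> V" unfolding y_def using x d by (intro mem_V)
      show "norm (g y) \<le> eps_g P \<or>
         f y \<le> f x - min newton_const (npc_const \<omega>) * (eps_g P * sqrt (eps_g P)) \<or>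
         (\<exists>dir. minres_call P g H q x = (NPC, dir) \<and> norm dir < \<omega> * norm (g x))"
        using big large call NPC by (auto simp: minres_call_def)
    qed (rule le)
  next
    case SOL
    note d = run.minres_SOL_direction[OF \<sigma> R(1) tol_pos krylov_lower[OF x] krylov_upper[OF x] g0
        call[unfolded SOL]]
    have d: "dir \<in> V" "dir \<noteq> 0" "inner (g x) dir \<le> - inner dir (H x dir)"
      "\<sigma> * (norm dir)\<^sup>2 \<le> inner dir (H x dir)" "norm (g x + H x dir) \<le> theta P * R / \<sigma> * sqrt (eps_g P) * norm dir"
      using d by (auto simp: algebra_simps)
    define y where "y = x + (GREATEST \<alpha>. 0 < \<alpha> \<and> \<alpha> \<le> 1 \<and>
        f (x + \<alpha> *\<^sub>R dir) \<le> f x + rho_S P * \<alpha> * inner (g x) dir) *\<^sub>R dir"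
    have c0: "0 \<le> theta P * R / \<sigma>" using theta R \<sigma> by simp
    have le: "f y \<le> f x"
      unfolding y_def
      by (rule newton_descent(1)[OF f_min x d(1) rho(1,2) \<sigma> eps_g c0 d(2-5)])
    have alt: "norm (g y) \<le> eps_g P \<or> f y \<le> f x - newton_const * eps_g P"
      unfolding y_def newton_const_def
      by (rule newton_descent(2)[OF f_min x d(1) rho(1,2) \<sigma> eps_g c0 d(2-5)])
    have "0 \<le> newton_const" using rho \<sigma> by (simp add: newton_const_def)
    have "min newton_const (npc_const \<omega>) * (\<epsilon> * sqrt \<epsilon>) \<le> newton_const * (\<epsilon> * sqrt \<epsilon>)"
      using \<epsilon> by (intro mult_right_mono) auto
    also have "\<dots> \<le> newton_const * (\<epsilon> * 1)"
      using \<epsilon> \<open>0 \<le> newton_const\<close> by (intro mult_left_mono) auto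
    finally have weaker: "min newton_const (npc_const \<omega>) * (\<epsilon> * sqrt \<epsilon>) \<le> newton_const * \<epsilon>" by simp
    show ?thesis
    proof (rule that)
      show "newton_mr_step P f g H z q x = Some y"
        using large by (simp add: newton_mr_step_def minres_call_def call SOL y_def)
      show "y \<in> V" unfolding y_def using x d by (intro mem_V)
      show "norm (g y) \<le> eps_g P \<or>
         f y \<le> f x - min newton_const (npc_const \<omega>) * (eps_g P * sqrt (eps_g P)) \<or>
         (\<exists>dir. minres_call P g H q x = (NPC, dir) \<and> norm dir < \<omega> * norm (g x))"
        using alt weaker by (auto simp: \<epsilon>_def)
    qed (rule le)
  qed
qed

lemma symmetric_operator_shifted:
  assumes x: "x \<in> V" shows "symmetric_operator V (shifted P (H x))"
proof -
  interpret symmetric_operator V "H x" using x by (rule symmetric_operator_H)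
  show ?thesis
  proof (rule symmetric_operator.intro)
    show "bounded_linear (shifted P (H x))"
      unfolding shifted_def[abs_def]
      by (intro bounded_linear_add bounded_linear bounded_linear_scaleR_right)
    show "shifted P (H x) v \<in> V" if "v \<in> V" for v
      using that closed subspace by (simp add: shifted_def subspace_add subspace_scale)
    show "inner (shifted P (H x) v) w = inner v (shifted P (H x) w)" if "v \<in> V" "w \<in> V" for v w
      using symmetric[OF that] by (simp add: shifted_def inner_add_left inner_add_right)
  qed (rule fin_dim)
qed

lemma minres_run_shifted: "x \<in> V \<Longrightarrow> q \<in> V \<Longrightarrow> minres_run V (shifted P (H x)) q"
  using symmetric_operator_shifted by (simp add: minres_run_def minres_run_axioms_def)

lemma small_gradient_step:
  assumes x: "x \<in> V" and small: "norm (g x) \<le> eps_g P" and q: "q \<in> V" and z: "z = 1 \<or> z = -1"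
    and npc: "fst (minres (shifted P (H x)) q 0) = NPC"
  obtains y where "newton_mr_step P f g H z q x = Some y" "y \<in> V"
    "f y \<le> f x - curvature_const * eps_H P ^ 3"
proof -
  interpret run: minres_run V "shifted P (H x)" q using x q by (rule minres_run_shifted)
  obtain r where call: "minres (shifted P (H x)) q 0 = (NPC, r)" using npc by (metis prod.collapse)
  note r = run.minres_NPC_direction[OF order.refl call]
  define c where "c = inner (g x) r"
  define dir where "dir = - (Sign z c *\<^sub>R (r /\<^sub>R norm r))"
  define k where "k = - Sign z c / norm r"
  have dir: "dir = k *\<^sub>R r" by (simp add: dir_def k_def divide_inverse)
  have S: "\<bar>Sign z c\<bar> = 1" "Sign z c * c = \<bar>c\<bar>"
    using z by (auto simp: Sign_def sgn_if)
  have k: "k\<^sup>2 * (norm r)\<^sup>2 = 1" using S r(2)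
    by (simp add: k_def power_divide) (metis power2_abs power_one)
  have dV: "dir \<in> V" unfolding dir using r subspace by (intro subspace_scale)
  have d1: "norm dir = 1" using S r(2) by (simp add: dir k_def)
  have slope: "inner (g x) dir \<le> 0"
  proof -
    have "inner (g x) dir = - (Sign z c * c) / norm r" by (simp add: dir k_def c_def)
    then show ?thesis using S by simp
  qed
  have "inner r (H x r) \<le> - eps_H P / 2 * (norm r)\<^sup>2"
    using r(4) by (simp add: shifted_def inner_add_right power2_norm_eq_inner)
  then have "k\<^sup>2 * inner r (H x r) \<le> k\<^sup>2 * (- eps_H P / 2 * (norm r)\<^sup>2)" by (intro mult_left_mono) auto
  also have "\<dots> = - eps_H P / 2 * (k\<^sup>2 * (norm r)\<^sup>2)" by simp
  also have "k\<^sup>2 * inner r (H x r) = inner dir (H x dir)"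
    using x by (simp add: dir H_scale power2_eq_square)
  finally have curv: "inner dir (H x dir) \<le> - eps_H P / 2" by (simp only: k mult_1_right)
  define y where "y = x + (GREATEST \<alpha>. 0 < \<alpha> \<and>
      f (x + \<alpha> *\<^sub>R dir) \<le> f x + 1 / 2 * rho_C P * \<alpha>\<^sup>2 * inner dir (H x dir)) *\<^sub>R dir"
  show ?thesis
  proof (rule that)
    show "newton_mr_step P f g H z q x = Some y"
      using small by (simp add: newton_mr_step_def minres_call_def call y_def dir_def c_def Let_def)
    show "y \<in> V" unfolding y_def using x dV by (intro mem_V)
    show "f y \<le> f x - curvature_const * eps_H P ^ 3"
      unfolding y_def curvature_const_def
      by (rule negative_curvature_descent[OF f_min x dV rho(5,6) eps_H(1) d1 slope curv])
  qed
qed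

lemma small_gradient_SOL:
  assumes "norm (g x) \<le> eps_g P" "fst (minres (shifted P (H x)) q 0) = SOL"
  shows "newton_mr_step P f g H z q x = None"
  using assms by (cases "minres (shifted P (H x)) q 0") (simp add: newton_mr_step_def minres_call_def)

lemma curvature_const_pos: "0 < curvature_const"
  using rho L_pos by (simp add: curvature_const_def)

lemma newton_mr_step_mem:
  assumes x: "x \<in> V" and q: "q \<in> V" and z: "z = 1 \<or> z = -1" and y: "newton_mr_step P f g H z q x = Some y"
  shows "y \<in> V \<and> f y \<le> f x"
proof (cases "eps_g P < norm (g x)")
  case True
  obtain y' where "newton_mr_step P f g H z q x = Some y'" "y' \<in> V" "f y' \<le> f x"
    using large_gradient_step[OF x True zero_less_one] by blast
  then show ?thesis using y by simp
next
  case False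
  then have small: "norm (g x) \<le> eps_g P" by simp
  have npc: "fst (minres (shifted P (H x)) q 0) = NPC"
    using small_gradient_SOL[OF small] y flag.exhaust by (metis option.distinct(1))
  obtain y' where "newton_mr_step P f g H z q x = Some y'" "y' \<in> V" "f y' \<le> f x - curvature_const * eps_H P ^ 3"
    by (rule small_gradient_step[OF x small q z npc])
  moreover have "0 \<le> curvature_const * eps_H P ^ 3" using curvature_const_pos eps_H by simp
  ultimately show ?thesis using y by simp
qed

lemma hessian_bound_small_gradient:
  assumes x: "x \<in> V" and small: "norm (g x) \<le> eps_g P" and v: "v \<in> V"
  shows "norm (H x v) \<le> (R + 3 * L + 1) * norm v"
proof (rule hessian_bound_at_small_gradient[OF _ _ x _ v])
  show "norm (H y (g y)) \<le> R * norm (g y)" if y: "y \<in> V" for y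
  proof -
    interpret minres_run V "H y" "g y" using y by (rule minres_run_H)
    show ?thesis using power_mem_krylov[of 0 1 "g y"] by (intro krylov_upper[OF y, of _ 1]) simp
  qed
qed (use R eps_g small in auto)

end

section \<open>Measurability of the method\<close>

lemma measurable_continuous_on_closed:
  fixes h :: "'a::topological_space \<Rightarrow> 'b::topological_space"
  assumes V: "closed V" and h: "continuous_on V h"
    and x: "x \<in> borel_measurable N" "\<And>\<omega>. \<omega> \<in> space N \<Longrightarrow> x \<omega> \<in> V"
  shows "(\<lambda>\<omega>. h (x \<omega>)) \<in> borel_measurable N"
proof -
  have "x \<in> measurable N (restrict_space borel V)"
    using x by (intro measurable_restrict_space2) auto
  then show ?thesis by (rule measurable_compose) (rule borel_measurable_continuous_on_restrict[OF h])
qed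

text \<open>By compactness, a continuous function is positive on an interval if and only if it is bounded
  away from zero on a countable dense subset.\<close>

lemma sets_all_pos:
  fixes \<phi> :: "'a \<Rightarrow> real \<Rightarrow> real"
  assumes cont: "\<And>\<omega>. \<omega> \<in> space N \<Longrightarrow> continuous_on UNIV (\<phi> \<omega>)"
    and meas: "\<And>t. (\<lambda>\<omega>. \<phi> \<omega> t) \<in> borel_measurable N"
  shows "{\<omega> \<in> space N. \<forall>t\<in>{a..b}. 0 < \<phi> \<omega> t} \<in> sets N"
proof -
  obtain D where D: "countable D" "D \<subseteq> {a..b}" "{a..b} \<subseteq> closure D" using separable by blast
  have "(\<forall>t\<in>{a..b}. 0 < \<phi> \<omega> t) \<longleftrightarrow> (\<exists>n::nat. \<forall>t\<in>D. 1 / Suc n \<le> \<phi> \<omega> t)" if \<omega>: "\<omega> \<in> space N" for \<omega>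
  proof
    assume pos: "\<forall>t\<in>{a..b}. 0 < \<phi> \<omega> t"
    show "\<exists>n::nat. \<forall>t\<in>D. 1 / Suc n \<le> \<phi> \<omega> t"
    proof (cases "{a..b} = {}")
      case False
      have "continuous_on {a..b} (\<phi> \<omega>)" using cont[OF \<omega>] by (rule continuous_on_subset) auto
      then obtain m where m: "m \<in> {a..b}" "\<And>t. t \<in> {a..b} \<Longrightarrow> \<phi> \<omega> m \<le> \<phi> \<omega> t"
        using continuous_attains_inf[OF compact_Icc False] by blast
      then obtain n where "1 / Suc n < \<phi> \<omega> m" using pos nat_approx_posE by blast
      then show ?thesis using m D by (meson less_imp_le order.trans subset_iff)
    qed (use D in auto)
  next
    assume "\<exists>n::nat. \<forall>t\<in>D. 1 / Suc n \<le> \<phi> \<omega> t"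
    then obtain n :: nat where n: "\<And>t. t \<in> D \<Longrightarrow> 1 / Suc n \<le> \<phi> \<omega> t" by blast
    have "closed {t. 1 / Suc n \<le> \<phi> \<omega> t}" using cont[OF \<omega>] by (intro closed_Collect_le) auto
    then have "closure D \<subseteq> {t. 1 / Suc n \<le> \<phi> \<omega> t}" using n by (intro closure_minimal) auto
    then have "1 / Suc n \<le> \<phi> \<omega> t" if "t \<in> {a..b}" for t using D(3) that by blast
    moreover have "0 < 1 / real (Suc n)" by simp
    ultimately show "\<forall>t\<in>{a..b}. 0 < \<phi> \<omega> t" by (meson less_le_trans)
  qed
  then have "{\<omega> \<in> space N. \<forall>t\<in>{a..b}. 0 < \<phi> \<omega> t} = {\<omega> \<in> space N. \<exists>n::nat. \<forall>t\<in>D. 1 / Suc n \<le> \<phi> \<omega> t}"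
    by blast
  moreover have "{\<omega> \<in> space N. \<exists>n::nat. \<forall>t\<in>D. 1 / Suc n \<le> \<phi> \<omega> t} \<in> sets N"
    using meas D(1) by measurable
  ultimately show ?thesis by simp
qed

text \<open>Whether the greatest element exists, and whether it is at least \<open>a\<close>, can be read off from the
  sets on which \<open>\<phi>\<close> is positive on an interval.  Where it does not exist, the value of the
  description does not depend on \<open>\<omega>\<close>.\<close>

lemma measurable_greatest_step:
  fixes \<phi> :: "'a \<Rightarrow> real \<Rightarrow> real"
  assumes cont: "\<And>\<omega>. \<omega> \<in> space N \<Longrightarrow> continuous_on UNIV (\<phi> \<omega>)"
    and meas: "\<And>t. (\<lambda>\<omega>. \<phi> \<omega> t) \<in> borel_measurable N"
  shows "(\<lambda>\<omega>. GREATEST t. 0 < t \<and> \<phi> \<omega> t \<le> 0) \<in> borel_measurable N"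
proof -
  define m where "m \<omega> = (GREATEST t. 0 < t \<and> \<phi> \<omega> t \<le> 0)" for \<omega>
  define pos where "pos \<omega> a b \<longleftrightarrow> (\<forall>t\<in>{a..b}. 0 < \<phi> \<omega> t)" for \<omega> and a b :: real
  define ex where "ex \<omega> \<longleftrightarrow> (\<exists>i::nat. \<not> pos \<omega> (1 / Suc i) (Suc i)) \<and> (\<exists>i::nat. \<forall>j::nat. pos \<omega> i j)" for \<omega>
  define c0 where "c0 = (THE x::real. False)"
  have [measurable]: "Measurable.pred N (\<lambda>\<omega>. pos \<omega> a b)" for a b
    using sets_all_pos[OF assms] by (simp add: pos_def pred_def)
  have [measurable]: "Measurable.pred N ex" unfolding ex_def by measurable
  have m_ex: "0 < m \<omega> \<and> \<phi> \<omega> (m \<omega>) \<le> 0 \<and> (\<forall>t. 0 < t \<and> \<phi> \<omega> t \<le> 0 \<longrightarrow> t \<le> m \<omega>)"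
    if \<omega>: "\<omega> \<in> space N" and e: "ex \<omega>" for \<omega>
  proof -
    obtain i :: nat and t where t: "t \<in> {1 / Suc i .. Suc i}" "\<phi> \<omega> t \<le> 0"
      using e by (auto simp: ex_def pos_def not_less)
    have t0: "0 < t" using t(1) by (metis atLeastAtMost_iff less_le_trans of_nat_0_less_iff zero_less_Suc zero_less_divide_1_iff)
    obtain k :: nat where k: "\<And>j::nat. pos \<omega> k j" using e by (auto simp: ex_def)
    have bound: "s \<le> k" if "\<phi> \<omega> s \<le> 0" for s
    proof (rule ccontr)
      assume "\<not> s \<le> real k"
      moreover obtain j :: nat where "s \<le> j" using real_arch_simple by blast
      ultimately have "0 < \<phi> \<omega> s" using k[of j] by (auto simp: pos_def)
      then show False using that by simp
    qed
    note g = greatest_step[OF cont[OF \<omega>] t0 t(2), of "real k", folded m_def]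
    have le: "s \<le> m \<omega>" if s: "0 < s" "\<phi> \<omega> s \<le> 0" for s
      using greatest_step(2)[OF cont[OF \<omega>] s, of "real k"] bound by (simp add: m_def)
    show ?thesis using g bound t0 le by force
  qed
  have m_nex: "m \<omega> = c0" if \<omega>: "\<omega> \<in> space N" and e: "\<not> ex \<omega>" for \<omega>
  proof -
    have nex: "\<not> (0 < x \<and> \<phi> \<omega> x \<le> 0 \<and> (\<forall>y. 0 < y \<and> \<phi> \<omega> y \<le> 0 \<longrightarrow> y \<le> x))" for x
    proof
      assume x: "0 < x \<and> \<phi> \<omega> x \<le> 0 \<and> (\<forall>y. 0 < y \<and> \<phi> \<omega> y \<le> 0 \<longrightarrow> y \<le> x)"
      obtain i where i: "1 / Suc i < x" using x nat_approx_posE by blast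
      obtain j :: nat where j: "x \<le> j" using real_arch_simple by blast
      have "1 / Suc (max i j) \<le> x"
        using i by (intro order.trans[OF _ less_imp_le[OF i]] divide_left_mono) auto
      moreover have "x \<le> Suc (max i j)" using j by linarith
      ultimately have "\<not> pos \<omega> (1 / Suc (max i j)) (Suc (max i j))"
        using x by (auto simp: pos_def not_less intro!: bexI[of _ x])
      moreover obtain k :: nat where k: "x < k" using reals_Archimedean2 by blast
      have "pos \<omega> k l" for l :: nat
        unfolding pos_def
      proof
        fix t assume "t \<in> {real k..real l}"
        then have "x < t" "0 < t" using k x by auto
        then show "0 < \<phi> \<omega> t" using x by (meson not_less)
      qed
      ultimately show False using e by (auto simp: ex_def)
    qed
    have "(\<lambda>x. (0 < x \<and> \<phi> \<omega> x \<le> 0) \<and> (\<forall>y. 0 < y \<and> \<phi> \<omega> y \<le> 0 \<longrightarrow> y \<le> x)) = (\<lambda>x. False)"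
    proof
      fix x show "((0 < x \<and> \<phi> \<omega> x \<le> 0) \<and> (\<forall>y. 0 < y \<and> \<phi> \<omega> y \<le> 0 \<longrightarrow> y \<le> x)) = False"
        using nex[of x] by simp
    qed
    then show ?thesis unfolding m_def Greatest_def c0_def by (rule arg_cong[where f = The])
  qed
  have "m \<in> borel_measurable N"
  proof (subst borel_measurable_iff_ge, intro allI)
    fix a :: real
    have "{\<omega> \<in> space N. a \<le> m \<omega>} =
      {\<omega> \<in> space N. if ex \<omega> then a \<le> 0 \<or> (\<exists>j::nat. \<not> pos \<omega> a j) else a \<le> c0}"
    proof (intro Collect_cong conj_cong refl)
      fix \<omega> assume \<omega>: "\<omega> \<in> space N"
      show "a \<le> m \<omega> \<longleftrightarrow> (if ex \<omega> then a \<le> 0 \<or> (\<exists>j::nat. \<not> pos \<omega> a j) else a \<le> c0)"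
      proof (cases "ex \<omega>")
        case True
        note m = m_ex[OF \<omega> True]
        show ?thesis
        proof (cases "a \<le> 0")
          case False
          have "a \<le> m \<omega> \<longleftrightarrow> (\<exists>j::nat. \<not> pos \<omega> a j)"
          proof
            assume "a \<le> m \<omega>"
            moreover obtain j :: nat where "m \<omega> \<le> j" using real_arch_simple by blast
            ultimately have "m \<omega> \<in> {a..real j}" by simp
            moreover have "\<not> 0 < \<phi> \<omega> (m \<omega>)" using m by (simp add: not_less)
            ultimately show "\<exists>j::nat. \<not> pos \<omega> a j" unfolding pos_def by blast
          next
            assume "\<exists>j::nat. \<not> pos \<omega> a j"
            then obtain t where "a \<le> t" "\<phi> \<omega> t \<le> 0" by (auto simp: pos_def not_less)
            moreover from this have "0 < t" using False by linarith
            ultimately have "t \<le> m \<omega>" using m by blast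
            then show "a \<le> m \<omega>" using \<open>a \<le> t\<close> by linarith
          qed
          then show ?thesis using True False by simp
        qed (use True m in simp)
      qed (use m_nex[OF \<omega>] in simp)
    qed
    also have "\<dots> \<in> sets N" by measurable
    finally show "{\<omega> \<in> space N. a \<le> m \<omega>} \<in> sets N" .
  qed
  then show ?thesis by (simp add: m_def[abs_def])
qed

text \<open>A measurable family of operators on the subspace \<open>V\<close>: it maps measurable vector fields to
  measurable vector fields.\<close>

definition measurable_operator ::
  "'b measure \<Rightarrow> rseq set \<Rightarrow> ('b \<Rightarrow> rseq \<Rightarrow> rseq) \<Rightarrow> bool" where
  "measurable_operator N V A \<longleftrightarrow>
     (\<forall>v \<in> borel_measurable N. (\<forall>\<omega>\<in>space N. v \<omega> \<in> V) \<longrightarrow> (\<lambda>\<omega>. A \<omega> (v \<omega>)) \<in> borel_measurable N)"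

lemma measurable_operatorD:
  assumes "measurable_operator N V A" "v \<in> borel_measurable N" "\<And>\<omega>. \<omega> \<in> space N \<Longrightarrow> v \<omega> \<in> V"
  shows "(\<lambda>\<omega>. A \<omega> (v \<omega>)) \<in> borel_measurable N"
  using assms unfolding measurable_operator_def by blast

context
  fixes N :: "'b measure" and V :: "rseq set" and A :: "'b \<Rightarrow> rseq \<Rightarrow> rseq" and b :: "'b \<Rightarrow> rseq"
    and \<eta> :: real
  assumes A: "measurable_operator N V A" and b: "b \<in> borel_measurable N"
    and run: "\<And>\<omega>. \<omega> \<in> space N \<Longrightarrow> minres_run V (A \<omega>) (b \<omega>)" and \<eta>: "0 \<le> \<eta>"
begin

lemmas measurable_A = measurable_operatorD[OF A]

lemma measurable_cr:
  "(\<lambda>\<omega>. cr_s (A \<omega>) (b \<omega>) t) \<in> borel_measurable N \<and> (\<lambda>\<omega>. cr_r (A \<omega>) (b \<omega>) t) \<in> borel_measurable N \<and>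
   (\<lambda>\<omega>. cr_p (A \<omega>) (b \<omega>) t) \<in> borel_measurable N"
proof (induction t)
  case 0
  show ?case using b by (simp add: cr_0)
next
  case (Suc t)
  then have [measurable]: "(\<lambda>\<omega>. cr_s (A \<omega>) (b \<omega>) t) \<in> borel_measurable N"
    "(\<lambda>\<omega>. cr_r (A \<omega>) (b \<omega>) t) \<in> borel_measurable N" "(\<lambda>\<omega>. cr_p (A \<omega>) (b \<omega>) t) \<in> borel_measurable N"
    by auto
  have [measurable]: "(\<lambda>\<omega>. A \<omega> (cr_p (A \<omega>) (b \<omega>) t)) \<in> borel_measurable N"
    using minres_run.cr_mem(3)[OF run] by (intro measurable_A) auto
  have r' [measurable]: "(\<lambda>\<omega>. cr_r (A \<omega>) (b \<omega>) (Suc t)) \<in> borel_measurable N"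
    unfolding cr_Suc by measurable
  have [measurable]: "(\<lambda>\<omega>. A \<omega> (cr_r (A \<omega>) (b \<omega>) (Suc t))) \<in> borel_measurable N"
    using minres_run.cr_mem(2)[OF run] by (intro measurable_A) auto
  have "(\<lambda>\<omega>. cr_s (A \<omega>) (b \<omega>) (Suc t)) \<in> borel_measurable N" unfolding cr_Suc by measurable
  moreover have "(\<lambda>\<omega>. cr_p (A \<omega>) (b \<omega>) (Suc t)) \<in> borel_measurable N" unfolding cr_Suc(3) by measurable
  ultimately show ?case using r' by blast
qed

lemma shows measurable_cr_s [measurable]: "(\<lambda>\<omega>. cr_s (A \<omega>) (b \<omega>) t) \<in> borel_measurable N"
  and measurable_cr_r [measurable]: "(\<lambda>\<omega>. cr_r (A \<omega>) (b \<omega>) t) \<in> borel_measurable N"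
  using measurable_cr by auto

lemma shows measurable_A_cr_s [measurable]: "(\<lambda>\<omega>. A \<omega> (cr_s (A \<omega>) (b \<omega>) t)) \<in> borel_measurable N"
  and measurable_A_cr_r [measurable]: "(\<lambda>\<omega>. A \<omega> (cr_r (A \<omega>) (b \<omega>) t)) \<in> borel_measurable N"
  using minres_run.cr_mem[OF run] by (auto intro!: measurable_A measurable_cr_s measurable_cr_r)

lemma measurable_cr_npc [measurable]: "Measurable.pred N (\<lambda>\<omega>. cr_npc (A \<omega>) (b \<omega>) t)"
  unfolding cr_npc_def by measurable

lemma measurable_cr_sol [measurable]: "Measurable.pred N (\<lambda>\<omega>. cr_sol (A \<omega>) (b \<omega>) \<eta> t)"
  unfolding cr_sol_def by measurable

lemma minres_eq_cr:
  assumes "\<omega> \<in> space N"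
  shows "minres_iters (A \<omega>) (b \<omega>) \<eta> = (LEAST t. 1 \<le> t \<and> (cr_npc (A \<omega>) (b \<omega>) t \<or> cr_sol (A \<omega>) (b \<omega>) \<eta> t))"
    "minres (A \<omega>) (b \<omega>) \<eta> =
      (if cr_npc (A \<omega>) (b \<omega>) (minres_iters (A \<omega>) (b \<omega>) \<eta>)
       then (NPC, cr_r (A \<omega>) (b \<omega>) (minres_iters (A \<omega>) (b \<omega>) \<eta> - 1))
       else (SOL, cr_s (A \<omega>) (b \<omega>) (minres_iters (A \<omega>) (b \<omega>) \<eta> - 1)))"
proof -
  interpret minres_run V "A \<omega>" "b \<omega>" by (rule run[OF assms])
  obtain E where E: "finite E" "V \<subseteq> span E" using fin_dim by (auto simp: fin_dim_def)
  show "minres_iters (A \<omega>) (b \<omega>) \<eta> = (LEAST t. 1 \<le> t \<and> (cr_npc (A \<omega>) (b \<omega>) t \<or> cr_sol (A \<omega>) (b \<omega>) \<eta> t))"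
    "minres (A \<omega>) (b \<omega>) \<eta> =
      (if cr_npc (A \<omega>) (b \<omega>) (minres_iters (A \<omega>) (b \<omega>) \<eta>)
       then (NPC, cr_r (A \<omega>) (b \<omega>) (minres_iters (A \<omega>) (b \<omega>) \<eta> - 1))
       else (SOL, cr_s (A \<omega>) (b \<omega>) (minres_iters (A \<omega>) (b \<omega>) \<eta> - 1)))"
    by (rule minres_iters_props[OF \<eta> E])+
qed

lemma measurable_minres_iters [measurable]:
  "(\<lambda>\<omega>. minres_iters (A \<omega>) (b \<omega>) \<eta>) \<in> measurable N (count_space UNIV)"
proof -
  have "(\<lambda>\<omega>. LEAST t. 1 \<le> t \<and> (cr_npc (A \<omega>) (b \<omega>) t \<or> cr_sol (A \<omega>) (b \<omega>) \<eta> t)) \<in> measurable N (count_space UNIV)"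
    by measurable
  then show ?thesis using minres_eq_cr(1) by (subst measurable_cong) auto
qed

lemma measurable_minres_flag [measurable]:
  "Measurable.pred N (\<lambda>\<omega>. fst (minres (A \<omega>) (b \<omega>) \<eta>) = NPC)"
proof -
  have "Measurable.pred N (\<lambda>\<omega>. cr_npc (A \<omega>) (b \<omega>) (minres_iters (A \<omega>) (b \<omega>) \<eta>))"
    by (rule measurable_compose_countable[OF measurable_cr_npc measurable_minres_iters])
  then show ?thesis by (rule measurable_cong[THEN iffD2, rotated]) (simp add: minres_eq_cr(2))
qed

lemma measurable_minres_vector [measurable]:
  "(\<lambda>\<omega>. snd (minres (A \<omega>) (b \<omega>) \<eta>)) \<in> borel_measurable N"
proof -
  have [measurable]: "Measurable.pred N (\<lambda>\<omega>. cr_npc (A \<omega>) (b \<omega>) (minres_iters (A \<omega>) (b \<omega>) \<eta>))"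
    by (rule measurable_compose_countable[OF measurable_cr_npc measurable_minres_iters])
  have [measurable]: "(\<lambda>\<omega>. minres_iters (A \<omega>) (b \<omega>) \<eta> - 1) \<in> measurable N (count_space UNIV)"
    by (rule measurable_compose[OF measurable_minres_iters]) simp
  have [measurable]: "(\<lambda>\<omega>. cr_r (A \<omega>) (b \<omega>) (minres_iters (A \<omega>) (b \<omega>) \<eta> - 1)) \<in> borel_measurable N"
    by (rule measurable_compose_countable[OF measurable_cr_r]) measurable
  have [measurable]: "(\<lambda>\<omega>. cr_s (A \<omega>) (b \<omega>) (minres_iters (A \<omega>) (b \<omega>) \<eta> - 1)) \<in> borel_measurable N"
    by (rule measurable_compose_countable[OF measurable_cr_s]) measurable
  have "(\<lambda>\<omega>. if cr_npc (A \<omega>) (b \<omega>) (minres_iters (A \<omega>) (b \<omega>) \<eta>)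
      then cr_r (A \<omega>) (b \<omega>) (minres_iters (A \<omega>) (b \<omega>) \<eta> - 1)
      else cr_s (A \<omega>) (b \<omega>) (minres_iters (A \<omega>) (b \<omega>) \<eta> - 1)) \<in> borel_measurable N"
    by measurable
  then show ?thesis by (rule measurable_cong[THEN iffD2, rotated]) (simp add: minres_eq_cr(2))
qed

lemma minres_vector_mem: "\<omega> \<in> space N \<Longrightarrow> snd (minres (A \<omega>) (b \<omega>) \<eta>) \<in> V"
  using minres_run.cr_mem[OF run] by (subst minres_eq_cr(2)) auto

end

declare measurable_cr_s [measurable del] measurable_cr_r [measurable del]
  measurable_A_cr_s [measurable del] measurable_A_cr_r [measurable del]
  measurable_cr_npc [measurable del] measurable_cr_sol [measurable del]
  measurable_minres_iters [measurable del] measurable_minres_flag [measurable del]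
  measurable_minres_vector [measurable del]

locale newton_mr_Rn = newton_mr_problem "Rn d" f g H L P \<sigma> R f_min
  for d :: nat and f g H L P \<sigma> R f_min +
  assumes d: "1 \<le> d"
begin

abbreviation "V \<equiv> Rn d"

text \<open>The iteration as a total function: where the method terminates, the point stays.\<close>

definition next_point :: "real \<Rightarrow> rseq \<Rightarrow> rseq \<Rightarrow> rseq" where
  "next_point z q x = (case newton_mr_step P f g H z q x of None \<Rightarrow> x | Some y \<Rightarrow> y)"

lemma next_point_eq:
  "next_point z q x =
     (if eps_g P < norm (g x) then
        (let r = snd (minres (H x) (g x) tol) in
         if fst (minres (H x) (g x) tol) = NPC then
           x + (GREATEST t. 0 < t \<and> f (x + t *\<^sub>R r) - (f x + rho_N P * t * inner (g x) r) \<le> 0) *\<^sub>R r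
         else
           x + (GREATEST t. 0 < t \<and>
              max (t - 1) (f (x + t *\<^sub>R r) - (f x + rho_S P * t * inner (g x) r)) \<le> 0) *\<^sub>R r)
      else if fst (minres (shifted P (H x)) q 0) = NPC then
        (let r = snd (minres (shifted P (H x)) q 0);
             dir = - (Sign z (inner (g x) r) *\<^sub>R (r /\<^sub>R norm r)) in
         x + (GREATEST t. 0 < t \<and>
            f (x + t *\<^sub>R dir) - (f x + 1 / 2 * rho_C P * t\<^sup>2 * inner dir (H x dir)) \<le> 0) *\<^sub>R dir)
      else x)"
  by (cases "fst (minres (H x) (g x) tol)"; cases "fst (minres (shifted P (H x)) q 0)")
     (auto simp: next_point_def newton_mr_step_def minres_call_def Let_def split: prod.splits)

lemma next_point_mem:
  assumes "x \<in> V" "q \<in> V" "z = 1 \<or> z = -1"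
  shows "next_point z q x \<in> V" "f (next_point z q x) \<le> f x"
  using newton_mr_step_mem[OF assms] assms(1) by (auto simp: next_point_def split: option.splits)

lemma measurable_operator_H:
  assumes x: "x \<in> borel_measurable N" "\<And>\<omega>. \<omega> \<in> space N \<Longrightarrow> x \<omega> \<in> V"
  shows "measurable_operator N V (\<lambda>\<omega>. H (x \<omega>))"
  unfolding measurable_operator_def
proof (intro ballI impI)
  fix v assume v [measurable]: "v \<in> borel_measurable N" and vV: "\<forall>\<omega>\<in>space N. v \<omega> \<in> V"
  have Hi: "(\<lambda>\<omega>. H (x \<omega>) (axis_seq i)) \<in> borel_measurable N" if "i < d" for i
    using H_continuous[OF axis_seq_in_Rn[OF that]] x by (rule measurable_continuous_on_closed[OF closed_Rn])
  have "(\<lambda>\<omega>. \<Sum>i<d. inner (axis_seq i) (v \<omega>) *\<^sub>R H (x \<omega>) (axis_seq i)) \<in> borel_measurable N"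
    by (intro borel_measurable_sum borel_measurable_scaleR borel_measurable_inner borel_measurable_const v Hi) simp
  moreover have "H (x \<omega>) (v \<omega>) = (\<Sum>i<d. inner (axis_seq i) (v \<omega>) *\<^sub>R H (x \<omega>) (axis_seq i))"
    if \<omega>: "\<omega> \<in> space N" for \<omega>
  proof -
    have "H (x \<omega>) (v \<omega>) = H (x \<omega>) (\<Sum>i<d. coord (v \<omega>) i *\<^sub>R axis_seq i)"
      using Rn_expand[of "v \<omega>" d] vV \<omega> by simp
    also have "\<dots> = (\<Sum>i<d. coord (v \<omega>) i *\<^sub>R H (x \<omega>) (axis_seq i))"
      using bounded_linear.linear[OF H_bounded_linear[OF x(2)[OF \<omega>]]] by (simp add: linear_sum linear_scale)
    finally show ?thesis by simp
  qed
  ultimately show "(\<lambda>\<omega>. H (x \<omega>) (v \<omega>)) \<in> borel_measurable N"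
    by (subst measurable_cong) auto
qed

lemma measurable_operator_shifted:
  assumes "measurable_operator N V A"
  shows "measurable_operator N V (\<lambda>\<omega>. shifted P (A \<omega>))"
  unfolding measurable_operator_def
proof (intro ballI impI)
  fix v assume v [measurable]: "v \<in> borel_measurable N" and vV: "\<forall>\<omega>\<in>space N. v \<omega> \<in> V"
  have [measurable]: "(\<lambda>\<omega>. A \<omega> (v \<omega>)) \<in> borel_measurable N"
    using vV by (intro measurable_operatorD[OF assms v]) blast
  show "(\<lambda>\<omega>. shifted P (A \<omega>) (v \<omega>)) \<in> borel_measurable N" unfolding shifted_def by measurable
qed

context
  fixes N :: "'b measure" and x q :: "'b \<Rightarrow> rseq"
  assumes x [measurable]: "x \<in> borel_measurable N" and q [measurable]: "q \<in> borel_measurable N"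
    and xV: "\<And>\<omega>. \<omega> \<in> space N \<Longrightarrow> x \<omega> \<in> V" and qV: "\<And>\<omega>. \<omega> \<in> space N \<Longrightarrow> q \<omega> \<in> V"
begin

lemma measurable_g [measurable]: "(\<lambda>\<omega>. g (x \<omega>)) \<in> borel_measurable N"
  by (rule measurable_continuous_on_closed[OF closed_Rn g_continuous x xV])

lemma measurable_f_shift:
  assumes v [measurable]: "v \<in> borel_measurable N" and vV: "\<And>\<omega>. \<omega> \<in> space N \<Longrightarrow> v \<omega> \<in> V"
  shows "(\<lambda>\<omega>. f (x \<omega> + t *\<^sub>R v \<omega>)) \<in> borel_measurable N"
  using xV vV mem_V by (intro measurable_continuous_on_closed[OF closed_Rn f_continuous]) auto

lemma measurable_f [measurable]: "(\<lambda>\<omega>. f (x \<omega>)) \<in> borel_measurable N"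
  by (rule measurable_continuous_on_closed[OF closed_Rn f_continuous x xV])

lemmas op_H = measurable_operator_H[OF x xV]
lemmas op_shifted = measurable_operator_shifted[OF op_H]

lemma measurable_npc_flag: "Measurable.pred N (\<lambda>\<omega>. fst (minres (shifted P (H (x \<omega>))) (q \<omega>) 0) = NPC)"
  by (rule measurable_minres_flag[OF op_shifted q]) (auto intro: minres_run_shifted xV qV)

lemma measurable_npc_cost: "(\<lambda>\<omega>. npc_cost (shifted P (H (x \<omega>))) (q \<omega>)) \<in> borel_measurable N"
proof -
  have [measurable]: "(\<lambda>\<omega>. minres_iters (shifted P (H (x \<omega>))) (q \<omega>) 0) \<in> measurable N (count_space UNIV)"
    by (rule measurable_minres_iters[OF op_shifted q]) (auto intro: minres_run_shifted xV qV)
  note measurable_npc_flag [measurable]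
  show ?thesis unfolding npc_cost_def by measurable
qed

lemma measurable_next_point: "(\<lambda>\<omega>. next_point z (q \<omega>) (x \<omega>)) \<in> borel_measurable N"
proof -
  define r1 where "r1 \<omega> = snd (minres (H (x \<omega>)) (g (x \<omega>)) tol)" for \<omega>
  define r2 where "r2 \<omega> = snd (minres (shifted P (H (x \<omega>))) (q \<omega>) 0)" for \<omega>
  define dir where "dir \<omega> = - (Sign z (inner (g (x \<omega>)) (r2 \<omega>)) *\<^sub>R (r2 \<omega> /\<^sub>R norm (r2 \<omega>)))" for \<omega>
  note run_H = minres_run_H[OF xV] and run_S = minres_run_shifted[OF xV qV]
  have r1 [measurable]: "r1 \<in> borel_measurable N"
    unfolding r1_def[abs_def] using tol_pos by (intro measurable_minres_vector[OF op_H measurable_g run_H]) auto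
  have r1V: "r1 \<omega> \<in> V" if "\<omega> \<in> space N" for \<omega>
    unfolding r1_def using tol_pos that by (intro minres_vector_mem[OF op_H measurable_g run_H]) auto
  have r2 [measurable]: "r2 \<in> borel_measurable N"
    unfolding r2_def[abs_def] by (intro measurable_minres_vector[OF op_shifted q run_S]) auto
  have r2V: "r2 \<omega> \<in> V" if "\<omega> \<in> space N" for \<omega>
    unfolding r2_def using that by (intro minres_vector_mem[OF op_shifted q run_S]) auto
  have [measurable]: "Measurable.pred N (\<lambda>\<omega>. fst (minres (H (x \<omega>)) (g (x \<omega>)) tol) = NPC)"
    using tol_pos by (intro measurable_minres_flag[OF op_H measurable_g run_H]) auto
  note measurable_npc_flag [measurable]
  have dir [measurable]: "dir \<in> borel_measurable N"
    unfolding dir_def[abs_def] Sign_def sgn_real_def by measurable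
  have dirV: "dir \<omega> \<in> V" if "\<omega> \<in> space N" for \<omega>
    unfolding dir_def using r2V[OF that] subspace by (intro subspace_neg subspace_scale)
  have [measurable]: "(\<lambda>\<omega>. H (x \<omega>) (dir \<omega>)) \<in> borel_measurable N"
    by (rule measurable_operatorD[OF op_H dir dirV])
  note shift [measurable] = measurable_f_shift[OF r1 r1V] measurable_f_shift[OF dir dirV]
  define t1 where "t1 \<omega> = (GREATEST t. 0 < t \<and>
    f (x \<omega> + t *\<^sub>R r1 \<omega>) - (f (x \<omega>) + rho_N P * t * inner (g (x \<omega>)) (r1 \<omega>)) \<le> 0)" for \<omega>
  define t2 where "t2 \<omega> = (GREATEST t. 0 < t \<and>
    max (t - 1) (f (x \<omega> + t *\<^sub>R r1 \<omega>) - (f (x \<omega>) + rho_S P * t * inner (g (x \<omega>)) (r1 \<omega>))) \<le> 0)" for \<omega>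
  define t3 where "t3 \<omega> = (GREATEST t. 0 < t \<and>
    f (x \<omega> + t *\<^sub>R dir \<omega>) - (f (x \<omega>) + 1 / 2 * rho_C P * t\<^sup>2 * inner (dir \<omega>) (H (x \<omega>) (dir \<omega>))) \<le> 0)" for \<omega>
  have [measurable]: "t1 \<in> borel_measurable N" unfolding t1_def[abs_def]
    by (rule measurable_greatest_step, intro continuous_intros f_line_continuous xV r1V) measurable
  have [measurable]: "t2 \<in> borel_measurable N" unfolding t2_def[abs_def]
    by (rule measurable_greatest_step, intro continuous_intros f_line_continuous xV r1V) measurable
  have [measurable]: "t3 \<in> borel_measurable N" unfolding t3_def[abs_def]
    by (rule measurable_greatest_step, intro continuous_intros f_line_continuous xV dirV) measurable
  have "(\<lambda>\<omega>. if eps_g P < norm (g (x \<omega>)) then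
        if fst (minres (H (x \<omega>)) (g (x \<omega>)) tol) = NPC then x \<omega> + t1 \<omega> *\<^sub>R r1 \<omega> else x \<omega> + t2 \<omega> *\<^sub>R r1 \<omega>
      else if fst (minres (shifted P (H (x \<omega>))) (q \<omega>) 0) = NPC then x \<omega> + t3 \<omega> *\<^sub>R dir \<omega> else x \<omega>)
    \<in> borel_measurable N"
    by measurable
  then show ?thesis
    unfolding next_point_eq t1_def t2_def t3_def dir_def r1_def r2_def Let_def .
qed

end

declare measurable_g [measurable del] measurable_f [measurable del]

definition needs_curvature :: "rseq \<Rightarrow> bool" where
  "needs_curvature x \<longleftrightarrow> norm (g x) \<le> eps_g P \<and> \<not> second_order_optimal V P g H x"

lemma V_nontrivial: "V \<noteq> {0}"
proof -
  have "axis_seq 0 \<in> V" using d by (intro axis_seq_in_Rn) simp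
  moreover have "axis_seq 0 \<noteq> 0" using norm_axis_seq[of 0] by fastforce
  ultimately show ?thesis by blast
qed

lemma measurable_needs_curvature:
  assumes x [measurable]: "x \<in> borel_measurable N" and xV: "\<And>\<omega>. \<omega> \<in> space N \<Longrightarrow> x \<omega> \<in> V"
  shows "Measurable.pred N (\<lambda>\<omega>. needs_curvature (x \<omega>))"
proof -
  define S where "S = (\<Inter>v\<in>V. {x\<in>V. - eps_H P * inner v v \<le> inner v (H x v)})"
  have "closed S" unfolding S_def
    by (intro closed_INT ballI continuous_on_closed_Collect_le continuous_intros H_continuous closed_Rn)
  then have "S \<in> sets borel" by simp
  from measurable_sets[OF x this] have [measurable]: "Measurable.pred N (\<lambda>\<omega>. x \<omega> \<in> S)"
    by (simp add: pred_def vimage_def Int_def conj_commute)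
  have gm: "(\<lambda>\<omega>. g (x \<omega>)) \<in> borel_measurable N" by (rule measurable_g[OF x x xV xV])
  have [measurable]: "Measurable.pred N (\<lambda>\<omega>. norm (g (x \<omega>)) \<le> eps_g P)"
    using borel_measurable_le[OF measurable_compose[OF gm borel_measurable_norm] borel_measurable_const] by (simp add: pred_def)
  have eq: "needs_curvature (x \<omega>) \<longleftrightarrow> norm (g (x \<omega>)) \<le> eps_g P \<and> \<not> x \<omega> \<in> S" if \<omega>: "\<omega> \<in> space N" for \<omega>
  proof -
    interpret symmetric_operator V "H (x \<omega>)" using xV[OF \<omega>] by (rule symmetric_operator_H)
    show ?thesis using xV[OF \<omega>] lambda_min_ge_iff[OF V_nontrivial, of "- eps_H P"] subspace_0[OF subspace]
      by (auto simp: needs_curvature_def second_order_optimal_def S_def)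
  qed
  have "Measurable.pred N (\<lambda>\<omega>. norm (g (x \<omega>)) \<le> eps_g P \<and> \<not> x \<omega> \<in> S)"
    by (intro pred_intros_logic) fact+
  then show ?thesis by (rule measurable_cong[THEN iffD2, rotated]) (rule eq)
qed

section \<open>The expected cost of finding negative curvature\<close>

text \<open>Chosen such that \<open>M sinh\<^sup>2 overlap_rate \<le> \<epsilon>\<^sub>H / 2\<close> for the bound \<open>M = R + 3L + 2\<close> on the norm of
  the shifted Hessian.\<close>

definition overlap_rate :: real where
  "overlap_rate = sqrt (eps_H P / (8 * (R + 3 * L + 2)))"

definition npc_budget :: real where
  "npc_budget = 6 * (1 + ln d) / overlap_rate"

lemma overlap_rate: "0 < overlap_rate" "overlap_rate \<le> 1"
proof -
  show "0 < overlap_rate" using eps_H R L_pos by (simp add: overlap_rate_def)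
  have "eps_H P \<le> 8 * (R + 3 * L + 2)"     using eps_H(2) R(1) L_pos by (intro order.trans[OF eps_H(2)]) simp
  then show "overlap_rate \<le> 1" using R L_pos by (simp add: overlap_rate_def)
qed

lemma npc_budget_nonneg: "0 \<le> npc_budget"
  using d overlap_rate by (simp add: npc_budget_def)

lemma expected_cost_needs_curvature:
  assumes x: "x \<in> V" and need: "needs_curvature x"
  shows "(\<integral>\<^sup>+q. npc_cost (shifted P (H x)) q \<partial>sphere_uniform d) \<le> ennreal npc_budget"
proof -
  interpret A: symmetric_operator V "H x" using x by (rule symmetric_operator_H)
  define M where "M = R + 3 * L + 2"
  have M: "0 < M" using R L_pos by (simp add: M_def)
  have small: "norm (g x) \<le> eps_g P" and "lambda_min V (H x) < - eps_H P"
    using need by (auto simp: needs_curvature_def second_order_optimal_def)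
  obtain B where B: "A.is_eigenbasis B" by (rule A.ex_eigenbasis)
  then have "finite (eigenvalues V (H x))" "eigenvalues V (H x) \<noteq> {}"
    using A.eigenvalues_eq[OF B] V_nontrivial by (auto simp: A.is_eigenbasis_def)
  then have "lambda_min V (H x) \<in> eigenvalues V (H x)" unfolding lambda_min_def by (rule Min_in)
  with \<open>lambda_min V (H x) < _\<close> obtain l v
    where v: "v \<in> V" "v \<noteq> 0" "H x v = l *\<^sub>R v" and l: "l < - eps_H P"
    by (auto simp: eigenvalues_def eigenspace_def)
  show ?thesis unfolding npc_budget_def
  proof (rule expected_npc_cost[OF d symmetric_operator_shifted[OF x] M _ overlap_rate])
    show "norm (shifted P (H x) w) \<le> M * norm w" if w: "w \<in> V" for w
    proof -
      have "norm (shifted P (H x) w) \<le> (R + 3 * L + 1) * norm w + eps_H P / 2 * norm w"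
        unfolding shifted_def using hessian_bound_small_gradient[OF x small w] eps_H
        by (intro norm_triangle_le add_mono) auto
      also have "\<dots> = (R + 3 * L + 1 + eps_H P / 2) * norm w" by (simp add: distrib_right)
      also have "\<dots> \<le> M * norm w" using eps_H by (intro mult_right_mono) (auto simp: M_def)
      finally show ?thesis .
    qed
    show "l + eps_H P / 2 \<in> eigenvalues V (shifted P (H x))"
      using v by (auto simp: eigenvalues_def eigenspace_def shifted_def scaleR_add_left intro!: exI[of _ v])
    have "sinh overlap_rate \<le> 2 * overlap_rate" using overlap_rate by (intro sinh_le_double) auto
    then have "(sinh overlap_rate)\<^sup>2 \<le> (2 * overlap_rate)\<^sup>2" using overlap_rate by (intro power_mono) auto
    also have "\<dots> = eps_H P / (2 * M)"
      using M eps_H by (simp add: overlap_rate_def M_def[symmetric] power_mult_distrib)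
    finally have "M * (sinh overlap_rate)\<^sup>2 \<le> M * (eps_H P / (2 * M))" using M by (intro mult_left_mono) auto
    also have "\<dots> = eps_H P / 2" using M by simp
    finally show "l + eps_H P / 2 \<le> - M * (sinh overlap_rate)\<^sup>2" using l by simp
  qed
qed

end

context newton_mr_Rn
begin

text \<open>Almost all draws are in \<open>V\<close>; projecting the others there makes the trajectory a process in \<open>V\<close>.\<close>

definition to_V :: "rseq \<Rightarrow> rseq" where
  "to_V q = vec_of d (coord q)"

lemma to_V_mem: "to_V q \<in> V"
  by (simp add: to_V_def)

lemma to_V_id: "q \<in> V \<Longrightarrow> to_V q = q"
  by (simp add: to_V_def vec_of_coord)

lemma measurable_to_V: "to_V \<in> borel_measurable borel"
proof -
  have "(\<lambda>q. \<Sum>i<d. inner (axis_seq i) q *\<^sub>R axis_seq i) \<in> borel_measurable borel" by measurable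
  then show ?thesis by (simp add: to_V_def[abs_def] vec_of_eq_sum)
qed

primrec trajectory :: "(nat \<Rightarrow> real) \<Rightarrow> rseq \<Rightarrow> (nat \<Rightarrow> rseq) \<Rightarrow> nat \<Rightarrow> rseq" where
  "trajectory z x0 \<xi> 0 = x0"
| "trajectory z x0 \<xi> (Suc k) = next_point (z k) (to_V (\<xi> k)) (trajectory z x0 \<xi> k)"

definition signs :: "(nat \<Rightarrow> real) \<Rightarrow> bool" where
  "signs z \<longleftrightarrow> (\<forall>k. z k = 1 \<or> z k = -1)"

lemma trajectory_mem: "signs z \<Longrightarrow> x0 \<in> V \<Longrightarrow> trajectory z x0 \<xi> k \<in> V"
  by (induction k) (auto simp: signs_def intro: next_point_mem to_V_mem)

lemma trajectory_shift:
  "trajectory z x0 (case_nat q \<xi>) (Suc k) =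
   trajectory (\<lambda>i. z (Suc i)) (next_point (z 0) (to_V q) x0) \<xi> k"
  by (induction k) auto

lemma measurable_draw: "(\<lambda>\<xi>. to_V (\<xi> k)) \<in> borel_measurable (draws d)"
proof -
  have "(\<lambda>\<xi>. \<xi> k) \<in> measurable (draws d) (sphere_uniform d)"
    unfolding draws_def by (rule measurable_component_singleton) simp
  then have "(\<lambda>\<xi>. \<xi> k) \<in> borel_measurable (draws d)"
    by (simp cong: measurable_cong_sets)
  then show ?thesis by (rule measurable_compose[OF _ measurable_to_V])
qed

lemma measurable_trajectory:
  assumes "signs z" "x0 \<in> V"
  shows "(\<lambda>\<xi>. trajectory z x0 \<xi> k) \<in> borel_measurable (draws d)"
proof (induction k)
  case (Suc k)
  show ?case unfolding trajectory.simps
    by (rule measurable_next_point[OF Suc measurable_draw trajectory_mem[OF assms] to_V_mem])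
qed simp

text \<open>The iterations that an outer iteration spends at a point where the Hessian has an eigenvalue
  below \<open>-\<epsilon>\<^sub>H\<close>, infinite if the method terminates there by mistake.\<close>

definition curvature_cost :: "rseq \<Rightarrow> rseq \<Rightarrow> ennreal" where
  "curvature_cost x q = (if needs_curvature x then npc_cost (shifted P (H x)) q else 0)"

definition total_cost :: "(nat \<Rightarrow> real) \<Rightarrow> rseq \<Rightarrow> (nat \<Rightarrow> rseq) \<Rightarrow> nat \<Rightarrow> ennreal" where
  "total_cost z x0 \<xi> n = (\<Sum>k<n. curvature_cost (trajectory z x0 \<xi> k) (to_V (\<xi> k)))"

lemma measurable_total_cost:
  assumes "signs z" "x0 \<in> V"
  shows "(\<lambda>\<xi>. total_cost z x0 \<xi> n) \<in> borel_measurable (draws d)"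
  unfolding total_cost_def
proof (rule borel_measurable_sum)
  fix k
  note x = measurable_trajectory[OF assms, of k] and xV = trajectory_mem[OF assms, of _ k]
  have [measurable]: "Measurable.pred (draws d) (\<lambda>\<xi>. needs_curvature (trajectory z x0 \<xi> k))"
    by (rule measurable_needs_curvature[OF x xV])
  have [measurable]: "(\<lambda>\<xi>. npc_cost (shifted P (H (trajectory z x0 \<xi> k))) (to_V (\<xi> k))) \<in> borel_measurable (draws d)"
    by (rule measurable_npc_cost[OF x measurable_draw xV to_V_mem])
  show "(\<lambda>\<xi>. curvature_cost (trajectory z x0 \<xi> k) (to_V (\<xi> k))) \<in> borel_measurable (draws d)"
    unfolding curvature_cost_def by measurable
qed

lemma total_cost_shift:
  "total_cost z x0 (case_nat q \<xi>) (Suc n) =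
   curvature_cost x0 (to_V q) + total_cost (\<lambda>i. z (Suc i)) (next_point (z 0) (to_V q) x0) \<xi> n"
  unfolding total_cost_def
  by (subst sum.lessThan_Suc_shift) (simp add: trajectory_shift del: trajectory.simps(2))

definition curvature_drop :: real where
  "curvature_drop = curvature_const * eps_H P ^ 3"

lemma curvature_drop_pos: "0 < curvature_drop"
  using curvature_const_pos eps_H by (simp add: curvature_drop_def)

lemma next_point_drop:
  assumes x: "x \<in> V" and small: "norm (g x) \<le> eps_g P" and q: "q \<in> V" and z: "z = 1 \<or> z = -1"
    and npc: "fst (minres (shifted P (H x)) q 0) = NPC"
  shows "f (next_point z q x) \<le> f x - curvature_drop"
  using small_gradient_step[OF x small q z npc]
  by (metis curvature_drop_def next_point_def option.simps(5))

text \<open>One outer iteration that needs curvature costs at most \<open>npc_budget\<close> in expectation and decreases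
  \<open>f\<close> by \<open>curvature_drop\<close> for almost every draw.  So the multiple of \<open>f - f_min\<close> that has this ratio is a
  potential for the expected cost of the remaining run.\<close>

lemma expected_curvature_cost_potential:
  assumes x: "x \<in> V" and z: "z = 1 \<or> z = -1"
  defines "W \<equiv> \<lambda>y. npc_budget / curvature_drop * (f y - f_min)"
  shows "(\<integral>\<^sup>+q. curvature_cost x (to_V q) + ennreal (W (next_point z (to_V q) x)) \<partial>sphere_uniform d) \<le> ennreal (W x)"
proof -
  interpret M: prob_space "sphere_uniform d" by (rule prob_space_sphere_uniform[OF d])
  have M1: "emeasure (sphere_uniform d) UNIV = 1" using M.emeasure_space_1 by simp
  have W0: "0 \<le> W y" if "y \<in> V" for y
    using f_min[OF that] npc_budget_nonneg curvature_drop_pos by (simp add: W_def)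
  have W_mono: "W y \<le> W y'" if "f y \<le> f y'" for y y'
    unfolding W_def using that npc_budget_nonneg curvature_drop_pos by (intro mult_left_mono) auto
  show ?thesis
  proof (cases "needs_curvature x")
    case False
    have "(\<integral>\<^sup>+q. curvature_cost x (to_V q) + ennreal (W (next_point z (to_V q) x)) \<partial>sphere_uniform d)
        \<le> (\<integral>\<^sup>+q. ennreal (W x) \<partial>sphere_uniform d)"
      using False next_point_mem(2)[OF x to_V_mem z]
      by (intro nn_integral_mono) (auto simp: curvature_cost_def intro!: ennreal_leI W_mono)
    then show ?thesis by (simp add: M1)
  next
    case True
    let ?c = "\<lambda>q. npc_cost (shifted P (H x)) (to_V q)"
    have meas [measurable]: "?c \<in> borel_measurable (sphere_uniform d)"
      by (rule measurable_npc_cost) (use x to_V_mem measurable_to_V in \<open>auto cong: measurable_cong_sets\<close>)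
    have "AE q in sphere_uniform d. to_V q = q"
      by (rule eventually_mono[OF AE_sphere_uniform[OF d]]) (auto simp: to_V_id)
    then have "(\<integral>\<^sup>+q. ?c q \<partial>sphere_uniform d) = (\<integral>\<^sup>+q. npc_cost (shifted P (H x)) q \<partial>sphere_uniform d)"
      by (intro nn_integral_cong_AE) (auto elim!: eventually_mono)
    also have "\<dots> \<le> ennreal npc_budget" by (rule expected_cost_needs_curvature[OF x True])
    finally have c: "(\<integral>\<^sup>+q. ?c q \<partial>sphere_uniform d) \<le> ennreal npc_budget" .
    then have "AE q in sphere_uniform d. ?c q \<noteq> \<infinity>"
      by (intro nn_integral_PInf_AE meas) (auto simp: top_unique)
    then have drop: "AE q in sphere_uniform d.
        ?c q + ennreal (W (next_point z (to_V q) x)) + ennreal npc_budget \<le> ?c q + ennreal (W x)"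
    proof (rule eventually_mono)
      fix q assume "?c q \<noteq> \<infinity>"
      then have npc: "fst (minres (shifted P (H x)) (to_V q) 0) = NPC" by (auto simp: npc_cost_def split: if_splits)
      have small: "norm (g x) \<le> eps_g P" using True by (simp add: needs_curvature_def)
      let ?y = "next_point z (to_V q) x"
      have "f ?y \<le> f x - curvature_drop" by (rule next_point_drop[OF x small to_V_mem z npc])
      then have "npc_budget / curvature_drop * (f ?y - f_min) \<le> npc_budget / curvature_drop * (f x - f_min - curvature_drop)"
        using npc_budget_nonneg curvature_drop_pos by (intro mult_left_mono) auto
      then have "W ?y + npc_budget \<le> W x"
        using curvature_drop_pos by (simp add: W_def right_diff_distrib)
      moreover have "0 \<le> W ?y" by (rule W0[OF next_point_mem(1)[OF x to_V_mem z]])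
      ultimately have "ennreal (W ?y) + ennreal npc_budget \<le> ennreal (W x)"
        using npc_budget_nonneg by (simp add: ennreal_plus[symmetric] ennreal_leI del: ennreal_plus)
      then show "?c q + ennreal (W ?y) + ennreal npc_budget \<le> ?c q + ennreal (W x)"
        by (simp add: add.assoc add_left_mono)
    qed
    have "(\<lambda>q. next_point z (to_V q) x) \<in> borel_measurable (sphere_uniform d)"
      by (rule measurable_next_point) (use x to_V_mem measurable_to_V in \<open>auto cong: measurable_cong_sets\<close>)
    then have [measurable]: "(\<lambda>q. f (next_point z (to_V q) x)) \<in> borel_measurable (sphere_uniform d)"
      using next_point_mem(1)[OF x to_V_mem z] by (rule measurable_continuous_on_closed[OF closed_Rn f_continuous])
    have meas2: "(\<lambda>q. ?c q + ennreal (W (next_point z (to_V q) x))) \<in> borel_measurable (sphere_uniform d)"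
      unfolding W_def by measurable
    have "(\<integral>\<^sup>+q. ?c q + ennreal (W (next_point z (to_V q) x)) \<partial>sphere_uniform d) + ennreal npc_budget
        = (\<integral>\<^sup>+q. (?c q + ennreal (W (next_point z (to_V q) x))) + ennreal npc_budget \<partial>sphere_uniform d)"
      using nn_integral_add[OF meas2 borel_measurable_const[of "ennreal npc_budget"]] by (simp add: M1)
    also have "\<dots> \<le> (\<integral>\<^sup>+q. ?c q + ennreal (W x) \<partial>sphere_uniform d)"
      using drop by (rule nn_integral_mono_AE)
    also have "\<dots> = (\<integral>\<^sup>+q. ?c q \<partial>sphere_uniform d) + ennreal (W x)"
      using meas by (subst nn_integral_add) (auto simp: M1)
    also have "\<dots> \<le> ennreal npc_budget + ennreal (W x)" by (rule add_right_mono[OF c])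
    finally have "ennreal npc_budget + (\<integral>\<^sup>+q. ?c q + ennreal (W (next_point z (to_V q) x)) \<partial>sphere_uniform d)
        \<le> ennreal npc_budget + ennreal (W x)" by (simp add: add.commute)
    then have "(\<integral>\<^sup>+q. ?c q + ennreal (W (next_point z (to_V q) x)) \<partial>sphere_uniform d) \<le> ennreal (W x)"
      by (simp add: ennreal_add_left_cancel_le)
    then show ?thesis using True by (simp add: curvature_cost_def)
  qed
qed

text \<open>Induction on the number of iterations, splitting off the first draw.\<close>

theorem expected_total_cost:
  assumes "signs z" "x0 \<in> V"
  shows "(\<integral>\<^sup>+\<xi>. total_cost z x0 \<xi> n \<partial>draws d) \<le> ennreal (npc_budget / curvature_drop * (f x0 - f_min))"
  using assms
proof (induction n arbitrary: z x0)
  case 0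
  then show ?case by (simp add: total_cost_def)
next
  case (Suc n)
  interpret PP: product_prob_space "\<lambda>_::nat. sphere_uniform d" UNIV
    by (intro product_prob_spaceI prob_space_sphere_uniform d)
  interpret sequence_space "sphere_uniform d" ..
  interpret D: prob_space "draws d" unfolding draws_def by (intro prob_space_PiM prob_space_sphere_uniform d)
  let ?M = "sphere_uniform d"
  note tot = measurable_total_cost[OF Suc.prems, of "Suc n"]
  have z0: "z 0 = 1 \<or> z 0 = -1" using Suc.prems by (simp add: signs_def)
  have z': "signs (\<lambda>i. z (Suc i))" using Suc.prems by (simp add: signs_def)
  have iter: "distr (?M \<Otimes>\<^sub>M draws d) (draws d) (\<lambda>(q, \<xi>). case_nat q \<xi>) = draws d"
    using PiM_iter by (simp add: draws_def)
  have cons: "(\<lambda>(q, \<xi>). case_nat q \<xi>) \<in> measurable (?M \<Otimes>\<^sub>M draws d) (draws d)"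
    unfolding draws_def by measurable
  have comp: "(\<lambda>(q, \<xi>). total_cost z x0 (case_nat q \<xi>) (Suc n)) \<in> borel_measurable (?M \<Otimes>\<^sub>M draws d)"
    using measurable_compose[OF cons tot] by (simp add: split_beta')
  have "(\<integral>\<^sup>+\<xi>. total_cost z x0 \<xi> (Suc n) \<partial>draws d) =
      (\<integral>\<^sup>+p. total_cost z x0 (case_nat (fst p) (snd p)) (Suc n) \<partial>(?M \<Otimes>\<^sub>M draws d))"
  proof -
    have "(\<integral>\<^sup>+\<xi>. total_cost z x0 \<xi> (Suc n) \<partial>draws d) =
        (\<integral>\<^sup>+\<xi>. total_cost z x0 \<xi> (Suc n) \<partial>distr (?M \<Otimes>\<^sub>M draws d) (draws d) (\<lambda>(q, \<xi>). case_nat q \<xi>))"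
      by (simp only: iter)
    also have "\<dots> = (\<integral>\<^sup>+p. total_cost z x0 (case p of (q, \<xi>) \<Rightarrow> case_nat q \<xi>) (Suc n) \<partial>(?M \<Otimes>\<^sub>M draws d))"
      by (rule nn_integral_distr[OF cons]) (simp only: measurable_distr_eq1 tot)
    finally show ?thesis by (simp only: split_beta')
  qed
  also have "\<dots> = (\<integral>\<^sup>+q. \<integral>\<^sup>+\<xi>. total_cost z x0 (case_nat q \<xi>) (Suc n) \<partial>draws d \<partial>?M)"
    using D.nn_integral_fst[OF comp] by (simp add: split_beta')
  also have "\<dots> \<le> (\<integral>\<^sup>+q. curvature_cost x0 (to_V q) +
      ennreal (npc_budget / curvature_drop * (f (next_point (z 0) (to_V q) x0) - f_min)) \<partial>?M)"
  proof (rule nn_integral_mono)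
    fix q
    have y: "next_point (z 0) (to_V q) x0 \<in> V" by (rule next_point_mem(1)[OF Suc.prems(2) to_V_mem z0])
    have "(\<integral>\<^sup>+\<xi>. total_cost z x0 (case_nat q \<xi>) (Suc n) \<partial>draws d) =
      curvature_cost x0 (to_V q) +
      (\<integral>\<^sup>+\<xi>. total_cost (\<lambda>i. z (Suc i)) (next_point (z 0) (to_V q) x0) \<xi> n \<partial>draws d)"
      unfolding total_cost_shift
      using measurable_total_cost[OF z' y] by (subst nn_integral_add) (auto simp: D.emeasure_space_1)
    also have "\<dots> \<le> curvature_cost x0 (to_V q) +
      ennreal (npc_budget / curvature_drop * (f (next_point (z 0) (to_V q) x0) - f_min))"
      by (intro add_left_mono Suc.IH z' y)
    finally show "(\<integral>\<^sup>+\<xi>. total_cost z x0 (case_nat q \<xi>) (Suc n) \<partial>draws d) \<le> \<dots>" .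
  qed
  also have "\<dots> \<le> ennreal (npc_budget / curvature_drop * (f x0 - f_min))"
    by (rule expected_curvature_cost_potential[OF Suc.prems(2) z0])
  finally show ?case .
qed

section \<open>Counting the outer iterations along one run\<close>

definition gradient_drop :: "real \<Rightarrow> real" where
  "gradient_drop \<omega> = min newton_const (npc_const \<omega>) * (eps_g P * sqrt (eps_g P))"

lemma gradient_drop_pos: "0 < \<omega> \<Longrightarrow> 0 < gradient_drop \<omega>"
proof -
  assume \<omega>: "0 < \<omega>"
  have "0 < theta P * R / \<sigma> + L + 1" using theta R(1) \<sigma> L_pos by (intro add_pos_pos divide_pos_pos mult_pos_pos) auto
  then have "0 < min (\<sigma> * (1 / 2 - rho_S P) / L) (1 / (theta P * R / \<sigma> + L + 1))"
    using rho \<sigma> L_pos by (simp add: min_less_iff_conj)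
  then have "0 < newton_const" unfolding newton_const_def using rho \<sigma> by (intro mult_pos_pos zero_less_power) auto
  moreover have "0 < npc_const \<omega>" unfolding npc_const_def using rho \<omega> L_pos by (intro mult_pos_pos) auto
  ultimately show ?thesis using eps_g by (simp add: gradient_drop_def)
qed

definition large_cost :: real where
  "large_cost = 2 + (R / \<sigma>)\<^sup>2 * ln (1 + R\<^sup>2 / tol\<^sup>2)"

lemma large_cost_nonneg: "0 \<le> large_cost"
  unfolding large_cost_def by (intro add_nonneg_nonneg mult_nonneg_nonneg ln_ge_zero) auto

definition small_indicator :: "rseq \<Rightarrow> real" where
  "small_indicator x = (if norm (g x) \<le> eps_g P then 1 else 0)"

text \<open>An iteration with large gradient that does not decrease \<open>f\<close> enough is followed by one with
  small gradient, which does.  The indicator pays for this one iteration in advance.\<close>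

lemma run_invariant:
  assumes z: "signs z" and x0: "x0 \<in> V" and \<xi>: "\<And>k. \<xi> k \<in> V"
    and fin: "total_cost z x0 \<xi> n < \<top>" and II: "krylov_regular_II P f g H z x0 \<omega> \<xi>" and \<omega>: "0 < \<omega>"
    and k: "k \<le> n" and nonopt: "\<And>j. j < k \<Longrightarrow> \<not> second_order_optimal V P g H (trajectory z x0 \<xi> j)"
  defines "X \<equiv> trajectory z x0 \<xi>"
  shows "newton_mr P f g H z x0 \<xi> k = Some (X k) \<and>
    real k \<le> (2 / curvature_drop + 1 / gradient_drop \<omega>) * (f x0 - f (X k)) + small_indicator (X k) \<and>
    (\<Sum>j<k. real (call_iters P g H (\<xi> j) (X j))) \<le>
      large_cost * ((1 / curvature_drop + 1 / gradient_drop \<omega>) * (f x0 - f (X k)) + small_indicator (X k)) +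
      enn2real (total_cost z x0 \<xi> k)"
  using k nonopt
proof (induction k)
  case 0
  then show ?case using large_cost_nonneg by (simp add: X_def small_indicator_def total_cost_def)
next
  case (Suc k)
  define a where "a = 1 / curvature_drop"
  define b where "b = 1 / gradient_drop \<omega>"
  have ab: "1 / curvature_drop = a" "1 / gradient_drop \<omega> = b" "2 / curvature_drop = 2 * a"
    by (simp_all add: a_def b_def)
  let ?x = "X k" and ?y = "X (Suc k)"
  have IH: "newton_mr P f g H z x0 \<xi> k = Some ?x"
    "real k \<le> (2 * a + b) * (f x0 - f ?x) + small_indicator ?x"
    "(\<Sum>j<k. real (call_iters P g H (\<xi> j) (X j))) \<le>
      large_cost * ((a + b) * (f x0 - f ?x) + small_indicator ?x) + enn2real (total_cost z x0 \<xi> k)"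
    using Suc.IH Suc.prems unfolding ab by auto
  have xV: "?x \<in> V" unfolding X_def by (rule trajectory_mem[OF z x0])
  have zk: "z k = 1 \<or> z k = -1" using z by (simp add: signs_def)
  have \<xi>k: "to_V (\<xi> k) = \<xi> k" using \<xi> by (rule to_V_id)
  have y_eq: "?y = next_point (z k) (\<xi> k) ?x" by (simp add: X_def \<xi>k)
  have pos: "0 < a" "0 < b"
    using curvature_drop_pos gradient_drop_pos[OF \<omega>] by (auto simp: a_def b_def)
  have cost_Suc: "total_cost z x0 \<xi> (Suc k) = total_cost z x0 \<xi> k + curvature_cost ?x (\<xi> k)"
    by (simp add: total_cost_def X_def \<xi>k)
  have "total_cost z x0 \<xi> (Suc k) \<le> total_cost z x0 \<xi> n"
    unfolding total_cost_def using Suc.prems by (intro sum_mono2) auto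
  then have "total_cost z x0 \<xi> k + curvature_cost ?x (\<xi> k) < \<top>"
    using fin unfolding cost_Suc by (rule le_less_trans)
  then have fin': "total_cost z x0 \<xi> k < \<top>" "curvature_cost ?x (\<xi> k) < \<top>"
    by (simp_all add: less_top[symmetric] ennreal_add_eq_top)
  have step: "newton_mr P f g H z x0 \<xi> (Suc k) = newton_mr_step P f g H (z k) (\<xi> k) ?x" using IH(1) by simp
  show ?case
  proof (cases "norm (g ?x) \<le> eps_g P")
    case True
    then have need: "needs_curvature ?x" using Suc.prems(2)[of k] by (simp add: needs_curvature_def X_def)
    then have npc: "fst (minres (shifted P (H ?x)) (\<xi> k) 0) = NPC"
      using fin'(2) by (auto simp: curvature_cost_def npc_cost_def split: if_splits)
    obtain y where y: "newton_mr_step P f g H (z k) (\<xi> k) ?x = Some y" "f y \<le> f ?x - curvature_const * eps_H P ^ 3"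
      using small_gradient_step[OF xV True \<xi> zk npc] by blast
    have yX: "y = ?y" using y(1) by (simp add: y_eq next_point_def)
    have "curvature_drop \<le> f ?x - f ?y" using y(2) by (simp add: yX curvature_drop_def)
    then have D: "a * curvature_drop \<le> a * (f ?x - f ?y)" "0 \<le> b * (f ?x - f ?y)"
      using pos curvature_drop_pos by (auto intro: mult_left_mono)
    then have D1: "1 \<le> a * (f ?x - f ?y)" using curvature_drop_pos by (simp add: a_def)
    have ind: "small_indicator ?x = 1" "0 \<le> small_indicator ?y" using True by (auto simp: small_indicator_def)
    have "real (Suc k) \<le> (2 * a + b) * (f x0 - f ?x) + 2" using IH(2) ind(1) by simp
    also have "\<dots> \<le> (2 * a + b) * (f x0 - f ?x) + (2 * a + b) * (f ?x - f ?y)"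
      using D1 D(2) by (simp add: distrib_right)
    also have "\<dots> = (2 * a + b) * (f x0 - f ?y)" by (simp add: algebra_simps)
    finally have count: "real (Suc k) \<le> (2 * a + b) * (f x0 - f ?y) + small_indicator ?y"
      using ind(2) by simp
    have iters: "enn2real (total_cost z x0 \<xi> (Suc k)) =
        enn2real (total_cost z x0 \<xi> k) + real (call_iters P g H (\<xi> k) ?x)"
      unfolding cost_Suc using fin' True need npc
      by (simp add: enn2real_plus curvature_cost_def npc_cost_def call_iters_def ennreal_of_nat_eq_real_of_nat)
    have "(a + b) * (f x0 - f ?x) + 1 \<le> (a + b) * (f x0 - f ?x) + (a + b) * (f ?x - f ?y)"
      using D1 D(2) by (simp add: distrib_right)
    also have "\<dots> = (a + b) * (f x0 - f ?y)" by (simp add: algebra_simps)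
    finally have "(a + b) * (f x0 - f ?x) + small_indicator ?x \<le> (a + b) * (f x0 - f ?y) + small_indicator ?y"
      using ind by simp
    from mult_left_mono[OF this large_cost_nonneg]
    have "(\<Sum>j<Suc k. real (call_iters P g H (\<xi> j) (X j))) \<le>
      large_cost * ((a + b) * (f x0 - f ?y) + small_indicator ?y) + enn2real (total_cost z x0 \<xi> (Suc k))"
      using IH(3) unfolding iters by simp
    then show ?thesis using count step y(1) yX unfolding ab by simp
  next
    case False
    then have large: "eps_g P < norm (g ?x)" by simp
    obtain y where y: "newton_mr_step P f g H (z k) (\<xi> k) ?x = Some y" "f y \<le> f ?x"
      and alt: "norm (g y) \<le> eps_g P \<or>
       f y \<le> f ?x - min newton_const (npc_const \<omega>) * (eps_g P * sqrt (eps_g P)) \<or>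
       (\<exists>dir. minres_call P g H (\<xi> k) ?x = (NPC, dir) \<and> norm dir < \<omega> * norm (g ?x))"
      using large_gradient_step[OF xV large \<omega>] by blast
    have yX: "y = ?y" using y(1) by (simp add: y_eq next_point_def)
    have "\<not> (\<exists>dir. minres_call P g H (\<xi> k) ?x = (NPC, dir) \<and> norm dir < \<omega> * norm (g ?x))"
      using II IH(1) large by (fastforce simp: krylov_regular_II_def)
    then have alt': "norm (g ?y) \<le> eps_g P \<or> gradient_drop \<omega> \<le> f ?x - f ?y"
      using alt by (auto simp: yX gradient_drop_def)
    have dec: "0 \<le> f ?x - f ?y" using y(2) by (simp add: yX)
    have gain: "1 \<le> b * (f ?x - f ?y) + small_indicator ?y"
    proof (cases "norm (g ?y) \<le> eps_g P")
      case True
      then show ?thesis using dec pos by (simp add: small_indicator_def)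
    next
      case False
      then have "b * gradient_drop \<omega> \<le> b * (f ?x - f ?y)" using alt' pos by (intro mult_left_mono) auto
      then show ?thesis using gradient_drop_pos[OF \<omega>] False by (simp add: small_indicator_def b_def)
    qed
    have ind: "small_indicator ?x = 0" using False by (simp add: small_indicator_def)
    have a0: "0 \<le> a * (f ?x - f ?y)" using pos dec by simp
    have "real (Suc k) \<le> (2 * a + b) * (f x0 - f ?x) + 1" using IH(2) ind by simp
    also have "\<dots> \<le> (2 * a + b) * (f x0 - f ?x) + (2 * a + b) * (f ?x - f ?y) + small_indicator ?y"
      using gain a0 by (simp add: distrib_right)
    also have "\<dots> = (2 * a + b) * (f x0 - f ?y) + small_indicator ?y" by (simp add: algebra_simps)
    finally have count: "real (Suc k) \<le> (2 * a + b) * (f x0 - f ?y) + small_indicator ?y"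
      by simp
    have "curvature_cost ?x (\<xi> k) = 0" using False by (simp add: curvature_cost_def needs_curvature_def)
    then have cost: "total_cost z x0 \<xi> (Suc k) = total_cost z x0 \<xi> k" by (simp add: cost_Suc)
    have "(a + b) * (f x0 - f ?x) + 1 \<le> (a + b) * (f x0 - f ?x) + (a + b) * (f ?x - f ?y) + small_indicator ?y"
      using gain a0 by (simp add: distrib_right)
    also have "\<dots> = (a + b) * (f x0 - f ?y) + small_indicator ?y" by (simp add: algebra_simps)
    finally have "large_cost * ((a + b) * (f x0 - f ?x) + 1) \<le> large_cost * ((a + b) * (f x0 - f ?y) + small_indicator ?y)"
      by (rule mult_left_mono[OF _ large_cost_nonneg])
    moreover have "real (call_iters P g H (\<xi> k) ?x) \<le> large_cost"
      unfolding large_cost_def by (rule large_gradient_iters[OF xV large])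
    ultimately have "(\<Sum>j<Suc k. real (call_iters P g H (\<xi> j) (X j))) \<le>
      large_cost * ((a + b) * (f x0 - f ?y) + small_indicator ?y) + enn2real (total_cost z x0 \<xi> (Suc k))"
      using IH(3) ind unfolding cost by (simp add: distrib_left)
    then show ?thesis using count step y(1) yX unfolding ab by simp
  qed
qed

lemma run_bound:
  assumes z: "signs z" and x0: "x0 \<in> V" and \<xi>: "\<And>k. \<xi> k \<in> V" and \<omega>: "0 < \<omega>"
    and cost: "total_cost z x0 \<xi> n \<le> ennreal c" "0 \<le> c" and II: "krylov_regular_II P f g H z x0 \<omega> \<xi>"
    and \<Delta>: "f x0 - f_min \<le> \<Delta>" and n: "(2 / curvature_drop + 1 / gradient_drop \<omega>) * \<Delta> + 1 < real n"
  shows "\<exists>k x. newton_mr P f g H z x0 \<xi> k = Some x \<and> second_order_optimal V P g H x \<and>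
    real (evals P f g H z x0 \<xi> k) \<le> (2 / curvature_drop + 1 / gradient_drop \<omega>) * \<Delta> + 2 +
      large_cost * ((1 / curvature_drop + 1 / gradient_drop \<omega>) * \<Delta> + 1) + c"
proof -
  let ?X = "trajectory z x0 \<xi>"
  have fin: "total_cost z x0 \<xi> n < \<top>" using cost(1) by (meson ennreal_less_top le_less_trans)
  note inv = run_invariant[OF z x0 \<xi> fin II \<omega>]
  have pos: "0 < 1 / curvature_drop" "0 < 1 / gradient_drop \<omega>" "0 < 2 / curvature_drop"
    using curvature_drop_pos gradient_drop_pos[OF \<omega>] by auto
  have gap: "f x0 - f (?X k) \<le> \<Delta>" for k
    using f_min[OF trajectory_mem[OF z x0, of \<xi> k]] \<Delta> by linarith
  have ind: "small_indicator x \<le> 1" for x by (simp add: small_indicator_def)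
  have C: "(2 / curvature_drop + 1 / gradient_drop \<omega>) * (f x0 - f (?X k)) + small_indicator (?X k) \<le>
      (2 / curvature_drop + 1 / gradient_drop \<omega>) * \<Delta> + 1" for k
    using pos gap[of k] by (intro add_mono mult_left_mono ind) auto
  have "\<exists>k\<le>n. second_order_optimal V P g H (?X k)"
  proof (rule ccontr)
    assume "\<not> ?thesis"
    then have "real n \<le> (2 / curvature_drop + 1 / gradient_drop \<omega>) * (f x0 - f (?X n)) + small_indicator (?X n)"
      using inv[of n] by auto
    then show False using C[of n] n by linarith
  qed
  then obtain k0 where k0: "k0 \<le> n" "second_order_optimal V P g H (?X k0)" by blast
  define k where "k = (LEAST k. second_order_optimal V P g H (?X k))"
  have opt: "second_order_optimal V P g H (?X k)" unfolding k_def using k0(2) by (rule LeastI)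
  have kn: "k \<le> n" unfolding k_def using k0 by (meson Least_le order.trans)
  have nonopt: "\<not> second_order_optimal V P g H (?X j)" if "j < k" for j
    using that not_less_Least unfolding k_def by blast
  have run: "newton_mr P f g H z x0 \<xi> j = Some (?X j)" if "j \<le> k" for j
    using inv[of j] that kn nonopt by auto
  have "real (evals P f g H z x0 \<xi> k) = real k + 1 + (\<Sum>j<k. real (call_iters P g H (\<xi> j) (?X j)))"
    by (simp add: evals_def, intro sum.cong refl) (simp add: run)
  also have "\<dots> \<le> ((2 / curvature_drop + 1 / gradient_drop \<omega>) * \<Delta> + 1) + 1 +
      (large_cost * ((1 / curvature_drop + 1 / gradient_drop \<omega>) * \<Delta> + 1) + c)"
  proof (intro add_mono)
    show "real k \<le> (2 / curvature_drop + 1 / gradient_drop \<omega>) * \<Delta> + 1"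
      using inv[OF kn nonopt] C[of k] by linarith
    have "(\<Sum>j<k. real (call_iters P g H (\<xi> j) (?X j))) \<le>
      large_cost * ((1 / curvature_drop + 1 / gradient_drop \<omega>) * (f x0 - f (?X k)) + small_indicator (?X k)) +
      enn2real (total_cost z x0 \<xi> k)"
      using inv[OF kn nonopt] by blast
    also have "\<dots> \<le> large_cost * ((1 / curvature_drop + 1 / gradient_drop \<omega>) * \<Delta> + 1) + c"
    proof (intro add_mono mult_left_mono large_cost_nonneg ind gap)
      have "total_cost z x0 \<xi> k \<le> total_cost z x0 \<xi> n"
        unfolding total_cost_def using kn by (intro sum_mono2) auto
      also note cost(1)
      finally show "enn2real (total_cost z x0 \<xi> k) \<le> c" using cost(2) by (rule enn2real_leI[rotated])
    qed (use pos in auto)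
    finally show "(\<Sum>j<k. real (call_iters P g H (\<xi> j) (?X j))) \<le>
      large_cost * ((1 / curvature_drop + 1 / gradient_drop \<omega>) * \<Delta> + 1) + c" .
  qed auto
  finally have "real (evals P f g H z x0 \<xi> k) \<le> (2 / curvature_drop + 1 / gradient_drop \<omega>) * \<Delta> + 2 +
      large_cost * ((1 / curvature_drop + 1 / gradient_drop \<omega>) * \<Delta> + 1) + c" by simp
  then show ?thesis using run[of k] opt by blast
qed

text \<open>Markov's inequality turns the expected cost into a bound that holds with probability
  \<open>1 - \<delta>\<close>.\<close>

theorem high_probability_bound:
  assumes z: "signs z" and x0: "x0 \<in> V" and \<omega>: "0 < \<omega>" and \<delta>: "0 < \<delta>" "\<delta> < 1"
    and II: "AE \<xi> in draws d. krylov_regular_II P f g H z x0 \<omega> \<xi>" and \<Delta>: "f x0 - f_min \<le> \<Delta>"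
  shows "\<exists>E\<in>sets (draws d). 1 - \<delta> \<le> measure (draws d) E \<and>
    (\<forall>\<xi>\<in>E. \<exists>k x. newton_mr P f g H z x0 \<xi> k = Some x \<and> second_order_optimal V P g H x \<and>
      real (evals P f g H z x0 \<xi> k) \<le> (2 / curvature_drop + 1 / gradient_drop \<omega>) * \<Delta> + 2 +
        large_cost * ((1 / curvature_drop + 1 / gradient_drop \<omega>) * \<Delta> + 1) +
        (npc_budget / curvature_drop * \<Delta> + 1) / \<delta>)"
proof -
  interpret D: prob_space "draws d" unfolding draws_def by (intro prob_space_PiM prob_space_sphere_uniform d)
  \<comment> \<open>the summand 1 keeps the threshold positive if \<open>\<Delta> = 0\<close>\<close>
  define c where "c = (npc_budget / curvature_drop * \<Delta> + 1) / \<delta>"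
  obtain n :: nat where n: "(2 / curvature_drop + 1 / gradient_drop \<omega>) * \<Delta> + 1 < real n"
    using reals_Archimedean2 by blast
  have "0 \<le> f x0 - f_min" using f_min[OF x0] by simp
  then have \<Delta>0: "0 \<le> \<Delta>" using \<Delta> by linarith
  have K0: "0 \<le> npc_budget / curvature_drop" using npc_budget_nonneg curvature_drop_pos by simp
  have "0 < npc_budget / curvature_drop * \<Delta> + 1" using K0 \<Delta>0 by (intro add_nonneg_pos mult_nonneg_nonneg) auto
  then have c: "0 < c" unfolding c_def using \<delta>(1) by (rule divide_pos_pos)
  let ?T = "\<lambda>\<xi>. total_cost z x0 \<xi> n"
  note meas [measurable] = measurable_total_cost[OF z x0, of n]
  let ?bad = "{\<xi> \<in> space (draws d). ennreal c < ?T \<xi>}"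
  have bad_sets: "?bad \<in> sets (draws d)" by measurable
  have "emeasure (draws d) ?bad \<le> emeasure (draws d) {\<xi> \<in> space (draws d). 1 \<le> ennreal (1 / c) * ?T \<xi>}"
  proof (rule emeasure_mono)
    show "?bad \<subseteq> {\<xi> \<in> space (draws d). 1 \<le> ennreal (1 / c) * ?T \<xi>}"
    proof safe
      fix \<xi> assume "ennreal c < ?T \<xi>"
      then have "ennreal (1 / c) * ennreal c \<le> ennreal (1 / c) * ?T \<xi>" by (intro mult_left_mono) auto
      then show "1 \<le> ennreal (1 / c) * ?T \<xi>" using c by (simp add: ennreal_mult[symmetric])
    qed
  qed measurable
  also have "\<dots> \<le> ennreal (1 / c) * (\<integral>\<^sup>+\<xi>. ?T \<xi> * indicator (space (draws d)) \<xi> \<partial>draws d)"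
    by (rule nn_integral_Markov_inequality) auto
  also have "(\<integral>\<^sup>+\<xi>. ?T \<xi> * indicator (space (draws d)) \<xi> \<partial>draws d) = (\<integral>\<^sup>+\<xi>. ?T \<xi> \<partial>draws d)"
    by (intro nn_integral_cong) auto
  also have "\<dots> \<le> ennreal (npc_budget / curvature_drop * \<Delta> + 1)"
  proof (rule order.trans[OF expected_total_cost[OF z x0] ennreal_leI])
    have "npc_budget / curvature_drop * (f x0 - f_min) \<le> npc_budget / curvature_drop * \<Delta>"
      using K0 \<Delta> by (rule mult_left_mono[rotated])
    then show "npc_budget / curvature_drop * (f x0 - f_min) \<le> npc_budget / curvature_drop * \<Delta> + 1" by linarith
  qed
  also have "npc_budget / curvature_drop * \<Delta> + 1 = c * \<delta>" using \<delta> by (simp add: c_def)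
  finally have "emeasure (draws d) ?bad \<le> ennreal (1 / c) * ennreal (c * \<delta>)" by (simp add: mult_left_mono)
  also have "\<dots> = ennreal \<delta>" using c \<delta> by (simp add: ennreal_mult[symmetric])
  finally have bad: "measure (draws d) ?bad \<le> \<delta>" using \<delta> by (simp add: D.emeasure_eq_measure)
  have "AE \<xi> in draws d. \<forall>k. \<xi> k \<in> V"
  proof (subst AE_all_countable, intro allI)
    fix k
    show "AE \<xi> in draws d. \<xi> k \<in> V" unfolding draws_def
      by (rule AE_PiM_component[OF prob_space_sphere_uniform[OF d]])
         (auto intro: eventually_mono[OF AE_sphere_uniform[OF d]])
  qed
  with II have "AE \<xi> in draws d. krylov_regular_II P f g H z x0 \<omega> \<xi> \<and> (\<forall>k. \<xi> k \<in> V)" by (rule AE_conjI)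
  then obtain N where N: "{\<xi> \<in> space (draws d). \<not> (krylov_regular_II P f g H z x0 \<omega> \<xi> \<and> (\<forall>k. \<xi> k \<in> V))} \<subseteq> N"
    "emeasure (draws d) N = 0" "N \<in> sets (draws d)"
    by (rule AE_E)
  define E where "E = space (draws d) - (?bad \<union> N)"
  have E: "E \<in> sets (draws d)" unfolding E_def using bad_sets N(3) by auto
  have "measure (draws d) (?bad \<union> N) \<le> measure (draws d) ?bad + measure (draws d) N"
    using bad_sets N(3) by (rule measure_Un_le)
  also have "\<dots> \<le> \<delta>" using bad N(2) by (simp add: measure_def)
  finally have "1 - \<delta> \<le> measure (draws d) E"
    unfolding E_def using bad_sets N(3) by (subst D.prob_compl) auto
  moreover have "\<exists>k x. newton_mr P f g H z x0 \<xi> k = Some x \<and> second_order_optimal V P g H x \<and>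
      real (evals P f g H z x0 \<xi> k) \<le> (2 / curvature_drop + 1 / gradient_drop \<omega>) * \<Delta> + 2 +
        large_cost * ((1 / curvature_drop + 1 / gradient_drop \<omega>) * \<Delta> + 1) + c" if "\<xi> \<in> E" for \<xi>
  proof (rule run_bound[OF z x0 _ \<omega> _ less_imp_le[OF c] _ \<Delta> n])
    show "\<xi> k \<in> V" for k using that N(1) by (auto simp: E_def)
    show "?T \<xi> \<le> ennreal c" using that by (auto simp: E_def not_less)
    show "krylov_regular_II P f g H z x0 \<omega> \<xi>" using that N(1) by (auto simp: E_def)
  qed
  ultimately show ?thesis using E unfolding c_def by blast
qed

end

section \<open>The complexity bound\<close>

lemma inverse_powers_as_powr:
  fixes e :: real assumes "0 < e"
  shows "1 / (e * sqrt e) = e powr (-3/2)" "1 / (e ^ 3 * sqrt e) = e powr (-7/2)"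
proof -
  have "e powr (3/2) = e powr (1 + 1/2)" by simp
  also have "\<dots> = e * sqrt e" using assms unfolding powr_add by (simp add: powr_half_sqrt)
  finally have 1: "e powr (3/2) = e * sqrt e" .
  have "e powr (7/2) = e powr (3 + 1/2)" by simp
  also have "\<dots> = e ^ 3 * sqrt e" using assms unfolding powr_add by (simp add: powr_half_sqrt)
  finally have 2: "e powr (7/2) = e ^ 3 * sqrt e" .
  show "1 / (e * sqrt e) = e powr (-3/2)" "1 / (e ^ 3 * sqrt e) = e powr (-7/2)"
    using powr_minus_divide[of e "3/2"] powr_minus_divide[of e "7/2"] by (simp_all add: 1 2)
qed

text \<open>The logarithmic cost of an iteration with large gradient also multiplies the \<open>\<epsilon>\<^sub>H\<^sup>-\<^sup>3\<close> steps of
  negative curvature.  Either the logarithm is at most \<open>\<epsilon>\<^sub>H\<^sup>-\<^sup>1\<^sup>/\<^sup>2\<close>, or \<open>\<epsilon>\<^sub>H\<^sup>-\<^sup>3\<close> is at most its sixth power.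
  This is what fixes the power of the logarithm at 7.\<close>

lemma mixed_term_bound:
  fixes e l G D :: real
  assumes e: "0 < e" "e \<le> 1" and l: "1 \<le> l" and G: "1 \<le> G" and D: "1 \<le> D"
  shows "1 / e ^ 3 * l \<le> G * l ^ 7 + D * (1 / (e ^ 3 * sqrt e))"
proof (cases "l * sqrt e \<le> 1")
  case True
  then have "l \<le> 1 / sqrt e" using e by (simp add: field_simps)
  then have "1 / e ^ 3 * l \<le> 1 / e ^ 3 * (1 / sqrt e)" using e by (intro mult_left_mono) auto
  also have "\<dots> = 1 * (1 / (e ^ 3 * sqrt e))" by simp
  also have "\<dots> \<le> D * (1 / (e ^ 3 * sqrt e))" using D e by (intro mult_right_mono) auto
  finally show ?thesis using l G by (simp add: add_increasing)
next
  case False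
  then have "1 ^ 6 \<le> (l * sqrt e) ^ 6" by (intro power_mono) auto
  also have "\<dots> = l ^ 6 * e ^ 3"
  proof -
    have "(sqrt e) ^ 6 = ((sqrt e)\<^sup>2) ^ 3" by (simp flip: power_mult)
    then show ?thesis using e by (simp add: power_mult_distrib)
  qed
  finally have "1 / e ^ 3 \<le> l ^ 6" using e by (simp add: field_simps)
  then have "1 / e ^ 3 * l \<le> l ^ 6 * l" using l by (intro mult_right_mono) auto
  also have "\<dots> = 1 * l ^ 7" by (simp add: eval_nat_numeral)
  also have "\<dots> \<le> G * l ^ 7" using G l by (intro mult_right_mono) auto
  finally show ?thesis using D e by (simp add: add_increasing2)
qed

lemma cost_sum_bound:
  fixes a b c k q h G l X Y :: real
  assumes nonneg: "0 \<le> a" "0 \<le> b" "0 \<le> c" "0 \<le> k" "0 \<le> q" "0 \<le> Y" "1 \<le> X"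
    and le: "h \<le> Y" "G \<le> X" "l \<le> X" "G * l \<le> X" "h * l \<le> X + Y"
  shows "2 * b * h + a * G + 2 + c * l * (b * h + a * G + 1) + k * Y + q
    \<le> 2 * (2 * b + a + 2 + c * (b + a + 1) + k + q) * max X Y"
proof -
  let ?Z = "X + Y"
  have 1: "2 * b * h \<le> 2 * b * ?Z" "a * G \<le> a * ?Z" "k * Y \<le> k * ?Z" "q * 1 \<le> q * ?Z"
    using nonneg le by (intro mult_left_mono; simp)+
  have 2: "c * (b * (h * l)) \<le> c * (b * ?Z)" "c * (a * (G * l)) \<le> c * (a * ?Z)" "c * l \<le> c * ?Z"
    using nonneg le by (intro mult_left_mono; simp)+
  have "2 * b * h + a * G + 2 + c * l * (b * h + a * G + 1) + k * Y + q =
      2 * b * h + a * G + 2 + (c * (b * (h * l)) + c * (a * (G * l)) + c * l) + k * Y + q * 1"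
    by (simp add: algebra_simps)
  also have "\<dots> \<le> 2 * b * ?Z + a * ?Z + 2 * ?Z + (c * (b * ?Z) + c * (a * ?Z) + c * ?Z) + k * ?Z + q * ?Z"
    using nonneg by (intro add_mono 1 2) auto
  also have "\<dots> = (2 * b + a + 2 + c * (b + a + 1) + k + q) * ?Z" by (simp add: algebra_simps)
  also have "\<dots> \<le> (2 * b + a + 2 + c * (b + a + 1) + k + q) * (2 * max X Y)"
    using nonneg by (intro mult_left_mono add_nonneg_nonneg mult_nonneg_nonneg) auto
  finally show ?thesis by (simp only: mult_ac)
qed

theorem theorem6:
  fixes \<delta> Lg LH \<sigma> \<omega> \<mu> \<theta> \<rho>S \<rho>N \<rho>C \<Delta> :: real
  assumes "0 < \<delta>" "\<delta> < 1"
    and "0 \<le> Lg" "0 \<le> LH" "0 < \<sigma>" "0 < \<omega>" "0 < \<mu>"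
    and "0 < \<theta>" "0 < \<rho>S" "\<rho>S < 1 / 2" "0 < \<rho>N" "\<rho>N < 1" "0 < \<rho>C" "\<rho>C < 1"
    and "0 \<le> \<Delta>"
  shows "\<exists>(C::real) (p::nat). 0 < C \<and>
    (\<forall>(d::nat) (f :: rseq \<Rightarrow> real) (g :: rseq \<Rightarrow> rseq) (H :: rseq \<Rightarrow> rseq \<Rightarrow> rseq)
        (x0 :: rseq) (xmin :: rseq) (z :: nat \<Rightarrow> real) (\<epsilon>g::real) (\<epsilon>H::real) (\<nu>::real) (P :: params).
       1 \<le> d \<and>
       C2_on (Rn d) f g H \<and>
       xmin \<in> Rn d \<and> (\<forall>x\<in>Rn d. f xmin \<le> f x) \<and>
       x0 \<in> Rn d \<and> f x0 - f xmin \<le> \<Delta> \<and>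
       (\<forall>k. z k = 1 \<or> z k = -1) \<and>
       0 < \<epsilon>g \<and> \<epsilon>g \<le> 1 \<and> 0 < \<epsilon>H \<and> \<epsilon>H \<le> 1 \<and>
       P = \<lparr>eps_g = \<epsilon>g, eps_H = \<epsilon>H, theta = \<theta>, rho_S = \<rho>S, rho_N = \<rho>N, rho_C = \<rho>C\<rparr> \<and>
       relevant_hessian_bounded (Rn d) g H Lg \<and>
       lipschitz_hessian (Rn d) H LH \<and>
       krylov_regular_I (Rn d) g H \<sigma> \<and>
       (AE \<xi> in draws d. krylov_regular_II P f g H z x0 \<omega> \<xi>) \<and>
       Lg\<^sup>2 / (Lg\<^sup>2 + \<theta>\<^sup>2 * \<epsilon>g) \<le> \<nu> \<and> \<nu> \<le> 1 \<and>
       spectral_assumption (Rn d) g H \<mu> \<nu>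
       \<longrightarrow>
       (\<exists>E\<in>sets (draws d). measure (draws d) E \<ge> 1 - \<delta> \<and>
          (\<forall>\<xi>\<in>E. \<exists>k x. newton_mr P f g H z x0 \<xi> k = Some x \<and>
             second_order_optimal (Rn d) P g H x \<and>
             real (evals P f g H z x0 \<xi> k)
               \<le> max (C * \<epsilon>g powr (-3/2) * (1 + ln (1 / \<epsilon>g)) ^ p)
                     (C * (1 + ln (real d)) * \<epsilon>H powr (-7/2)))))"
proof -
  \<comment> \<open>\<open>Lg\<close> and \<open>LH\<close> may be zero, but the constants below divide by their replacements\<close>
  define L R where "L = LH + 1" and "R = Lg + 1"
  have LR: "0 < L" "0 < R" using assms by (auto simp: L_def R_def)
  \<comment> \<open>\<open>f\<close> decreases by \<open>ca \<epsilon>g\<^sup>3\<^sup>/\<^sup>2\<close> or by \<open>cb \<epsilon>H\<^sup>3\<close>; a call at a large gradient takes at most \<open>c (1 + ln (1/\<epsilon>g))\<close> iterations\<close>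
  define ca where "ca = min (\<rho>S * \<sigma> * (min (\<sigma> * (1 / 2 - \<rho>S) / L) (1 / (\<theta> * R / \<sigma> + L + 1)))\<^sup>2)
      (\<rho>N * sqrt ((1 - \<rho>N) / L) * (\<omega> * sqrt \<omega>))"
  define cb where "cb = \<rho>C * (1 - \<rho>C)\<^sup>2 / (64 * L\<^sup>2)"
  define c where "c = 2 + (R / \<sigma>)\<^sup>2 * (ln (1 + R\<^sup>2 / \<theta>\<^sup>2) + 1)"
  define a b where "a = \<Delta> / ca" and "b = \<Delta> / cb"
  define k where "k = 6 * sqrt (8 * (R + 3 * L + 2)) * b / \<delta>"
  define C where "C = 2 * (2 * b + a + 2 + c * (b + a + 1) + k + 1 / \<delta>)"
  have "0 < \<theta> * R / \<sigma> + L + 1" using assms LR by (intro add_pos_pos divide_pos_pos mult_pos_pos) auto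
  then have "0 < min (\<sigma> * (1 / 2 - \<rho>S) / L) (1 / (\<theta> * R / \<sigma> + L + 1))"
    using assms LR by (simp add: min_less_iff_conj)
  then have "0 < \<rho>S * \<sigma> * (min (\<sigma> * (1 / 2 - \<rho>S) / L) (1 / (\<theta> * R / \<sigma> + L + 1)))\<^sup>2"
    using assms by (intro mult_pos_pos zero_less_power) auto
  moreover have "0 < \<rho>N * sqrt ((1 - \<rho>N) / L) * (\<omega> * sqrt \<omega>)"
    using assms LR by (intro mult_pos_pos) auto
  ultimately have ca: "0 < ca" by (simp add: ca_def)
  have cb: "0 < cb" using assms LR by (simp add: cb_def)
  have ln0: "0 \<le> ln (1 + R\<^sup>2 / \<theta>\<^sup>2)" by (intro ln_ge_zero) auto
  have nonneg: "0 \<le> a" "0 \<le> b" "0 \<le> c" "0 \<le> k" "0 \<le> 1 / \<delta>"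
    using assms LR ca cb ln0 by (auto simp: a_def b_def c_def k_def intro!: add_nonneg_nonneg mult_nonneg_nonneg)
  have "0 \<le> 2 * b + a + c * (b + a + 1) + k + 1 / \<delta>" using nonneg by simp
  then have C: "0 < C" by (simp add: C_def)
  show ?thesis
  proof (intro exI[of _ C] exI[of _ 7] conjI C allI impI, elim conjE)
    fix d f g H x0 xmin z \<epsilon>g \<epsilon>H \<nu> P
    assume d: "1 \<le> d" and C2: "C2_on (Rn d) f g H" and xmin: "\<forall>x\<in>Rn d. f xmin \<le> f x"
      and x0: "x0 \<in> Rn d" and \<Delta>: "f x0 - f xmin \<le> \<Delta>" and z: "\<forall>k. z k = 1 \<or> z k = -1"
      and eg: "0 < \<epsilon>g" "\<epsilon>g \<le> 1" and eH: "0 < \<epsilon>H" "\<epsilon>H \<le> 1"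
      and P: "P = \<lparr>eps_g = \<epsilon>g, eps_H = \<epsilon>H, theta = \<theta>, rho_S = \<rho>S, rho_N = \<rho>N, rho_C = \<rho>C\<rparr>"
      and rel: "relevant_hessian_bounded (Rn d) g H Lg" and lip: "lipschitz_hessian (Rn d) H LH"
      and I: "krylov_regular_I (Rn d) g H \<sigma>" and II: "AE \<xi> in draws d. krylov_regular_II P f g H z x0 \<omega> \<xi>"
    have "lipschitz_hessian (Rn d) H L" unfolding lipschitz_hessian_def
    proof (intro ballI)
      fix x y assume "x \<in> Rn d" "y \<in> Rn d"
      then have "opnorm_on (Rn d) (\<lambda>v. H x v - H y v) \<le> LH * norm (x - y)"
        using lip by (simp add: lipschitz_hessian_def)
      also have "\<dots> \<le> L * norm (x - y)" by (intro mult_right_mono) (auto simp: L_def)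
      finally show "opnorm_on (Rn d) (\<lambda>v. H x v - H y v) \<le> L * norm (x - y)" .
    qed
    then interpret F: lipschitz_hessian_function "Rn d" f g H L
      using C2 LR by unfold_locales (auto intro: fin_dim_Rn)
    have Rb: "\<bar>l\<bar> \<le> R" if "x \<in> Rn d" "l \<in> relevant (Rn d) (H x) (g x)" for x l
    proof -
      have "\<bar>l\<bar> \<le> max 0 (UtAU_norm (U_all (Rn d) (H x) (g x)) (H x))"
        using F.symmetric_operator_H[OF that(1)] that(2) by (rule symmetric_operator.relevant_le_UtAU_norm)
      also have "\<dots> \<le> Lg" using rel that(1) assms by (simp add: relevant_hessian_bounded_def)
      finally show ?thesis by (simp add: R_def)
    qed
    interpret N: newton_mr_Rn d f g H L P \<sigma> R "f xmin"
      using assms eg eH I xmin d LR Rb by unfold_locales (auto simp: P)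
    have Pf: "eps_g P = \<epsilon>g" "eps_H P = \<epsilon>H" "theta P = \<theta>" "rho_S P = \<rho>S" "rho_N P = \<rho>N" "rho_C P = \<rho>C"
      by (simp_all add: P)
    define l where "l = 1 + ln (1 / \<epsilon>g)"
    define D where "D = 1 + ln (real d)"
    define h where "h = 1 / \<epsilon>H ^ 3"
    define G where "G = 1 / (\<epsilon>g * sqrt \<epsilon>g)"
    have l: "1 \<le> l" using eg by (simp add: l_def)
    have D: "1 \<le> D" using d by (simp add: D_def)
    have "\<epsilon>g * sqrt \<epsilon>g \<le> 1 * 1" using eg by (intro mult_mono) auto
    then have G: "1 \<le> G" using eg by (simp add: G_def)
    define X where "X = G * l ^ 7"
    define Y where "Y = D * (1 / (\<epsilon>H ^ 3 * sqrt \<epsilon>H))"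
    have l7: "1 \<le> l ^ 7" "l \<le> l ^ 7" using l self_le_power[of l 7] by (auto intro: one_le_power)
    have X: "1 \<le> X" "G \<le> X" "l \<le> X" "G * l \<le> X"
      using mult_mono[OF G l7(1)] mult_mono[OF order.refl l7(1), of G] mult_mono[OF G l7(2)]
        mult_mono[OF order.refl l7(2), of G] G l by (auto simp: X_def)
    have "h \<le> 1 / (\<epsilon>H ^ 3 * sqrt \<epsilon>H)"
      unfolding h_def using eH by (intro divide_left_mono) (auto simp: mult_left_le)
    also have "\<dots> \<le> Y" unfolding Y_def using D eH mult_right_mono[of 1 D "1 / (\<epsilon>H ^ 3 * sqrt \<epsilon>H)"] by simp
    finally have hY: "h \<le> Y" .
    have Y0: "0 \<le> Y" using D eH by (simp add: Y_def)
    have mixed: "h * l \<le> X + Y"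
      unfolding h_def X_def Y_def by (rule mixed_term_bound[OF eH l G D])
    have drops: "N.curvature_drop = cb * \<epsilon>H ^ 3" "N.gradient_drop \<omega> = ca * (\<epsilon>g * sqrt \<epsilon>g)"
      by (simp_all add: N.curvature_drop_def N.curvature_const_def N.gradient_drop_def N.newton_const_def
          N.npc_const_def Pf ca_def cb_def)
    have bh: "1 / N.curvature_drop * \<Delta> = b * h" and aG: "1 / N.gradient_drop \<omega> * \<Delta> = a * G"
      by (simp_all add: drops a_def b_def h_def G_def)
    have large: "N.large_cost \<le> c * l"
    proof -
      have "1 + R\<^sup>2 / N.tol\<^sup>2 = 1 + R\<^sup>2 / \<theta>\<^sup>2 * (1 / \<epsilon>g)"
        using eg by (simp add: Pf power_mult_distrib)
      also have "\<dots> \<le> 1 / \<epsilon>g + R\<^sup>2 / \<theta>\<^sup>2 * (1 / \<epsilon>g)" using eg by simp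
      also have "\<dots> = (1 + R\<^sup>2 / \<theta>\<^sup>2) * (1 / \<epsilon>g)" by (simp only: distrib_right mult_1_left)
      finally have le: "1 + R\<^sup>2 / N.tol\<^sup>2 \<le> (1 + R\<^sup>2 / \<theta>\<^sup>2) * (1 / \<epsilon>g)" .
      have pos: "0 < 1 + R\<^sup>2 / N.tol\<^sup>2" "0 < 1 + R\<^sup>2 / \<theta>\<^sup>2" by (intro add_pos_nonneg; simp)+
      have "ln (1 + R\<^sup>2 / N.tol\<^sup>2) \<le> ln ((1 + R\<^sup>2 / \<theta>\<^sup>2) * (1 / \<epsilon>g))" using le pos by (intro ln_mono) auto
      also have "\<dots> = ln (1 + R\<^sup>2 / \<theta>\<^sup>2) + ln (1 / \<epsilon>g)" using pos eg by (intro ln_mult_pos) auto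
      also have "\<dots> = ln (1 + R\<^sup>2 / \<theta>\<^sup>2) * 1 + (l - 1)" by (simp add: l_def)
      also have "\<dots> \<le> ln (1 + R\<^sup>2 / \<theta>\<^sup>2) * l + l" using ln0 l by (intro add_mono mult_left_mono) auto
      finally have "(R / \<sigma>)\<^sup>2 * ln (1 + R\<^sup>2 / N.tol\<^sup>2) \<le> (R / \<sigma>)\<^sup>2 * (ln (1 + R\<^sup>2 / \<theta>\<^sup>2) * l + l)"
        by (intro mult_left_mono) auto
      then show ?thesis using l by (simp add: N.large_cost_def c_def algebra_simps)
    qed
    have budget: "N.npc_budget / N.curvature_drop * \<Delta> / \<delta> = k * Y"
    proof -
      have "N.overlap_rate = sqrt \<epsilon>H / sqrt (8 * (R + 3 * L + 2))"
        by (simp only: N.overlap_rate_def Pf real_sqrt_divide)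
      then have "N.npc_budget = 6 * D * sqrt (8 * (R + 3 * L + 2)) / sqrt \<epsilon>H"
        by (simp only: N.npc_budget_def D_def divide_divide_eq_right)
      then show ?thesis by (simp add: drops b_def k_def Y_def mult_ac)
    qed
    have total: "(2 / N.curvature_drop + 1 / N.gradient_drop \<omega>) * \<Delta> + 2 +
        N.large_cost * ((1 / N.curvature_drop + 1 / N.gradient_drop \<omega>) * \<Delta> + 1) +
        (N.npc_budget / N.curvature_drop * \<Delta> + 1) / \<delta> \<le> C * max X Y"
    proof -
      have "(2 / N.curvature_drop + 1 / N.gradient_drop \<omega>) * \<Delta> =
          2 * (1 / N.curvature_drop * \<Delta>) + 1 / N.gradient_drop \<omega> * \<Delta>"
        by (simp add: distrib_right)
      then have e1: "(2 / N.curvature_drop + 1 / N.gradient_drop \<omega>) * \<Delta> = 2 * b * h + a * G"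
        unfolding bh aG by simp
      have e2: "(1 / N.curvature_drop + 1 / N.gradient_drop \<omega>) * \<Delta> = b * h + a * G"
        unfolding distrib_right bh aG ..
      have e3: "(N.npc_budget / N.curvature_drop * \<Delta> + 1) / \<delta> = k * Y + 1 / \<delta>"
        unfolding add_divide_distrib budget ..
      have "0 \<le> b * h + a * G + 1" using nonneg G eH by (simp add: h_def)
      then have "N.large_cost * (b * h + a * G + 1) \<le> c * l * (b * h + a * G + 1)"
        by (rule mult_right_mono[OF large])
      then have "(2 / N.curvature_drop + 1 / N.gradient_drop \<omega>) * \<Delta> + 2 +
          N.large_cost * ((1 / N.curvature_drop + 1 / N.gradient_drop \<omega>) * \<Delta> + 1) +
          (N.npc_budget / N.curvature_drop * \<Delta> + 1) / \<delta> \<le>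
          2 * b * h + a * G + 2 + c * l * (b * h + a * G + 1) + k * Y + 1 / \<delta>"
        unfolding e1 e2 e3 by simp
      also have "\<dots> \<le> C * max X Y"
        unfolding C_def by (rule cost_sum_bound[OF nonneg(1-5) Y0 X(1) hY X(2-4) mixed])
      finally show ?thesis .
    qed
    have "C * max X Y = max (C * X) (C * Y)" using C by (simp add: max_mult_distrib_left)
    also have "C * X = C * \<epsilon>g powr (-3/2) * (1 + ln (1 / \<epsilon>g)) ^ 7"
      by (simp only: X_def G_def inverse_powers_as_powr(1)[OF eg(1)] l_def mult.assoc)
    also have "C * Y = C * (1 + ln (real d)) * \<epsilon>H powr (-7/2)"
      by (simp only: Y_def D_def inverse_powers_as_powr(2)[OF eH(1)] mult.assoc)
    finally have max_eq: "C * max X Y = max (C * \<epsilon>g powr (-3/2) * (1 + ln (1 / \<epsilon>g)) ^ 7)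
        (C * (1 + ln (real d)) * \<epsilon>H powr (-7/2))" .
    have "N.signs z" using z by (simp add: N.signs_def)
    from N.high_probability_bound[OF this x0 assms(6,1,2) II \<Delta>]
    show "\<exists>E\<in>sets (draws d). measure (draws d) E \<ge> 1 - \<delta> \<and>
          (\<forall>\<xi>\<in>E. \<exists>k x. newton_mr P f g H z x0 \<xi> k = Some x \<and>
             second_order_optimal (Rn d) P g H x \<and>
             real (evals P f g H z x0 \<xi> k)
               \<le> max (C * \<epsilon>g powr (-3/2) * (1 + ln (1 / \<epsilon>g)) ^ 7)
                     (C * (1 + ln (real d)) * \<epsilon>H powr (-7/2)))"
      using total unfolding max_eq by (meson order.trans)
  qed
qed

end
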